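(* Let $Y_n=(Y_n(t))_{t\in[0,1]}$ be the normalized Quicksort-on-the-fly process and $Y=R^\emptyset$ the Quicksort process, both defined in the context. Then all finite dimensional distributions of $(Y_n(t))_{0<t\le1}$ converge to those of $(Y(t))_{0<t\le1}$: for every $k\in\mathbb N$ and all $t_1,\dots,t_k\in(0,1]$, $(Y_n(t_1),\dots,Y_n(t_k))$ converges in distribution to $(Y(t_1),\dots,Y(t_k))$ as $n\to\infty$.
   Context: Quicksort on the fly: given $n$ distinct reals, choose a pivot uniformly at random, split into the smaller elements, the pivot and the larger elements, and always recursively continue on the leftmost unfinished sublist (outputting singletons immediately), so that the elements are output in increasing order. $X(n,l)$ is the number of comparisons made until the $l$-th smallest element is identified, $1\le l\le n$. Its joint law is characterized by: $X(n,0)=0$ for all $n$, $X(0,\cdot)=X(1,\cdot)\equiv0$, and for $n\ge2$, jointly in $l=1,\dots,n$, $X(n,l)\overset{d}{=}n-1+\mathbf 1_{l<I_n}X^1(I_n-1,l)+\mathbf 1_{l\ge I_n}\big(X^1(I_n-1,I_n-1)+X^2(n-I_n,l-I_n)\big)$, where $I_n$ is uniform on $\{1,\dots,n\}$, $(X^1(j,\cdot))_j,(X^2(j,\cdot))_j$ are independent copies of $(X(j,\cdot))_j$, independent of $I_n$. Define $Y_n(t)=\big(X(n,\lfloor nt\rfloor)-E X(n,\lfloor nt\rfloor)\big)/n$ for $t\in[0,1]$. The Quicksort process $Y$: Let $V=\bigcup_{k\ge0}\{1,2\}^k$ be the binary tree of finite words over $\{1,2\}$ (root $\emptyset$, concatenation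 $vw$, $V_{<m}$ the words of length $<m$), $(U^v)_{v\in V}$ i.i.d. uniform on $[0,1]$, $C(x)=1+2x\ln x+2(1-x)\ln(1-x)$ (with $0\ln0=0$), $C(t,x)=C(x)+2\,\mathbf 1_{t<x}\big(-1+x+(1-t)\ln(1-t)-(1-x)\ln(1-x)-(x-t)\ln(x-t)\big)$. Put $\ell^v_\emptyset=1$, $\ell^v_{w1}=\ell^v_wU^{vw}$, $\ell^v_{w2}=\ell^v_w(1-U^{vw})$, $Q^v=\lim_m\sum_{w\in V_{<m}}\ell^v_wC(U^{vw})$ (a.s. and $L_2$ limit). Define maps on functions $h:[0,1]\to\mathbb R$ by $(T^v_1h)(t)=\mathbf 1_{t<U^v}U^vh(1\wedge t/U^v)$, $(T^v_2h)(t)=\mathbf 1_{t\ge U^v}(1-U^v)h\big(0\vee\frac{t-U^v}{1-U^v}\big)$, $C^v(t)=C(t,U^v)+\mathbf 1_{t\ge U^v}U^vQ^{v1}$, $L^v_\emptyset=\mathrm{id}$, $L^v_{wi}=L^v_w\circ T^{vw}_i$, $R^v_m=\sum_{w\in V_{<m}}L^v_w(C^{vw})$. Then $R^\emptyset_m$ converges a.s. uniformly on $[0,1]$ to a càdlàg random function $R^\emptyset$, and $Y:=R^\emptyset$. *)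

theory Defs
  imports "HOL-Probability.Probability"
begin

text \<open>qs n is the joint law of the function l \<mapsto> X(n,l); only l \<in> {0..n} is meaningful.
  X(n,0) = 0, X(0,.) = X(1,.) = 0, and for n \<ge> 2 the distributional recursion with
  I_n uniform on {1..n} and independent copies X^1, X^2.\<close>

function qs :: "nat \<Rightarrow> (nat \<Rightarrow> nat) pmf" where
  "qs n = (if n \<le> 1 then return_pmf (\<lambda>_. 0) else
     bind_pmf (pmf_of_set {1..n}) (\<lambda>i.
     bind_pmf (qs (i - 1)) (\<lambda>x1.
     bind_pmf (qs (n - i)) (\<lambda>x2.
     return_pmf (\<lambda>l. if l = 0 then 0 else
        n - 1 + (if l < i then x1 l else x1 (i - 1) + x2 (l - i)))))))"
  by auto
termination
  by (relation "Wellfounded.measure id") (auto simp: set_pmf_of_set)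

definition Yn :: "nat \<Rightarrow> (nat \<Rightarrow> nat) \<Rightarrow> real \<Rightarrow> real" where
  "Yn n x t = (let l = nat \<lfloor>real n * t\<rfloor> in
     (real (x l) - measure_pmf.expectation (qs n) (\<lambda>y. real (y l))) / real n)"

text \<open>Words over {1,2} are encoded as bool lists: False = 1, True = 2. Concatenation vw = v @ w.
  A sample is U :: bool list \<Rightarrow> real, with U v = U^v.\<close>

definition xlnx :: "real \<Rightarrow> real" where
  "xlnx x = (if x = 0 then 0 else x * ln x)"

definition Cfun :: "real \<Rightarrow> real" where
  "Cfun x = 1 + 2 * xlnx x + 2 * xlnx (1 - x)"

definition Cfun2 :: "real \<Rightarrow> real \<Rightarrow> real" where
  "Cfun2 t x = Cfun x + 2 * (if t < x then
      -1 + x + xlnx (1 - t) - xlnx (1 - x) - xlnx (x - t) else 0)"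

definition Vlt :: "nat \<Rightarrow> bool list set" where
  "Vlt m = {w. length w < m}"

text \<open>ell^v_w: ell^v_[] = 1, ell^v_{w1} = ell^v_w U^{vw}, ell^v_{w2} = ell^v_w (1 - U^{vw})\<close>
definition ell :: "(bool list \<Rightarrow> real) \<Rightarrow> bool list \<Rightarrow> bool list \<Rightarrow> real" where
  "ell U v w = (\<Prod>j<length w. if w ! j then 1 - U (v @ take j w) else U (v @ take j w))"

definition Qv :: "(bool list \<Rightarrow> real) \<Rightarrow> bool list \<Rightarrow> real" where
  "Qv U v = lim (\<lambda>m. \<Sum>w\<in>Vlt m. ell U v w * Cfun (U (v @ w)))"

definition T1 :: "real \<Rightarrow> (real \<Rightarrow> real) \<Rightarrow> real \<Rightarrow> real" where
  "T1 u h t = (if t < u then u * h (min 1 (t / u)) else 0)"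

definition T2 :: "real \<Rightarrow> (real \<Rightarrow> real) \<Rightarrow> real \<Rightarrow> real" where
  "T2 u h t = (if t \<ge> u then (1 - u) * h (max 0 ((t - u) / (1 - u))) else 0)"

definition Tv :: "(bool list \<Rightarrow> real) \<Rightarrow> bool list \<Rightarrow> bool \<Rightarrow> (real \<Rightarrow> real) \<Rightarrow> real \<Rightarrow> real" where
  "Tv U v i = (if i then T2 (U v) else T1 (U v))"

definition Cv :: "(bool list \<Rightarrow> real) \<Rightarrow> bool list \<Rightarrow> real \<Rightarrow> real" where
  "Cv U v t = Cfun2 t (U v) + (if t \<ge> U v then U v * Qv U (v @ [False]) else 0)"

text \<open>L^v_w; L^v_[] = id and L^v_{iw} = T^v_i o L^{vi}_w, equivalent to L^v_{wi} = L^v_w o T^{vw}_i.\<close>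
fun Lv :: "(bool list \<Rightarrow> real) \<Rightarrow> bool list \<Rightarrow> bool list \<Rightarrow> (real \<Rightarrow> real) \<Rightarrow> real \<Rightarrow> real" where
  "Lv U v [] h = h"
| "Lv U v (i # w) h = Tv U v i (Lv U (v @ [i]) w h)"

definition Rm :: "(bool list \<Rightarrow> real) \<Rightarrow> bool list \<Rightarrow> nat \<Rightarrow> real \<Rightarrow> real" where
  "Rm U v m t = (\<Sum>w\<in>Vlt m. Lv U v w (Cv U (v @ w)) t)"

text \<open>Y = R^\<emptyset>, the (a.s. uniform, in particular pointwise) limit of R^\<emptyset>_m\<close>
definition Yproc :: "(bool list \<Rightarrow> real) \<Rightarrow> real \<Rightarrow> real" where
  "Yproc U t = lim (\<lambda>m. Rm U [] m t)"

definition Uspace :: "(bool list \<Rightarrow> real) measure" where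
  "Uspace = PiM UNIV (\<lambda>_. uniform_measure lborel {0..1})"

definition conv_in_dist :: "(nat \<Rightarrow> 'a::topological_space measure) \<Rightarrow> 'a measure \<Rightarrow> bool" where
  "conv_in_dist Ms M \<longleftrightarrow>
     (\<forall>f :: 'a \<Rightarrow> real. continuous_on UNIV f \<and> bounded (range f) \<longrightarrow>
        (\<lambda>n. \<integral>x. f x \<partial>Ms n) \<longlonglongrightarrow> (\<integral>x. f x \<partial>M))"

end

theory Submission
  imports Defs "HOL-Real_Asymp.Real_Asymp"
begin

text \<open>
  Realise \<open>X(n,l)\<close> on the space of the \<open>U\<^sup>v\<close> by choosing the pivot rank \<open>\<lceil>n U\<^sup>v\<rceil>\<close> at the node \<open>v\<close>.
  With the closed form of the means, the toll of the centred and scaled recursion differs from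
  \<open>C(t,x)\<close> by \<open>O(log n / n)\<close>. Let \<open>G\<close> be an approximation of the limit whose asymptotic mean squared
  error is at most \<open>K\<close> along all sequences \<open>l/n \<rightarrow> t\<close>, for all \<open>t \<in> (0,1]\<close>. Inserting \<open>G\<close> once into
  the limit recursion and conditioning on the first split, the reverse Fatou lemma bounds the
  new error by \<open>K\<close> times \<open>E(U\<^sup>2 + (1-U)\<^sup>2) = 2/3\<close>; cross terms vanish because the processes are centred.
  Starting from \<open>G = 0\<close>, the partial sums of \<open>Q\<close> and then of \<open>R\<close> have errors \<open>O((2/3)\<^sup>m)\<close>, uniformly in \<open>t\<close>.
  This forces their almost sure convergence and gives \<open>E(Y\<^sub>n(t) - Y(t))\<^sup>2 \<rightarrow> 0\<close> for each \<open>t\<close>.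
\<close>

section \<open>Expected costs and tolls\<close>

text \<open>All objects live on one sample space, so convergence in law reduces to mean square
  convergence at each fixed time and no metric on laws enters. The toll \<open>Cv\<close> contains
  the full limit \<open>Qv\<close> of the left subtree; hence the same contraction argument runs
  twice, the round for \<open>Qv\<close> being the case of the single time \<open>t = 1\<close>. The
  obstacle is that after a split the subproblem has a new size and a rank whose ratio is only close
  to the rescaled time, while \<open>Cfun2\<close> jumps when the time crosses the pivot.
  Controlling the error along all sequences of ratios tending to \<open>t\<close> makes the property
  stable under splitting, and the toll converges unless the pivot sits exactly at the time, which is
  a null event. Time \<open>0\<close> stays outside because ratios tending to \<open>0\<close> may
  come from rank \<open>0\<close>, where the recursion has no toll. No constant below is optimised;
  only the factor \<open>2 / 3\<close> has to be exact enough to stay below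
  \<open>1\<close>.\<close>

definition meanX :: "nat \<Rightarrow> nat \<Rightarrow> real" where
  "meanX n l = (if l = 0 then 0 else 2 * real n + 2 * (real n + 1) * harm n
     - 2 * (real n + 3 - real l) * harm (n + 1 - l) - 6 * real l + 6)"

lemma sum_harm: "(\<Sum>k<n. harm k) = real n * harm n - real n"
proof (induction n)
  case (Suc n)
  show ?case by (simp only: sum.lessThan_Suc Suc.IH harm_Suc) (simp add: field_simps)
qed simp

lemma sum_mult_harm:
  "(\<Sum>k<n. real k * harm k) = real n * (real n - 1) / 2 * harm n - real n * (real n - 1) / 4"
proof (induction n)
  case (Suc n)
  show ?case by (simp only: sum.lessThan_Suc Suc.IH harm_Suc) (simp add: field_simps)
qed simp

lemma sum_real_lessThan: "(\<Sum>k<n. real k) = real n * (real n - 1) / 2"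
  by (induction n) (auto simp: field_simps)

text \<open>Rank \<open>l = n\<close> gives the classical mean of Quicksort. For general
  \<open>l\<close>, \<open>meanX n l\<close> is the mean cost of partial Quicksort, which sorts only
  the \<open>l\<close> smallest of \<open>n\<close> elements.\<close>

lemma meanX_diag: "meanX n n = 2 * (real n + 1) * harm n - 4 * real n"
  by (cases n) (auto simp: meanX_def harm_expand algebra_simps)

text \<open>The closed form at rank \<open>0\<close> is not \<open>0\<close>, hence the case distinction in \<open>meanX\<close>; it matters for the
  pivot of rank \<open>l\<close> itself, which contributes \<open>meanX (n - l) 0 = 0\<close>.\<close>

lemma meanX_recursion:
  assumes "2 \<le> n" "1 \<le> l" "l \<le> n"
  shows "(\<Sum>i=1..n. real n - 1 + (if l < i then meanX (i - 1) l else meanX (i - 1) (i - 1) + meanX (n - i) (l - i)))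
    = real n * meanX n l"
proof -
  have split: "{1..n} = {1..<l} \<union> {l} \<union> {l<..n}" using assms by auto
  define p where "p = n - l"
  have n: "n = l + p" using assms by (simp add: p_def)
  let ?f = "\<lambda>i. if l < i then meanX (i - 1) l else meanX (i - 1) (i - 1) + meanX (n - i) (l - i)"
  have A: "(\<Sum>i\<in>{l<..n}. ?f i) = (\<Sum>j<p. meanX (l + j) l)"
    by (rule sum.reindex_bij_witness[of _ "\<lambda>j. l + j + 1" "\<lambda>i. i - l - 1"]) (auto simp: n)
  have B: "(\<Sum>i\<in>{1..<l}. meanX (i - 1) (i - 1)) = (\<Sum>j<l - 1. meanX j j)"
    by (rule sum.reindex_bij_witness[of _ "\<lambda>j. j + 1" "\<lambda>i. i - 1"]) auto
  have C: "(\<Sum>i\<in>{1..<l}. meanX (n - i) (l - i)) = (\<Sum>j<l - 1. meanX (p + 1 + j) (j + 1))"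
    by (rule sum.reindex_bij_witness[of _ "\<lambda>j. l - 1 - j" "\<lambda>i. l - 1 - i"]) (auto simp: n Suc_diff_Suc add.commute)
  have S: "(\<Sum>i=1..n. ?f i) = (\<Sum>i\<in>{1..<l}. ?f i) + ?f l + (\<Sum>i\<in>{l<..n}. ?f i)"
    unfolding split by (subst sum.union_disjoint; (subst sum.union_disjoint)?) auto
  obtain m where m: "l = Suc m" using assms by (cases l) auto
  have D1: "(\<Sum>j<q. meanX j j) = 2 * (\<Sum>j<q. real j * harm j) + 2 * (\<Sum>j<q. harm j) - 4 * (\<Sum>j<q. real j)" for q
    by (induction q) (auto simp: meanX_diag algebra_simps)
  \<comment> \<open>With the rank fixed, \<open>meanX (l + j) l\<close> is a function of
    \<open>l + j\<close>, whose sum is a difference of two prefix sums, plus a function of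
    \<open>j\<close>. In \<open>C1\<close> it is size minus rank that is fixed, so the second
    harmonic number is the constant \<open>harm (p + 1)\<close>.\<close>
  have A1: "(\<Sum>j<q. meanX (l + j) l) = (\<Sum>k<l + q. 2 * real k + 2 * (real k + 1) * harm k)
     - (\<Sum>k<l. 2 * real k + 2 * (real k + 1) * harm k)
     - (\<Sum>j<q. 2 * (real j + 3) * harm (Suc j)) - 6 * real q * real l + 6 * real q" for q
    by (induction q) (auto simp: meanX_def m algebra_simps)
  have A2: "(\<Sum>j<q. 2 * (real j + 3) * harm (Suc j)) = 
     (real q * (real q + 1) + 4 * (real q + 1)) * harm (Suc q) - real q * (real q + 1) / 2 - 4 * (real q + 1)" for q
  proof (induction q)
    case (Suc q)
    show ?case unfolding sum.lessThan_Suc Suc.IH harm_Suc[of "Suc q"] by (simp add: field_simps)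
  qed (simp add: harm_expand)
  have A3: "(\<Sum>k<q. 2 * real k + 2 * (real k + 1) * harm k) = 
     real q * (real q - 1) / 2 + real q * (real q + 1) * harm q - 2 * real q" for q
  proof (induction q)
    case (Suc q)
    show ?case unfolding sum.lessThan_Suc Suc.IH by (simp add: harm_Suc field_simps)
  qed (simp add: harm_expand)
  have C1: "(\<Sum>j<q. meanX (p + 1 + j) (j + 1)) = (\<Sum>k<p + 1 + q. 2 * real k + 2 * (real k + 1) * harm k)
     - (\<Sum>k<p + 1. 2 * real k + 2 * (real k + 1) * harm k)
     - 2 * (real p + 3) * harm (p + 1) * real q - 3 * real q * (real q + 1) + 6 * real q" for q
    by (induction q) (auto simp: meanX_def algebra_simps)
  have "(\<Sum>i=1..n. real n - 1 + ?f i) = real n * (real n - 1) + (\<Sum>i=1..n. ?f i)"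
    by (simp add: sum.distrib)
  also have "(\<Sum>i=1..n. ?f i) = (\<Sum>j<l. meanX j j) + (\<Sum>j<l - 1. meanX (p + 1 + j) (j + 1)) + (\<Sum>j<p. meanX (l + j) l)"
    unfolding S A using B C by (simp add: sum.distrib m meanX_def[of _ 0])
  also have "real n * (real n - 1) + \<dots> = real n * meanX n l"
    unfolding D1 A1 A2 A3 C1 sum_harm sum_mult_harm sum_real_lessThan
    by (simp add: meanX_def n m field_simps)
  finally show ?thesis .
qed

text \<open>The scale-invariant part of the mean: \<open>xlnx (n x) = n xlnx x + n x ln n\<close> makes the tolls
  formed from \<open>mean0\<close> exactly equal to \<open>Cfun2\<close>, so that only logarithmic errors remain.\<close>

definition mean0 :: "nat \<Rightarrow> nat \<Rightarrow> real" where
  "mean0 n l = 2 * real n + 2 * xlnx (real n) - 2 * xlnx (real n - real l)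
     + (2 * euler_mascheroni - 6) * real l"

text \<open>The conditional mean of \<open>X(n,l)\<close> given the pivot rank \<open>i\<close>,
  centred by its mean and scaled by \<open>n\<close>: the deterministic remainder when every cost in
  the recursion is centred.\<close>

definition toll :: "nat \<Rightarrow> nat \<Rightarrow> nat \<Rightarrow> real" where
  "toll n l i = (real n - 1 + (if l < i then meanX (i - 1) l else meanX (i - 1) (i - 1) + meanX (n - i) (l - i))
     - meanX n l) / real n"

text \<open>A conditional mean minus the mean averages to zero. In the limit this gives the
  vanishing integral of \<open>Cfun\<close>.\<close>

lemma sum_cc:
  assumes "2 \<le> n" "1 \<le> l" "l \<le> n"
  shows "(\<Sum>i=1..n. toll n l i) = 0"
proof -
  have "(\<Sum>i=1..n. toll n l i) = (\<Sum>i=1..n. real n - 1 + (if l < i then meanX (i - 1) l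
      else meanX (i - 1) (i - 1) + meanX (n - i) (l - i)) - meanX n l) / real n"
    by (simp add: toll_def sum_divide_distrib)
  also have "\<dots> = 0"
    unfolding sum_subtractf meanX_recursion[OF assms] by simp
  finally show ?thesis .
qed

section \<open>Logarithmic error bounds for means and tolls\<close>

lemma harm_le: "harm n \<le> 1 + ln (real n)" if "1 \<le> n"
  using euler_mascheroni_sequence_decreasing[of 1 n] that by (simp add: harm_expand)

lemma harm_le_mono: "harm p \<le> 1 + ln (real n)" if "1 \<le> n" "p \<le> n"
  using harm_le[OF that(1)] harm_mono[OF that(2), where ?'a=real] by linarith

text \<open>The Euler-Mascheroni bounds concern \<open>harm n - ln (n + 1)\<close>; replacing
  \<open>ln (n + 1)\<close> by \<open>ln n\<close> costs at most \<open>1 / n\<close>. The factor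
  \<open>n\<close> turns the logarithm into \<open>xlnx\<close> and keeps the bound true at
  \<open>n = 0\<close>.\<close>

lemma mult_harm_approx: "\<bar>real n * harm n - xlnx (real n) - euler_mascheroni * real n\<bar> \<le> 1"
proof (cases "n = 0")
  case False
  then have n: "n \<ge> 1" by simp
  have 1: "euler_mascheroni \<le> harm n - ln (real n + 1) + 1 / (2 * real n)"
    "euler_mascheroni \<ge> harm n - ln (real n + 1)"
    using euler_mascheroni_bounds[OF n] n by (auto simp: inverse_eq_divide add_ac intro: order_trans[rotated])
  have 2: "ln (real n + 1) - ln (real n) < 1 / real n" by (rule ln_diff_le_inverse) (use n in simp)
  have 3: "ln (real n + 1) - ln (real n) \<ge> 0" using n by simp
  have "\<bar>harm n - ln (real n) - euler_mascheroni\<bar> \<le> 1 / real n"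
    using 1 2 3 by (auto simp: abs_le_iff)
  then have "real n * \<bar>harm n - ln (real n) - euler_mascheroni\<bar> \<le> 1"
    using n by (simp add: field_simps)
  then have "\<bar>real n * (harm n - ln (real n) - euler_mascheroni)\<bar> \<le> 1"
    by (simp add: abs_mult)
  then show ?thesis using n by (simp add: xlnx_def algebra_simps)
qed (simp add: xlnx_def)

text \<open>The exact toll has a left part of size \<open>i - 1\<close>, the scale-invariant
  formulas want size \<open>i\<close>. These increments bound the price of the shift by a
  logarithm.\<close>

lemma xlnx_diff: "0 \<le> xlnx (real (Suc k)) - xlnx (real k)" "xlnx (real (Suc k)) - xlnx (real k) \<le> 1 + ln (real (Suc k))"
proof -
  have "0 \<le> xlnx (real (Suc k)) - xlnx (real k) \<and> xlnx (real (Suc k)) - xlnx (real k) \<le> 1 + ln (real (Suc k))"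
  proof (cases "k = 0")
    case False
    have 2: "ln (real k + 1) - ln (real k) < 1 / real k" by (rule ln_diff_le_inverse) (use False in simp)
    then have "real k * (ln (real k + 1) - ln (real k)) \<le> 1" using False by (simp add: field_simps)
    moreover have "real k * (ln (real k + 1) - ln (real k)) \<ge> 0" using False by simp
    moreover have "xlnx (real (Suc k)) - xlnx (real k) = ln (real k + 1) + real k * (ln (real k + 1) - ln (real k))"
      using False by (simp add: xlnx_def algebra_simps)
    moreover have "ln (real k + 1) \<ge> 0" by simp
    ultimately show ?thesis by (simp add: add.commute)
  qed (simp add: xlnx_def)
  then show "0 \<le> xlnx (real (Suc k)) - xlnx (real k)" "xlnx (real (Suc k)) - xlnx (real k) \<le> 1 + ln (real (Suc k))"
    by auto
qed

lemma meanX_approx: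
  assumes "1 \<le> l" "l \<le> n"
  shows "\<bar>meanX n l - mean0 n l\<bar> \<le> 40 * (1 + ln (real n))"
proof -
  define p where "p = n - l"
  have n: "n = l + p" using assms by (simp add: p_def)
  define h where "h = 1 + ln (real n)"
  have h: "1 \<le> h" using assms by (simp add: h_def)
  have H: "harm n \<le> h" "harm p \<le> h" unfolding h_def by (rule harm_le_mono; use assms n in simp)+
  have H0: "0 \<le> (harm n::real)" "0 \<le> (harm p::real)" by (simp_all add: harm_nonneg)
  define e where "e k = real k * harm k - xlnx (real k) - euler_mascheroni * real k" for k
  have e: "\<bar>e k\<bar> \<le> 1" for k unfolding e_def by (rule mult_harm_approx)
  \<comment> \<open>The index \<open>p + 1\<close> and the factor \<open>p + 3\<close> of the
    harmonic number do not match. Writing the product as \<open>real p * harm p\<close> leaves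
    \<open>3 * harm p\<close>, which is logarithmic, and the bounded \<open>r\<close>.\<close>
  define r where "r = (real p + 3) / (real p + 1)"
  have r: "0 \<le> r" "r \<le> 3" by (auto simp: r_def field_simps)
  have "(real p + 3) * harm (Suc p) = real p * harm p + 3 * harm p + r"
    by (simp add: harm_Suc r_def field_simps)
  then have "meanX n l - mean0 n l = 2 * e n + 2 * harm n - 2 * e p - 6 * harm p - 2 * r + 6"
    using assms by (simp add: meanX_def mean0_def n e_def algebra_simps)
  also have "\<bar>\<dots>\<bar> \<le> 40 * h"
    using e[of n] e[of p] H H0 r h by (auto simp: abs_le_iff)
  finally show ?thesis by (simp add: h_def)
qed

lemma mean0_diag: "mean0 n n = 2 * xlnx (real n) + (2 * euler_mascheroni - 4) * real n"
  by (simp add: mean0_def xlnx_def algebra_simps)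

lemma xlnx_scale: "0 < c \<Longrightarrow> 0 \<le> x \<Longrightarrow> xlnx (c * x) = c * xlnx x + c * x * ln c"
  by (auto simp: xlnx_def ln_mult algebra_simps)

text \<open>After scaling, \<open>ln (real n)\<close> has a coefficient proportional to
  \<open>i - (i - l) - n + (n - l) = 0\<close>, and the terms linear in \<open>l\<close> cancel, so
  the identity is exact with no error term.\<close>

lemma mean0_toll_above:
  assumes "l < i" "i \<le> n"
  shows "(real n + mean0 i l - mean0 n l) / real n = Cfun2 (real l / real n) (real i / real n)"
proof -
  have n: "real n > 0" using assms by simp
  have "real i / real n \<le> 1" "real l / real n < real i / real n" using assms by (auto simp: field_simps)
  have *: "xlnx (real i) = xlnx (real n * (real i / real n))"
     "xlnx (real i - real l) = xlnx (real n * (real i / real n - real l / real n))"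
     "xlnx (real n - real l) = xlnx (real n * (1 - real l / real n))"
    using n by (simp_all add: right_diff_distrib)
  have "xlnx (real i) = real n * xlnx (real i / real n) + real i * ln (real n)"
     "xlnx (real i - real l) = real n * xlnx (real i / real n - real l / real n) + (real i - real l) * ln (real n)"
     "xlnx (real n - real l) = real n * xlnx (1 - real l / real n) + (real n - real l) * ln (real n)"
    unfolding * by (subst xlnx_scale; use n assms in \<open>simp add: field_simps\<close>)+
  moreover have "xlnx (real n) = real n * ln (real n)" using n by (simp add: xlnx_def)
  ultimately show ?thesis using assms n
    by (simp add: Cfun2_def Cfun_def mean0_def divide_strict_right_mono) (simp add: field_simps)
qed

text \<open>The right part and the whole share the term \<open>xlnx (n - l)\<close>, which cancels
  together with the Euler-Mascheroni constant. Hence the value depends on \<open>i\<close> only, in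
  accordance with \<open>Cfun2 t x\<close> being \<open>Cfun x\<close> for
  \<open>t \<ge> x\<close>.\<close>

lemma mean0_toll_below:
  assumes "1 \<le> i" "i \<le> l" "l \<le> n"
  shows "(real n + mean0 i i + mean0 (n - i) (l - i) - mean0 n l) / real n = Cfun2 (real l / real n) (real i / real n)"
proof -
  have n: "real n > 0" using assms by simp
  have *: "xlnx (real i) = xlnx (real n * (real i / real n))"
     "xlnx (real n - real i) = xlnx (real n * (1 - real i / real n))"
    using n by (simp_all add: right_diff_distrib)
  have "xlnx (real i) = real n * xlnx (real i / real n) + real i * ln (real n)"
     "xlnx (real n - real i) = real n * xlnx (1 - real i / real n) + (real n - real i) * ln (real n)"
    unfolding * by (subst xlnx_scale; use n assms in \<open>simp add: field_simps\<close>)+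
  moreover have "xlnx (real n) = real n * ln (real n)" using n by (simp add: xlnx_def)
  moreover have "\<not> real l / real n < real i / real n" using assms n by (simp add: divide_right_mono not_less)
  moreover have "real (n - i) - real (l - i) = real n - real l" "real (n - i) = real n - real i"
     "real (l - i) = real l - real i" using assms by (auto simp: of_nat_diff)
  ultimately show ?thesis using n 
    by (simp add: Cfun2_def Cfun_def mean0_def xlnx_def[of 0]) (simp add: field_simps)
qed

text \<open>Besides the logarithmic errors, the pivot of rank exactly \<open>l\<close> carries an
  error of constant order, which does not vanish with \<open>n\<close>. It is harmless later because
  this rank corresponds to a null set of pivot positions.\<close>

lemma toll_approx:
  assumes "2 \<le> n" "1 \<le> l" "l \<le> n" "1 \<le> i" "i \<le> n"
  shows "\<bar>toll n l i - Cfun2 (real l / real n) (real i / real n)\<bar>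
     \<le> 200 * (1 + ln (real n)) / real n + (if l = i then 2 else 0)"
proof -
  define h where "h = 1 + ln (real n)"
  have h: "1 \<le> h" using assms by (simp add: h_def)
  have n: "real n > 0" using assms by simp
  have hm: "1 + ln (real k) \<le> h" if "k \<le> n" "k \<ge> 1" for k using that by (simp add: h_def)
  have A: "\<bar>meanX k j - mean0 k j\<bar> \<le> 40 * h" if "1 \<le> j" "j \<le> k" "k \<le> n" for j k
    using meanX_approx[OF that(1,2)] hm[OF that(3)] that by auto
  have A': "\<bar>meanX k k - mean0 k k\<bar> \<le> 40 * h" if "k \<le> n" for k
    using A[of k k] that h by (cases "k = 0") (auto simp: meanX_def mean0_def xlnx_def)
  obtain m where m: "i = Suc m" using assms by (cases i) auto
  have x: "0 \<le> xlnx (real (Suc k)) - xlnx (real k)" "xlnx (real (Suc k)) - xlnx (real k) \<le> h" if "Suc k \<le> n" for k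
    using xlnx_diff[of k] hm[OF that] by auto
  have g: "0 < (euler_mascheroni::real)" "(euler_mascheroni::real) < 1"
    using euler_mascheroni_pos euler_mascheroni_less_13_over_22 by auto
  show ?thesis
  proof (cases "l < i")
    case True
    \<comment> \<open>\<open>E\<close> collects the errors of the two closed forms, the
      \<open>-1\<close> in \<open>n - 1\<close>, and the shift of the left size from
      \<open>i - 1\<close> to \<open>i\<close>.\<close>
    define E where "E = (meanX m l - mean0 m l) - (meanX n l - mean0 n l) - 1 + (mean0 m l - mean0 i l)"
    have "\<bar>mean0 m l - mean0 i l\<bar> \<le> 2 + 4 * h"
    proof -
      define b where "b = m - l"
      have b: "Suc b \<le> n" "real m - real l = real b" "1 + real m - real l = real (Suc b)"
        using True assms m by (auto simp: b_def)
      have "mean0 m l - mean0 i l = - 2 - 2 * (xlnx (real (Suc m)) - xlnx (real m))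
          + 2 * (xlnx (real (Suc b)) - xlnx (real b))"
        using b by (simp add: mean0_def m algebra_simps)
      then show ?thesis using x[of m] x[OF b(1)] assms m h by (auto simp: abs_le_iff)
    qed
    then have E: "\<bar>E\<bar> \<le> 200 * h"
      unfolding E_def using A[of l m] A[of l n] assms True m h by (auto simp: abs_le_iff)
    have "toll n l i - Cfun2 (real l / real n) (real i / real n) = E / real n"
      unfolding mean0_toll_above[OF True \<open>i \<le> n\<close>, symmetric] using True n
      by (simp add: toll_def m E_def field_simps)
    then show ?thesis using E n True by (simp add: h_def divide_right_mono)
  next
    case False
    define D where "D = meanX (n - i) (l - i) - mean0 (n - i) (l - i)"
    have D: "\<bar>D\<bar> \<le> 40 * h + (if l = i then 2 * real n else 0)"
    proof (cases "l = i")
      case True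
      \<comment> \<open>\<open>meanX\<close> is \<open>0\<close> at rank \<open>0\<close>, whereas
        \<open>mean0 (n - i) 0\<close> equals \<open>2 * real (n - i)\<close>: the origin of the
        exceptional error.\<close>
      then have "D = - 2 * real (n - i)" by (simp add: D_def meanX_def mean0_def)
      then show ?thesis using True assms h by (simp add: of_nat_diff)
    next
      case F: False
      then show ?thesis unfolding D_def using A[of "l - i" "n - i"] False assms h by auto
    qed
    define E where "E = (meanX m m - mean0 m m) - (meanX n l - mean0 n l) - 1 + (mean0 m m - mean0 i i)"
    have "mean0 m m - mean0 i i = - 2 * (xlnx (real (Suc m)) - xlnx (real m)) - (2 * euler_mascheroni - 4)"
      by (simp add: mean0_diag m algebra_simps)
    then have "\<bar>mean0 m m - mean0 i i\<bar> \<le> 4 + 4 * h"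
      using x[of m] assms m g by (auto simp: abs_le_iff)
    then have E: "\<bar>E\<bar> \<le> 160 * h"
      unfolding E_def using A'[of m] A[of l n] assms False m h by (auto simp: abs_le_iff)
    have "toll n l i - Cfun2 (real l / real n) (real i / real n) = (E + D) / real n"
      unfolding mean0_toll_below[OF \<open>1 \<le> i\<close> leI[OF False] \<open>l \<le> n\<close>, symmetric] using False n
      by (simp add: toll_def m E_def D_def field_simps)
    also have "\<bar>\<dots>\<bar> \<le> (200 * h + (if l = i then 2 * real n else 0)) / real n"
      using E D n by (auto simp: divide_right_mono)
    also have "\<dots> = 200 * h / real n + (if l = i then 2 else 0)" using n by (simp add: field_simps)
    finally show ?thesis by (simp add: h_def)
  qed
qed

section \<open>Boundedness and convergence of the tolls\<close>

lemma xlnx_continuous: "continuous_on {0..} xlnx"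
proof -
  have "(xlnx \<longlongrightarrow> xlnx x) (at x within {0..})" if "x \<ge> 0" for x
  proof (cases "x = 0")
    case True
    have "((\<lambda>x::real. x * ln x) \<longlongrightarrow> 0) (at_right 0)" by real_asymp
    then have "(xlnx \<longlongrightarrow> 0) (at_right 0)"
      by (rule Lim_transform_eventually) (auto simp: xlnx_def eventually_at_filter)
    moreover have "at (0::real) within {0..} = at_right 0"
      by (simp add: at_within_Ici_at_right)
    ultimately show ?thesis using True by (simp add: xlnx_def)
  next
    case False
    then have "x > 0" using that by simp
    have "isCont (\<lambda>x. x * ln x) x" using \<open>x > 0\<close> by (intro continuous_intros) auto
    moreover have "eventually (\<lambda>y. y * ln y = xlnx y) (nhds x)" 
      by (auto simp: xlnx_def)
    ultimately have "isCont xlnx x" by (simp add: isCont_cong)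
    then show ?thesis unfolding isCont_def by (rule tendsto_within_subset) auto
  qed
  then show ?thesis by (simp add: continuous_on_def)
qed

lemma tendsto_xlnx:
  assumes "(f \<longlongrightarrow> x) F" "0 \<le> x" "eventually (\<lambda>k. 0 \<le> f k) F"
  shows "((\<lambda>k. xlnx (f k)) \<longlongrightarrow> xlnx x) F"
  using continuous_on_tendsto_compose[OF xlnx_continuous assms(1)] assms(2,3) by auto

lemma xlnx_bounds: "0 \<le> x \<Longrightarrow> x \<le> 1 \<Longrightarrow> \<bar>xlnx x\<bar> \<le> 1"
proof -
  assume x: "0 \<le> x" "x \<le> 1"
  show ?thesis
  proof (cases "x = 0")
    case False
    then have "x > 0" using x by simp
    have "ln (1 / x) \<le> 1 / x - 1" by (rule ln_le_minus_one) (use \<open>x > 0\<close> in simp)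
    then have "- ln x \<le> 1 / x" using \<open>x > 0\<close> by (simp add: ln_div)
    then have "x * (- ln x) \<le> x * (1 / x)" using \<open>x > 0\<close> by (intro mult_left_mono) auto
    moreover have "x * ln x \<le> 0" using x \<open>x > 0\<close> by (simp add: mult_le_0_iff)
    ultimately show ?thesis using \<open>x > 0\<close> by (simp add: xlnx_def abs_le_iff)
  qed (simp add: xlnx_def)
qed

text \<open>Bounding each \<open>xlnx\<close> and \<open>1 - x\<close> by \<open>1\<close> gives
  \<open>5\<close> for \<open>Cfun x\<close> and \<open>2 * 4\<close> for the correction.\<close>

lemma Cfun2_bounds:
  assumes "0 \<le> t" "t \<le> 1" "0 \<le> x" "x \<le> 1"
  shows "\<bar>Cfun2 t x\<bar> \<le> 13"
  using xlnx_bounds[of x] xlnx_bounds[of "1 - x"] xlnx_bounds[of "1 - t"] xlnx_bounds[of "x - t"] assms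
  by (auto simp: Cfun2_def Cfun_def abs_le_iff)

lemma toll_bounded:
  assumes "2 \<le> n" "1 \<le> l" "l \<le> n" "1 \<le> i" "i \<le> n"
  shows "\<bar>toll n l i\<bar> \<le> 415"
proof -
  have "\<bar>Cfun2 (real l / real n) (real i / real n)\<bar> \<le> 13"
    using assms by (intro Cfun2_bounds) auto
  moreover have "(1 + ln (real n)) / real n \<le> 1"
    using assms ln_le_minus_one[of "real n"] by (simp add: field_simps)
  moreover have "200 * (1 + ln (real n)) / real n = 200 * ((1 + ln (real n)) / real n)" by simp
  ultimately show ?thesis using toll_approx[OF assms] by (split if_splits) linarith+
qed

text \<open>Off the diagonal \<open>t = u\<close> the order of rank and pivot is eventually that of
  \<open>t\<close> and \<open>u\<close>, so one branch of \<open>Cfun2\<close> is in force and it is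
  continuous. On the diagonal \<open>Cfun2\<close> jumps by \<open>2 * (1 - u)\<close> and
  \<open>toll_approx\<close> has its exceptional term.\<close>

lemma toll_tendsto:
  fixes n l i :: "nat \<Rightarrow> nat"
  assumes n: "filterlim n at_top sequentially"
    and l: "eventually (\<lambda>k. 1 \<le> l k \<and> l k \<le> n k) sequentially"
    and i: "eventually (\<lambda>k. 1 \<le> i k \<and> i k \<le> n k) sequentially"
    and lt: "(\<lambda>k. real (l k) / real (n k)) \<longlonglongrightarrow> t"
    and iu: "(\<lambda>k. real (i k) / real (n k)) \<longlonglongrightarrow> u"
    and tu: "0 \<le> t" "t \<le> 1" "0 \<le> u" "u \<le> 1" "t \<noteq> u"
  shows "(\<lambda>k. toll (n k) (l k) (i k)) \<longlonglongrightarrow> Cfun2 t u"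
proof -
  have n2: "eventually (\<lambda>k. 2 \<le> n k) sequentially" using n by (auto simp: filterlim_at_top)
  have side: "eventually (\<lambda>k. (l k < i k \<longleftrightarrow> t < u) \<and> l k \<noteq> i k) sequentially"
  proof (cases "t < u")
    case True
    obtain m where m: "t < m" "m < u" using dense[OF True] by blast
    from order_tendstoD(2)[OF lt m(1)] order_tendstoD(1)[OF iu m(2)] n2
    show ?thesis
    proof eventually_elim
      case (elim k)
      then have "real (l k) / real (n k) < real (i k) / real (n k)" by linarith
      then show ?case using True by (auto simp: divide_less_cancel)
    qed
  next
    case False
    then have "u < t" using tu by simp
    then obtain m where m: "u < m" "m < t" using dense by blast
    from order_tendstoD(1)[OF lt m(2)] order_tendstoD(2)[OF iu m(1)] n2
    show ?thesis
    proof eventually_elim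
      case (elim k)
      then have "real (i k) / real (n k) < real (l k) / real (n k)" by linarith
      then show ?case using False by (auto simp: divide_less_cancel)
    qed
  qed
  have C: "(\<lambda>k. Cfun2 (real (l k) / real (n k)) (real (i k) / real (n k))) \<longlonglongrightarrow> Cfun2 t u"
  proof -
    define a where "a k = real (l k) / real (n k)" for k
    define b where "b k = real (i k) / real (n k)" for k
    have ab: "eventually (\<lambda>k. 0 \<le> a k \<and> a k \<le> 1 \<and> 0 \<le> b k \<and> b k \<le> 1 \<and> (a k < b k \<longleftrightarrow> t < u)) sequentially"
      using l i n2 side by eventually_elim (auto simp: a_def b_def divide_less_cancel)
    have lim: "a \<longlonglongrightarrow> t" "b \<longlonglongrightarrow> u" using lt iu by (simp_all add: a_def[abs_def] b_def[abs_def])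
    have C1: "(\<lambda>k. Cfun (b k)) \<longlonglongrightarrow> Cfun u"
      unfolding Cfun_def using ab tu
      by (intro tendsto_intros tendsto_xlnx lim) (auto elim: eventually_mono)
    have "(\<lambda>k. Cfun2 (a k) (b k)) \<longlonglongrightarrow> Cfun2 t u"
    proof (cases "t < u")
      case True
      have "(\<lambda>k. Cfun (b k) + 2 * (-1 + b k + xlnx (1 - a k) - xlnx (1 - b k) - xlnx (b k - a k)))
         \<longlonglongrightarrow> Cfun u + 2 * (-1 + u + xlnx (1 - t) - xlnx (1 - u) - xlnx (u - t))"
        using ab tu True
        by (intro tendsto_intros tendsto_xlnx C1 lim) (auto elim: eventually_mono)
      moreover have "eventually (\<lambda>k. Cfun (b k) + 2 * (-1 + b k + xlnx (1 - a k) - xlnx (1 - b k)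
          - xlnx (b k - a k)) = Cfun2 (a k) (b k)) sequentially"
        using ab by eventually_elim (use True in \<open>auto simp: Cfun2_def\<close>)
      ultimately show ?thesis using Lim_transform_eventually True by (fastforce simp: Cfun2_def)
    next
      case False
      have "Cfun2 t u = Cfun u" using False by (simp add: Cfun2_def)
      moreover have "eventually (\<lambda>k. Cfun (b k) = Cfun2 (a k) (b k)) sequentially"
        using ab by eventually_elim (use False in \<open>auto simp: Cfun2_def\<close>)
      ultimately show ?thesis using Lim_transform_eventually[OF C1] by simp
    qed
    then show ?thesis by (simp add: a_def b_def)
  qed
  have L: "(\<lambda>k. 200 * (1 + ln (real (n k))) / real (n k)) \<longlonglongrightarrow> 0"
  proof -
    have "((\<lambda>m::nat. 200 * (1 + ln (real m)) / real m) \<longlongrightarrow> 0) at_top" by real_asymp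
    from filterlim_compose[OF this n] show ?thesis .
  qed
  have "(\<lambda>k. toll (n k) (l k) (i k) - Cfun2 (real (l k) / real (n k)) (real (i k) / real (n k))) \<longlonglongrightarrow> 0"
  proof (rule Lim_null_comparison[OF _ L])
    show "\<forall>\<^sub>F k in sequentially. norm (toll (n k) (l k) (i k) - Cfun2 (real (l k) / real (n k)) (real (i k) / real (n k)))
        \<le> 200 * (1 + ln (real (n k))) / real (n k)"
      using l i n2 side
    proof eventually_elim
      case (elim k)
      then show ?case using toll_approx[of "n k" "l k" "i k"] by auto
    qed
  qed
  from tendsto_add[OF this C] show ?thesis by simp
qed

section \<open>Splitting the sample space at the root\<close>

abbreviation unif01 :: "real measure" where
  "unif01 \<equiv> uniform_measure lborel {0..1}"

lemma prob_space_unif01: "prob_space unif01"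
  by (intro prob_space_uniform_measure) auto

interpretation unif01: prob_space unif01
  by (rule prob_space_unif01)

lemma sets_Uspace[measurable_cong]: "sets Uspace = sets (PiM UNIV (\<lambda>_. borel))"
  unfolding Uspace_def by (intro sets_PiM_cong) auto

lemma space_Uspace[simp]: "space Uspace = UNIV"
  unfolding Uspace_def by (simp add: space_PiM)

interpretation UU: product_prob_space "\<lambda>_. unif01" "UNIV :: bool list set"
  by (intro product_prob_spaceI prob_space_unif01)

interpretation U: prob_space Uspace
  unfolding Uspace_def by (rule UU.P.prob_space_axioms)

interpretation UxU: pair_prob_space Uspace Uspace ..

interpretation uUU: pair_prob_space unif01 "Uspace \<Otimes>\<^sub>M Uspace" ..

definition subtree :: "bool \<Rightarrow> (bool list \<Rightarrow> real) \<Rightarrow> bool list \<Rightarrow> real" where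
  "subtree b U = (\<lambda>w. U (b # w))"

primrec glue :: "real \<Rightarrow> (bool list \<Rightarrow> real) \<Rightarrow> (bool list \<Rightarrow> real) \<Rightarrow> bool list \<Rightarrow> real" where
  "glue u A B [] = u"
| "glue u A B (b # w) = (if b then B w else A w)"

lemma subtree_glue[simp]: "subtree b (glue u A B) = (if b then B else A)"
  by (auto simp: subtree_def)

lemma measurable_UspaceI:
  assumes "\<And>w. (\<lambda>x. f x w) \<in> borel_measurable M"
  shows "f \<in> M \<rightarrow>\<^sub>M Uspace"
proof -
  have "f \<in> M \<rightarrow>\<^sub>M PiM UNIV (\<lambda>_. borel)"
    using assms by (intro measurable_PiM_single') (auto simp: PiE_def)
  then show ?thesis by (simp add: measurable_cong_sets[OF refl sets_Uspace])
qed

lemma subtree_measurable[measurable]: "subtree b \<in> Uspace \<rightarrow>\<^sub>M Uspace"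
  unfolding subtree_def by (rule measurable_UspaceI) simp

lemma measurable_Uspace_component:
  assumes "f \<in> M \<rightarrow>\<^sub>M Uspace"
  shows "(\<lambda>x. f x w) \<in> borel_measurable M"
proof -
  have "(\<lambda>U. U w) \<in> PiM UNIV (\<lambda>_. borel :: real measure) \<rightarrow>\<^sub>M borel"
    by (rule measurable_component_singleton) simp
  then have "(\<lambda>U. U w) \<in> Uspace \<rightarrow>\<^sub>M borel" by (simp add: measurable_cong_sets[OF sets_Uspace refl])
  from measurable_compose[OF assms this] show ?thesis .
qed

lemma glue_measurable[measurable (raw)]:
  assumes [measurable]: "f \<in> borel_measurable M" "g \<in> M \<rightarrow>\<^sub>M Uspace" "h \<in> M \<rightarrow>\<^sub>M Uspace"
  shows "(\<lambda>x. glue (f x) (g x) (h x)) \<in> M \<rightarrow>\<^sub>M Uspace"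
proof (rule measurable_UspaceI)
  fix w show "(\<lambda>x. glue (f x) (g x) (h x) w) \<in> borel_measurable M"
    by (cases w; cases "hd w") (auto intro: measurable_Uspace_component assms)
qed

text \<open>The root variable and the two subtrees are independent, each subtree being a copy of the
  whole family. By uniqueness of product measures only finite cylinders matter; a cylinder over
  \<open>J\<close> pulls back to a rectangle with one side for the root and one for each set
  \<open>Jb b\<close> of words that follow the first letter \<open>b\<close>.\<close>

lemma distr_glue: "distr (unif01 \<Otimes>\<^sub>M (Uspace \<Otimes>\<^sub>M Uspace)) Uspace (\<lambda>(u, A, B). glue u A B) = Uspace"
proof -
  have "distr (unif01 \<Otimes>\<^sub>M (Uspace \<Otimes>\<^sub>M Uspace)) Uspace (\<lambda>(u, A, B). glue u A B) = PiM UNIV (\<lambda>_. unif01)"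
  proof (rule UU.PiM_eq)
    fix J :: "bool list set" and F assume J: "finite J" and F: "\<And>j. j \<in> J \<Longrightarrow> F j \<in> sets unif01"
    \<comment> \<open>Extending \<open>F\<close> by \<open>UNIV\<close> outside \<open>J\<close>
      allows quantifying over all words, so that the condition splits by the first letter without
      mentioning \<open>J\<close>.\<close>
    define G where "G j = (if j \<in> J then F j else UNIV)" for j
    have G[measurable]: "G j \<in> sets borel" for j using F by (auto simp: G_def)
    define Jb where "Jb b = {w. b # w \<in> J}" for b
    have Jb: "finite (Jb b)" for b
      using finite_vimageI[OF J, of "Cons b"] by (auto simp: Jb_def vimage_def)
    have JU: "J = (J \<inter> {[]}) \<union> (Cons False ` Jb False \<union> Cons True ` Jb True)"
    proof (intro equalityI subsetI)
      fix w assume "w \<in> J" then show "w \<in> (J \<inter> {[]}) \<union> (Cons False ` Jb False \<union> Cons True ` Jb True)"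
        by (cases w; cases "hd w") (auto simp: Jb_def image_iff)
    qed (auto simp: Jb_def)
    let ?E = "\<lambda>b. {x \<in> space Uspace. \<forall>w\<in>Jb b. x w \<in> G (b # w)}"
    have E: "emeasure Uspace (?E b) = (\<Prod>w\<in>Jb b. emeasure unif01 (G (b # w)))" for b
      unfolding Uspace_def using Jb by (intro UU.emeasure_PiM_Collect) auto
    have Em: "?E b \<in> sets Uspace" for b
    proof -
      have "(\<lambda>x. x w) -` G (b # w) \<inter> space Uspace \<in> sets Uspace" for w
        by (rule measurable_sets[OF measurable_Uspace_component[OF measurable_ident_sets[OF refl]] G])
      then have "{x \<in> space Uspace. x w \<in> G (b # w)} \<in> sets Uspace" for w
        by (simp add: vimage_def Int_def conj_commute)
      then show ?thesis by (intro sets.sets_Collect_finite_All Jb)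
    qed
    have "(\<lambda>(u, A, B). glue u A B) -` prod_emb UNIV (\<lambda>_. unif01) J (\<Pi>\<^sub>E j\<in>J. F j)
       \<inter> space (unif01 \<Otimes>\<^sub>M (Uspace \<Otimes>\<^sub>M Uspace)) = G [] \<times> (?E False \<times> ?E True)" (is "?L = ?R")
    proof -
      have "(u, A, B) \<in> ?L \<longleftrightarrow> (u, A, B) \<in> ?R" for u A B
      proof -
        have "(u, A, B) \<in> ?L \<longleftrightarrow> (\<forall>j\<in>J. glue u A B j \<in> F j)"
          by (auto simp: prod_emb_def space_pair_measure PiE_iff)
        also have "\<dots> \<longleftrightarrow> (\<forall>j. glue u A B j \<in> G j)" by (auto simp: G_def)
        also have "\<dots> \<longleftrightarrow> u \<in> G [] \<and> (\<forall>w. A w \<in> G (False # w)) \<and> (\<forall>w. B w \<in> G (True # w))"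
        proof safe
          fix j assume *: "u \<in> G []" "\<forall>w. A w \<in> G (False # w)" "\<forall>w. B w \<in> G (True # w)"
          then show "glue u A B j \<in> G j" by (cases j) auto
        next
          assume a: "\<forall>j. glue u A B j \<in> G j"
          show "u \<in> G []" using a[rule_format, of "[]"] by simp
          show "A w \<in> G (False # w)" for w using a[rule_format, of "False # w"] by simp
          show "B w \<in> G (True # w)" for w using a[rule_format, of "True # w"] by simp
        qed
        also have "\<dots> \<longleftrightarrow> (u, A, B) \<in> ?R" by (auto simp: Jb_def G_def)
        finally show ?thesis .
      qed
      note eq = this
      show ?thesis
      proof (intro set_eqI)
        fix x :: "real \<times> (bool list \<Rightarrow> real) \<times> (bool list \<Rightarrow> real)"
        obtain u A B where x: "x = (u, A, B)" by (cases x)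
        show "x \<in> ?L \<longleftrightarrow> x \<in> ?R" unfolding x by (rule eq)
      qed
    qed
    note eq = this
    have gm: "(\<lambda>(u, A, B). glue u A B) \<in> unif01 \<Otimes>\<^sub>M (Uspace \<Otimes>\<^sub>M Uspace) \<rightarrow>\<^sub>M Uspace"
      by measurable
    have ps: "prod_emb UNIV (\<lambda>_. unif01) J (\<Pi>\<^sub>E j\<in>J. F j) \<in> sets Uspace"
      unfolding Uspace_def using J F by (intro sets_PiM_I) auto
    have "emeasure (distr (unif01 \<Otimes>\<^sub>M (Uspace \<Otimes>\<^sub>M Uspace)) Uspace (\<lambda>(u, A, B). glue u A B))
       (prod_emb UNIV (\<lambda>_. unif01) J (\<Pi>\<^sub>E j\<in>J. F j)) = emeasure (unif01 \<Otimes>\<^sub>M (Uspace \<Otimes>\<^sub>M Uspace)) (G [] \<times> (?E False \<times> ?E True))"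
      unfolding emeasure_distr[OF gm ps] eq ..
    also have "\<dots> = emeasure unif01 (G []) * (emeasure Uspace (?E False) * emeasure Uspace (?E True))"
    proof -
      have "G [] \<in> sets unif01" using G by simp
      then show ?thesis
        by (simp only: UxU.P.emeasure_pair_measure_Times[OF _ pair_measureI[OF Em Em]]
            U.emeasure_pair_measure_Times[OF Em Em])
    qed
    also have "\<dots> = (\<Prod>j\<in>J \<inter> {[]}. emeasure unif01 (G j)) *
        ((\<Prod>j\<in>Cons False ` Jb False. emeasure unif01 (G j)) * (\<Prod>j\<in>Cons True ` Jb True. emeasure unif01 (G j)))"
    proof -
      have "emeasure unif01 (G []) = (\<Prod>j\<in>J \<inter> {[]}. emeasure unif01 (G j))"
        using unif01.emeasure_space_1 by (cases "[] \<in> J") (auto simp: G_def)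
      moreover have "(\<Prod>j\<in>Cons b ` Jb b. emeasure unif01 (G j)) = (\<Prod>w\<in>Jb b. emeasure unif01 (G (b # w)))" for b
        by (rule prod.reindex_cong[of "Cons b"]) (auto intro: inj_onI)
      ultimately show ?thesis by (simp only: E)
    qed
    also have "\<dots> = (\<Prod>j\<in>(J \<inter> {[]}) \<union> (Cons False ` Jb False \<union> Cons True ` Jb True). emeasure unif01 (G j))"
    proof -
      have "(\<Prod>j\<in>Cons False ` Jb False \<union> Cons True ` Jb True. emeasure unif01 (G j)) =
        (\<Prod>j\<in>Cons False ` Jb False. emeasure unif01 (G j)) * (\<Prod>j\<in>Cons True ` Jb True. emeasure unif01 (G j))"
        by (rule prod.union_disjoint) (use Jb in auto)
      moreover have "(\<Prod>j\<in>(J \<inter> {[]}) \<union> (Cons False ` Jb False \<union> Cons True ` Jb True). emeasure unif01 (G j)) =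
        (\<Prod>j\<in>J \<inter> {[]}. emeasure unif01 (G j)) * (\<Prod>j\<in>Cons False ` Jb False \<union> Cons True ` Jb True. emeasure unif01 (G j))"
        by (rule prod.union_disjoint) (use J Jb in auto)
      ultimately show ?thesis by (simp only:)
    qed
    also have "\<dots> = (\<Prod>j\<in>J. emeasure unif01 (G j))"
      by (simp only: JU[symmetric])
    also have "\<dots> = (\<Prod>j\<in>J. emeasure unif01 (F j))" by (intro prod.cong) (auto simp: G_def)
    finally show "emeasure (distr (unif01 \<Otimes>\<^sub>M (Uspace \<Otimes>\<^sub>M Uspace)) Uspace (\<lambda>(u, A, B). glue u A B))
       (prod_emb UNIV (\<lambda>_. unif01) J (\<Pi>\<^sub>E j\<in>J. F j)) = (\<Prod>j\<in>J. emeasure unif01 (F j))" .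
  qed (simp add: Uspace_def)
  then show ?thesis by (simp add: Uspace_def)
qed

lemma glue_prod_measurable:
  "(\<lambda>(u, A, B). glue u A B) \<in> unif01 \<Otimes>\<^sub>M (Uspace \<Otimes>\<^sub>M Uspace) \<rightarrow>\<^sub>M Uspace"
  by measurable

text \<open>Conditioning on the first split. The root variable is the outermost one, so that the
  inner integrals see a fixed \<open>u\<close> and two independent subtrees.\<close>

lemma nn_integral_Uspace:
  assumes f: "f \<in> borel_measurable Uspace"
  shows "(\<integral>\<^sup>+x. f x \<partial>Uspace) = (\<integral>\<^sup>+u. \<integral>\<^sup>+A. \<integral>\<^sup>+B. f (glue u A B) \<partial>Uspace \<partial>Uspace \<partial>unif01)"
proof -
  let ?g = "\<lambda>(u, A, B). glue u A B"
  let ?M = "unif01 \<Otimes>\<^sub>M (Uspace \<Otimes>\<^sub>M Uspace)"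
  have m: "(\<lambda>x. f (?g x)) \<in> borel_measurable ?M"
    by (rule measurable_compose[OF glue_prod_measurable f])
  have m2: "(\<lambda>y. f (?g (u, y))) \<in> borel_measurable (Uspace \<Otimes>\<^sub>M Uspace)" for u
    by (rule measurable_compose[OF _ m]) simp
  have "(\<integral>\<^sup>+x. f x \<partial>Uspace) = (\<integral>\<^sup>+x. f x \<partial>distr ?M Uspace ?g)"
    by (simp only: distr_glue)
  also have "\<dots> = (\<integral>\<^sup>+x. f (?g x) \<partial>?M)" 
    by (rule nn_integral_distr[OF glue_prod_measurable]) (simp only: measurable_distr_eq1 f)
  also have "\<dots> = (\<integral>\<^sup>+u. \<integral>\<^sup>+y. f (?g (u, y)) \<partial>(Uspace \<Otimes>\<^sub>M Uspace) \<partial>unif01)"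
    by (rule UxU.P.nn_integral_fst[symmetric, OF m])
  also have "\<dots> = (\<integral>\<^sup>+u. \<integral>\<^sup>+A. \<integral>\<^sup>+B. f (?g (u, A, B)) \<partial>Uspace \<partial>Uspace \<partial>unif01)"
    by (simp only: U.nn_integral_fst[symmetric, OF m2])
  finally show ?thesis by simp
qed

lemma integral_Uspace:
  fixes f :: "_ \<Rightarrow> real"
  assumes f: "integrable Uspace f"
  shows "(\<integral>x. f x \<partial>Uspace) = (\<integral>u. \<integral>A. \<integral>B. f (glue u A B) \<partial>Uspace \<partial>Uspace \<partial>unif01)"
proof -
  have fm: "f \<in> borel_measurable Uspace" using f by (rule borel_measurable_integrable)
  let ?g = "\<lambda>(u, A, B). glue u A B"
  let ?M = "unif01 \<Otimes>\<^sub>M (Uspace \<Otimes>\<^sub>M Uspace)"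
  have i: "integrable ?M (\<lambda>x. f (?g x))"
    by (rule integrable_distr[OF glue_prod_measurable]) (simp only: distr_glue f)
  have m: "(\<lambda>x. f (?g x)) \<in> borel_measurable ?M"
    using i by (rule borel_measurable_integrable)
  have m1: "(\<lambda>(u, y). f (?g (u, y))) \<in> borel_measurable ?M" using m by (simp add: case_prod_beta')
  have m2: "(\<lambda>((u, A), B). f (?g (u, A, B))) \<in> borel_measurable ((unif01 \<Otimes>\<^sub>M Uspace) \<Otimes>\<^sub>M Uspace)"
    using measurable_compose[OF _ m, of "\<lambda>((u, A), B). (u, A, B)" "(unif01 \<Otimes>\<^sub>M Uspace) \<Otimes>\<^sub>M Uspace"]
    by (simp add: case_prod_beta')
  have "(\<integral>x. f x \<partial>Uspace) = (\<integral>x. f x \<partial>distr ?M Uspace ?g)"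
    by (simp only: distr_glue)
  also have "\<dots> = (\<integral>x. f (?g x) \<partial>?M)" by (rule integral_distr[OF glue_prod_measurable fm])
  also have "\<dots> = (\<integral>u. \<integral>y. f (?g (u, y)) \<partial>(Uspace \<Otimes>\<^sub>M Uspace) \<partial>unif01)"
    by (rule uUU.integral_fst'[symmetric, OF i])
  also have "\<dots> = (\<integral>u. \<integral>A. \<integral>B. f (?g (u, A, B)) \<partial>Uspace \<partial>Uspace \<partial>unif01)"
  proof (rule integral_cong_AE)
    have "AE u in unif01. integrable (Uspace \<Otimes>\<^sub>M Uspace) (\<lambda>y. f (?g (u, y)))"
      by (rule uUU.AE_integrable_fst'[OF i])
    then show "AE u in unif01. (\<integral>y. f (?g (u, y)) \<partial>(Uspace \<Otimes>\<^sub>M Uspace)) = (\<integral>A. \<integral>B. f (?g (u, A, B)) \<partial>Uspace \<partial>Uspace)"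
    proof eventually_elim
      case (elim u)
      from UxU.integral_fst'[OF elim] show ?case by (rule sym)
    qed
    show "(\<lambda>u. \<integral>y. f (?g (u, y)) \<partial>(Uspace \<Otimes>\<^sub>M Uspace)) \<in> borel_measurable unif01"
      by (rule UxU.P.borel_measurable_lebesgue_integral[OF m1])
    have "(\<lambda>(u, A). \<integral>B. f (?g (u, A, B)) \<partial>Uspace) \<in> borel_measurable (unif01 \<Otimes>\<^sub>M Uspace)"
      using U.borel_measurable_lebesgue_integral[OF m2] by (simp add: case_prod_beta')
    then show "(\<lambda>u. \<integral>A. \<integral>B. f (?g (u, A, B)) \<partial>Uspace \<partial>Uspace) \<in> borel_measurable unif01"
      by (rule U.borel_measurable_lebesgue_integral)
  qed
  finally show ?thesis by simp
qed

section \<open>The costs as functions of the uniform variables\<close>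

definition idx :: "nat \<Rightarrow> real \<Rightarrow> nat" where
  "idx n u = max 1 (min n (nat \<lceil>real n * u\<rceil>))"

lemma idx_measurable[measurable]: "idx n \<in> borel \<rightarrow>\<^sub>M count_space UNIV"
  unfolding idx_def by measurable

text \<open>The clamping in \<open>idx\<close> makes this hold for every real \<open>u\<close>, even
  outside the unit interval: the recursion of \<open>Xf\<close> has to terminate at every sample
  point, not only almost surely.\<close>

lemma idx_bounds: "1 \<le> idx n u" "1 \<le> n \<Longrightarrow> idx n u \<le> n"
  by (auto simp: idx_def)

lemma nn_integral_idx:
  fixes f :: "nat \<Rightarrow> ennreal"
  assumes n: "1 \<le> n"
  shows "(\<integral>\<^sup>+u. f (idx n u) \<partial>unif01) = (\<Sum>i=1..n. f i) / of_nat n"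
proof -
  let ?I = "\<lambda>i. {(real i - 1) / real n<..real i / real n}"
  \<comment> \<open>The half-open intervals are the preimages of the ranks up to the null point
    \<open>0\<close>, which \<open>idx\<close> sends to rank \<open>1\<close> although no interval
    contains it.\<close>
  have ae: "AE u in lborel. u \<in> {0..1} \<longrightarrow> f (idx n u) = (\<Sum>i=1..n. f i * indicator (?I i) u)"
    using AE_lborel_singleton[of "0::real"]
  proof eventually_elim
    case (elim u)
    show ?case
    proof
      assume "u \<in> {0..1}"
      with elim have u: "0 < u" "u \<le> 1" by auto
      define j where "j = nat \<lceil>real n * u\<rceil>"
      have c: "0 < \<lceil>real n * u\<rceil>" using u n by simp
      have "real n * u \<le> real n" using u by (simp add: mult_left_le)
      then have c2: "\<lceil>real n * u\<rceil> \<le> int n" by (simp add: ceiling_le_iff)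
      have "1 \<le> j" "j \<le> n" using c c2 unfolding j_def by linarith+
      then have j: "1 \<le> j" "j \<le> n" "idx n u = j" by (simp_all add: j_def idx_def)
      have in_iff: "u \<in> ?I i \<longleftrightarrow> i = j" if "i \<ge> 1" for i
      proof -
        have "u \<in> ?I i \<longleftrightarrow> real i - 1 < real n * u \<and> real n * u \<le> real i"
          using n by (auto simp: field_simps)
        also have "\<dots> \<longleftrightarrow> \<lceil>real n * u\<rceil> = int i" by (auto simp: ceiling_eq_iff)
        also have "\<dots> \<longleftrightarrow> i = j" using c by (auto simp: j_def)
        finally show ?thesis .
      qed
      have "(\<Sum>i=1..n. f i * indicator (?I i) u) = (\<Sum>i=1..n. if i = j then f i else 0)"
        by (rule sum.cong) (use in_iff in \<open>auto simp: indicator_def\<close>)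
      then show "f (idx n u) = (\<Sum>i=1..n. f i * indicator (?I i) u)"
        using j by simp
    qed
  qed
  have em: "emeasure unif01 (?I i) = 1 / of_nat n" if "i \<in> {1..n}" for i
  proof -
    have "0 \<le> (real i - 1) / real n" "real i / real n \<le> 1" using that n by auto
    then have "{0..1} \<inter> ?I i = ?I i" by (auto simp del: zero_le_divide_iff divide_le_eq_1)
    moreover have "(real i - 1) / real n \<le> real i / real n" by (intro divide_right_mono) auto
    ultimately have "emeasure unif01 (?I i) = ennreal (real i / real n - (real i - 1) / real n)"
      by (simp add: emeasure_uniform_measure divide_ennreal_def)
    also have "real i / real n - (real i - 1) / real n = 1 / real n" by (simp add: diff_divide_distrib)
    also have "ennreal (1 / real n) = 1 / of_nat n"
      using n by (simp add: divide_ennreal[symmetric] ennreal_of_nat_eq_real_of_nat)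
    finally show ?thesis .
  qed
  have "(\<integral>\<^sup>+u. f (idx n u) \<partial>unif01) = (\<integral>\<^sup>+u. (\<Sum>i=1..n. f i * indicator (?I i) u) \<partial>unif01)"
    by (intro nn_integral_cong_AE AE_uniform_measureI) (use ae in auto)
  also have "\<dots> = (\<Sum>i=1..n. f i * emeasure unif01 (?I i))"
  proof (subst nn_integral_sum)
    show "(\<Sum>i=1..n. \<integral>\<^sup>+u. f i * indicator (?I i) u \<partial>unif01) = (\<Sum>i=1..n. f i * emeasure unif01 (?I i))"
      by (intro sum.cong refl nn_integral_cmult_indicator) simp
    show "(\<lambda>u. f i * indicator (?I i) u) \<in> borel_measurable unif01" for i
      by (intro borel_measurable_times_ennreal borel_measurable_const borel_measurable_indicator) simp
  qed
  also have "\<dots> = (\<Sum>i=1..n. f i / of_nat n)"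
    by (intro sum.cong) (rule refl, subst em, assumption, simp add: ennreal_times_divide)
  finally show ?thesis by (simp only: divide_ennreal_def sum_distrib_right)
qed

definition Xcomb :: "nat \<Rightarrow> nat \<Rightarrow> (nat \<Rightarrow> nat) \<Rightarrow> (nat \<Rightarrow> nat) \<Rightarrow> nat \<Rightarrow> nat" where
  "Xcomb n i x1 x2 = (\<lambda>l. if l = 0 then 0 else
        n - 1 + (if l < i then x1 l else x1 (i - 1) + x2 (l - i)))"

text \<open>The two recursive calls read disjoint subtrees, which gives the independence required by
  \<open>qs\<close>. The same variables serve all \<open>n\<close>, so all sizes are coupled with
  each other and with the limit.\<close>

function Xf :: "nat \<Rightarrow> (bool list \<Rightarrow> real) \<Rightarrow> nat \<Rightarrow> nat" where
  "Xf n U = (if n \<le> 1 then (\<lambda>_. 0) else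
     Xcomb n (idx n (U [])) (Xf (idx n (U []) - 1) (subtree False U)) (Xf (n - idx n (U [])) (subtree True U)))"
  by auto
termination
proof (relation "Wellfounded.measure fst", goal_cases)
  case (2 n U) then show ?case using idx_bounds[of n "U []"] by simp
next
  case (3 n U) then show ?case using idx_bounds[of n "U []"] by simp
qed simp

declare Xf.simps[simp del] qs.simps[simp del]

text \<open>The product sigma-algebra needs only coordinatewise measurability of
  \<open>Xf n\<close>. Laws are therefore compared there, although a pmf is defined on all sets of
  functions.\<close>

abbreviation NN :: "(nat \<Rightarrow> nat) measure" where
  "NN \<equiv> PiM UNIV (\<lambda>_. count_space UNIV)"

lemma space_NN[simp]: "space NN = UNIV"
  by (simp add: space_PiM)

lemma Xf_glue:
  "Xf n (glue u A B) = (if n \<le> 1 then (\<lambda>_. 0) else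
     Xcomb n (idx n u) (Xf (idx n u - 1) A) (Xf (n - idx n u) B))"
  by (subst Xf.simps) simp

lemma measurable_add_nat:
  fixes f g :: "'a \<Rightarrow> nat"
  assumes "f \<in> M \<rightarrow>\<^sub>M count_space UNIV" "g \<in> M \<rightarrow>\<^sub>M count_space UNIV"
  shows "(\<lambda>x. f x + g x) \<in> M \<rightarrow>\<^sub>M count_space UNIV"
  using assms by measurable

lemma Xcomb_measurable':
  assumes "\<And>k. (\<lambda>x. f x k) \<in> M \<rightarrow>\<^sub>M count_space UNIV" "\<And>k. (\<lambda>x. g x k) \<in> M \<rightarrow>\<^sub>M count_space UNIV"
  shows "(\<lambda>x. Xcomb n i (f x) (g x) l) \<in> M \<rightarrow>\<^sub>M count_space UNIV"
proof -
  have "(\<lambda>x. n - 1 + f x l) \<in> M \<rightarrow>\<^sub>M count_space UNIV"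
    "(\<lambda>x. n - 1 + (f x (i - 1) + g x (l - i))) \<in> M \<rightarrow>\<^sub>M count_space UNIV"
    by (intro measurable_add_nat assms measurable_const; simp)+
  then show ?thesis unfolding Xcomb_def by (cases "l = 0"; cases "l < i") simp_all
qed

lemma Xf_measurable': "(\<lambda>U. Xf n U l) \<in> Uspace \<rightarrow>\<^sub>M count_space UNIV"
proof (induction n arbitrary: l rule: less_induct)
  case (less n)
  show ?case
  proof (cases "n \<le> 1")
    case True
    then have "Xf n U l = 0" for U by (simp add: Xf.simps[of n])
    then show ?thesis by simp
  next
    case False
    have "(\<lambda>U. Xcomb n (idx n (U [])) (Xf (idx n (U []) - 1) (subtree False U)) (Xf (n - idx n (U [])) (subtree True U)) l)
       \<in> Uspace \<rightarrow>\<^sub>M count_space UNIV"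
    \<comment> \<open>The pivot rank takes finitely many values, so it may be frozen; for a frozen
      rank in \<open>{1..n}\<close> both sizes are below \<open>n\<close> and the induction
      hypothesis applies.\<close>
    proof (rule measurable_compose_countable'[where I = "{1..n}" and g = "\<lambda>U. idx n (U [])" and
        f = "\<lambda>i U. Xcomb n i (Xf (i - 1) (subtree False U)) (Xf (n - i) (subtree True U)) l"])
      fix i assume "i \<in> {1..n}"
      then have i: "i - 1 < n" "n - i < n" by auto
      show "(\<lambda>U. Xcomb n i (Xf (i - 1) (subtree False U)) (Xf (n - i) (subtree True U)) l) \<in> Uspace \<rightarrow>\<^sub>M count_space UNIV"
        by (intro Xcomb_measurable' measurable_compose[OF subtree_measurable less.IH[OF i(1)]]
            measurable_compose[OF subtree_measurable less.IH[OF i(2)]])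
    next
      have "(\<lambda>U. idx n (U [])) \<in> Uspace \<rightarrow>\<^sub>M count_space UNIV"
        by (rule measurable_compose[OF measurable_Uspace_component[OF measurable_ident_sets[OF refl]] idx_measurable])
      moreover have "idx n u \<in> {1..n}" for u using idx_bounds[of n u] False by simp
      ultimately show "(\<lambda>U. idx n (U [])) \<in> Uspace \<rightarrow>\<^sub>M count_space {1..n}"
        by (intro measurable_count_space_extend[of "{1..n}" UNIV]) blast+
    qed simp
    then show ?thesis using False by (simp add: Xf.simps[of n])
  qed
qed

lemma Xf_measurable[measurable]: "Xf n \<in> Uspace \<rightarrow>\<^sub>M NN"
  by (rule measurable_PiM_single'[OF Xf_measurable']) simp

text \<open>A crude deterministic bound that only guarantees integrability before the sharp second
  moment bound is available.\<close>

lemma Xf_le: "Xf n U l \<le> n * n"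
proof (induction n arbitrary: U l rule: less_induct)
  case (less n)
  show ?case
  proof (cases "n \<le> 1")
    case True then show ?thesis by (subst Xf.simps) simp
  next
    case False
    define i where "i = idx n (U [])"
    have i: "1 \<le> i" "i \<le> n" using idx_bounds[of n "U []"] False by (auto simp: i_def)
    have 1: "Xf (i - 1) V k \<le> (i - 1) * (i - 1)" for V k by (rule less.IH) (use i in simp)
    have 2: "Xf (n - i) V k \<le> (n - i) * (n - i)" for V k by (rule less.IH) (use i False in simp)
    obtain a where a: "i = Suc a" using i by (cases i) auto
    obtain b where b: "n = i + b" using i le_Suc_ex by blast
    have "n - 1 + ((i - 1) * (i - 1) + (n - i) * (n - i)) \<le> n * n"
      unfolding b a by (simp add: algebra_simps)
    moreover have "Xf n U l \<le> n - 1 + ((i - 1) * (i - 1) + (n - i) * (n - i))"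
    proof -
      have "Xf n U l = (if l = 0 then 0 else n - 1 + (if l < i then Xf (i - 1) (subtree False U) l
         else Xf (i - 1) (subtree False U) (i - 1) + Xf (n - i) (subtree True U) (l - i)))"
        using False by (subst Xf.simps) (simp only: Xcomb_def i_def[symmetric] if_False)
      with 1[of "subtree False U" l] 1[of "subtree False U" "i - 1"] 2[of "subtree True U" "l - i"]
      show ?thesis by (simp only: split: if_split) linarith
    qed
    ultimately show ?thesis by linarith
  qed
qed

section \<open>The law and the mean of the costs\<close>

lemma finite_set_qs: "finite (set_pmf (qs n))"
proof (induction n rule: less_induct)
  case (less n)
  show ?case
  proof (cases "n \<le> 1")
    case True then show ?thesis by (subst qs.simps) simp
  next
    case False
    have "finite (set_pmf (qs (i - 1)))" "finite (set_pmf (qs (n - i)))" if "i \<in> {1..n}" for i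
      using that False by (auto intro!: less.IH)
    then show ?thesis using False by (subst qs.simps) (auto simp: set_pmf_of_set)
  qed
qed

lemma qs_rec: "\<not> n \<le> 1 \<Longrightarrow> qs n = bind_pmf (pmf_of_set {1..n}) (\<lambda>i.
     bind_pmf (qs (i - 1)) (\<lambda>x1. bind_pmf (qs (n - i)) (\<lambda>x2. return_pmf (Xcomb n i x1 x2))))"
  by (subst qs.simps) (simp add: Xcomb_def)

lemma Xcomb_measurable:
  assumes "f \<in> M \<rightarrow>\<^sub>M NN" "g \<in> M \<rightarrow>\<^sub>M NN"
  shows "(\<lambda>x. Xcomb n i (f x) (g x)) \<in> M \<rightarrow>\<^sub>M NN"
proof -
  have "(\<lambda>x. x k) \<in> NN \<rightarrow>\<^sub>M count_space UNIV" for k by simp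
  then show ?thesis
    by (intro measurable_PiM_single' Xcomb_measurable')
      (auto intro: measurable_compose[OF assms(1)] measurable_compose[OF assms(2)])
qed

text \<open>Stated for all test functions \<open>g\<close>, because the induction hypothesis is used
  on two derived ones: for the right part with the left part fixed, then for the left part with the
  right part already integrated out.\<close>

lemma nn_integral_Xf:
  assumes "g \<in> borel_measurable NN"
  shows "(\<integral>\<^sup>+U. g (Xf n U) \<partial>Uspace) = (\<integral>\<^sup>+x. g x \<partial>qs n)"
  using assms
proof (induction n arbitrary: g rule: less_induct)
  case (less n)
  note [measurable] = less.prems
  show ?case
  proof (cases "n \<le> 1")
    case True
    then show ?thesis by (subst Xf.simps, subst qs.simps) (simp add: U.emeasure_space_1[simplified])
  next
    case False
    define G where "G i = (\<integral>\<^sup>+x1. \<integral>\<^sup>+x2. g (Xcomb n i x1 x2) \<partial>qs (n - i) \<partial>qs (i - 1))" for i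
    have *: "(\<integral>\<^sup>+A. \<integral>\<^sup>+B. g (Xcomb n i (Xf (i - 1) A) (Xf (n - i) B)) \<partial>Uspace \<partial>Uspace) = G i"
      if i: "1 \<le> i" "i \<le> n" for i
    proof -
      have "(\<integral>\<^sup>+A. \<integral>\<^sup>+B. g (Xcomb n i (Xf (i - 1) A) (Xf (n - i) B)) \<partial>Uspace \<partial>Uspace)
         = (\<integral>\<^sup>+A. \<integral>\<^sup>+x2. g (Xcomb n i (Xf (i - 1) A) x2) \<partial>qs (n - i) \<partial>Uspace)"
      proof (intro nn_integral_cong)
        fix A
        have "n - i < n" using i by simp
        moreover have "(\<lambda>x2. g (Xcomb n i (Xf (i - 1) A) x2)) \<in> borel_measurable NN"
          by (rule measurable_compose[OF _ less.prems], rule Xcomb_measurable) simp_all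
        ultimately show "(\<integral>\<^sup>+B. g (Xcomb n i (Xf (i - 1) A) (Xf (n - i) B)) \<partial>Uspace)
          = (\<integral>\<^sup>+x2. g (Xcomb n i (Xf (i - 1) A) x2) \<partial>qs (n - i))"
          by (rule less.IH)
      qed
      also have "\<dots> = G i" unfolding G_def
      proof (rule less.IH)
        show "(\<lambda>x1. \<integral>\<^sup>+x2. g (Xcomb n i x1 x2) \<partial>qs (n - i)) \<in> borel_measurable NN"
        \<comment> \<open>Finite support turns the inner integral into a finite sum, which makes
          measurability in \<open>x1\<close> a coordinatewise matter.\<close>
        proof (subst nn_integral_measure_pmf_finite)
          have "(\<lambda>x1. g (Xcomb n i x1 x2)) \<in> borel_measurable NN" for x2
            by (rule measurable_compose[OF _ less.prems], rule Xcomb_measurable) simp_all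
          then show "(\<lambda>x1. \<Sum>x2\<in>set_pmf (qs (n - i)). g (Xcomb n i x1 x2) * pmf (qs (n - i)) x2) \<in> borel_measurable NN"
            by (intro borel_measurable_sum borel_measurable_times_ennreal) simp_all
        qed (simp_all add: finite_set_qs)
      qed (use i in auto)
      finally show ?thesis .
    qed
    have "(\<integral>\<^sup>+U. g (Xf n U) \<partial>Uspace) = (\<integral>\<^sup>+u. G (idx n u) \<partial>unif01)"
    proof (subst nn_integral_Uspace)
      show "(\<lambda>U. g (Xf n U)) \<in> borel_measurable Uspace"
        by (rule measurable_compose[OF Xf_measurable less.prems])
      have "(\<integral>\<^sup>+A. \<integral>\<^sup>+B. g (Xf n (glue u A B)) \<partial>Uspace \<partial>Uspace) = G (idx n u)" for u
        unfolding *[OF idx_bounds(1) idx_bounds(2), symmetric, OF less_imp_le, OF not_le_imp_less[OF False]]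
        using False by (simp only: Xf_glue if_False)
      then show "(\<integral>\<^sup>+u. \<integral>\<^sup>+A. \<integral>\<^sup>+B. g (Xf n (glue u A B)) \<partial>Uspace \<partial>Uspace \<partial>unif01)
        = (\<integral>\<^sup>+u. G (idx n u) \<partial>unif01)" by simp
    qed
    also have "\<dots> = (\<Sum>i=1..n. G i) / of_nat n" by (rule nn_integral_idx) (use False in simp)
    also have "\<dots> = (\<integral>\<^sup>+x. g x \<partial>qs n)"
      using False by (simp add: qs_rec nn_integral_pmf_of_set G_def)
    finally show ?thesis .
  qed
qed

lemma distr_Xf: "distr Uspace NN (Xf n) = distr (measure_pmf (qs n)) NN (\<lambda>x. x)"
proof (rule measure_eqI)
  fix A assume "A \<in> sets (distr Uspace NN (Xf n))"
  then have A[measurable]: "A \<in> sets NN" by simp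
  have "emeasure (distr Uspace NN (Xf n)) A = (\<integral>\<^sup>+x. indicator A x \<partial>distr Uspace NN (Xf n))"
    by simp
  also have "\<dots> = (\<integral>\<^sup>+U. indicator A (Xf n U) \<partial>Uspace)" by (rule nn_integral_distr) auto
  also have "\<dots> = (\<integral>\<^sup>+x. indicator A x \<partial>qs n)" by (rule nn_integral_Xf) measurable
  also have "\<dots> = emeasure (distr (measure_pmf (qs n)) NN (\<lambda>x. x)) A"
    by (simp add: emeasure_distr space_PiM)
  finally show "emeasure (distr Uspace NN (Xf n)) A = emeasure (distr (measure_pmf (qs n)) NN (\<lambda>x. x)) A" .
qed simp

lemma integral_Xf:
  fixes g :: "_ \<Rightarrow> real"
  assumes [measurable]: "g \<in> borel_measurable NN"
  shows "(\<integral>U. g (Xf n U) \<partial>Uspace) = measure_pmf.expectation (qs n) g"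
proof -
  have "(\<integral>U. g (Xf n U) \<partial>Uspace) = (\<integral>x. g x \<partial>distr Uspace NN (Xf n))"
    by (rule integral_distr[symmetric]) measurable
  also have "\<dots> = measure_pmf.expectation (qs n) g"
    unfolding distr_Xf by (rule integral_distr[OF _ assms]) simp
  finally show ?thesis .
qed

lemma expectation_bind_finite:
  fixes h :: "'b \<Rightarrow> real"
  assumes "finite (set_pmf p)" "\<And>x. x \<in> set_pmf p \<Longrightarrow> finite (set_pmf (f x))"
  shows "measure_pmf.expectation (bind_pmf p f) h = measure_pmf.expectation p (\<lambda>x. measure_pmf.expectation (f x) h)"
  using assms by (subst pmf_expectation_bind[of "set_pmf p"]) (auto simp: integral_measure_pmf[of "set_pmf p"])

lemma expectation_affine_finite:
  fixes f g :: "'a \<Rightarrow> real"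
  assumes "finite (set_pmf p)" "finite (set_pmf q)"
  shows "measure_pmf.expectation p (\<lambda>x. measure_pmf.expectation q (\<lambda>y. c + (f x + g y)))
    = c + (measure_pmf.expectation p f + measure_pmf.expectation q g)"
  using integrable_measure_pmf_finite[OF assms(1), of f] integrable_measure_pmf_finite[OF assms(2), of g]
  by simp

lemma expectation_qs: "l \<le> n \<Longrightarrow> measure_pmf.expectation (qs n) (\<lambda>y. real (y l)) = meanX n l"
proof (induction n arbitrary: l rule: less_induct)
  case (less n)
  show ?case
  proof (cases "n \<le> 1")
    case True
    then have "meanX n l = 0" using less.prems by (cases "l = 0") (auto simp: meanX_def harm_expand le_Suc_eq)
    then show ?thesis using True by (subst qs.simps) simp
  next
    case False
    let ?E = "\<lambda>n l. measure_pmf.expectation (qs n) (\<lambda>y. real (y l))"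
    show ?thesis
    proof (cases "l = 0")
      case True
      then show ?thesis using False by (subst qs.simps) 
         (simp add: expectation_bind_finite finite_set_qs set_pmf_of_set meanX_def)
    next
      case l: False
      have i: "integrable (measure_pmf (qs k)) f" for k and f :: "_ \<Rightarrow> real"
        by (rule integrable_measure_pmf_finite[OF finite_set_qs])
      have inner: "measure_pmf.expectation (bind_pmf (qs (i - 1)) (\<lambda>x1. bind_pmf (qs (n - i))
          (\<lambda>x2. return_pmf (Xcomb n i x1 x2)))) (\<lambda>y. real (y l)) = real n - 1 +
          (if l < i then ?E (i - 1) l else ?E (i - 1) (i - 1) + ?E (n - i) (l - i))" for i
      proof -
        have "real (Xcomb n i x1 x2 l) = (real n - 1) + (if l < i then real (x1 l) else real (x1 (i - 1)) + real (x2 (l - i)))"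
          for x1 x2 using False l by (auto simp: Xcomb_def of_nat_diff)
        then have "measure_pmf.expectation (bind_pmf (qs (i - 1)) (\<lambda>x1. bind_pmf (qs (n - i))
          (\<lambda>x2. return_pmf (Xcomb n i x1 x2)))) (\<lambda>y. real (y l)) =
           measure_pmf.expectation (qs (i - 1)) (\<lambda>x1. measure_pmf.expectation (qs (n - i))
            (\<lambda>x2. (real n - 1) + (if l < i then real (x1 l) else real (x1 (i - 1)) + real (x2 (l - i)))))"
          by (simp add: expectation_bind_finite finite_set_qs)
        also have "\<dots> = (real n - 1) + (if l < i then ?E (i - 1) l else ?E (i - 1) (i - 1) + ?E (n - i) (l - i))"
          using expectation_affine_finite[OF finite_set_qs finite_set_qs, where f = "\<lambda>x. real (x l)" and g = "\<lambda>_. 0"]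
            expectation_affine_finite[OF finite_set_qs finite_set_qs, where f = "\<lambda>x. real (x (i - 1))"
              and g = "\<lambda>x. real (x (l - i))"] 
          by (cases "l < i"; simp only: if_True if_False add_0_right integral_zero)
        finally show ?thesis .
      qed
      have "?E n l = measure_pmf.expectation (pmf_of_set {1..n}) (\<lambda>i. real n - 1 +
          (if l < i then ?E (i - 1) l else ?E (i - 1) (i - 1) + ?E (n - i) (l - i)))"
        unfolding qs_rec[OF False] inner[symmetric] using False
        by (intro expectation_bind_finite) (auto simp: finite_set_qs set_pmf_of_set)
      also have "\<dots> = (\<Sum>i=1..n. real n - 1 +
          (if l < i then ?E (i - 1) l else ?E (i - 1) (i - 1) + ?E (n - i) (l - i))) / real n"
        using False by (simp add: integral_pmf_of_set)
      also have "\<dots> = (\<Sum>i=1..n. real n - 1 +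
          (if l < i then meanX (i - 1) l else meanX (i - 1) (i - 1) + meanX (n - i) (l - i))) / real n"
        using less.prems False l by (intro arg_cong2[where f="(/)"] sum.cong refl) (auto simp: less.IH)
      also have "\<dots> = meanX n l"
        using less.prems False l by (subst meanX_recursion) auto
      finally show ?thesis .
    qed
  qed
qed

section \<open>Second moments\<close>

text \<open>With values in \<open>ennreal\<close>, so that it is defined without integrability and
  the Fatou lemmas apply directly.\<close>

abbreviation E2 :: "'a measure \<Rightarrow> ('a \<Rightarrow> real) \<Rightarrow> ennreal" where
  "E2 M f \<equiv> (\<integral>\<^sup>+x. ennreal ((f x)\<^sup>2) \<partial>M)"

lemma E2_le_comb:
  assumes "f \<in> borel_measurable M" "g \<in> borel_measurable M" "0 \<le> a" "0 \<le> b"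
    and le: "\<And>x. (h x)\<^sup>2 \<le> a * (f x)\<^sup>2 + b * (g x)\<^sup>2"
  shows "E2 M h \<le> ennreal a * E2 M f + ennreal b * E2 M g"
proof -
  have "E2 M h \<le> (\<integral>\<^sup>+x. ennreal a * ennreal ((f x)\<^sup>2) + ennreal b * ennreal ((g x)\<^sup>2) \<partial>M)"
    using assms(3,4) le by (intro nn_integral_mono) (simp add: ennreal_mult[symmetric] ennreal_plus[symmetric] del: ennreal_plus)
  also have "\<dots> = ennreal a * E2 M f + ennreal b * E2 M g"
    using assms(1,2) by (subst nn_integral_add) (auto simp: nn_integral_cmult)
  finally show ?thesis .
qed

lemma power2_le_of_abs: "\<bar>x\<bar> \<le> c \<Longrightarrow> x\<^sup>2 \<le> (c::real)\<^sup>2"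
  using power_mono[of "\<bar>x\<bar>" c 2] by simp

text \<open>Young's inequality with a free weight. A small \<open>d\<close> keeps the leading
  coefficient close to \<open>1\<close>, so that a contraction factor survives a small perturbation;
  \<open>d = 1\<close> gives the usual factors \<open>2\<close>.\<close>

lemma power2_add_le: "0 < d \<Longrightarrow> (x + y)\<^sup>2 \<le> (1 + d) * x\<^sup>2 + (1 + 1 / d) * (y::real)\<^sup>2"
proof -
  assume d: "0 < d"
  have "0 \<le> (d * x - y)\<^sup>2 / d" using d by simp
  also have "\<dots> = d * x\<^sup>2 - 2 * x * y + y\<^sup>2 / d" using d by (simp add: power2_eq_square field_simps)
  finally show ?thesis by (simp add: power2_eq_square algebra_simps)
qed

lemma E2_add_le:
  assumes "f \<in> borel_measurable M" "g \<in> borel_measurable M" "0 < d"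
  shows "E2 M (\<lambda>x. f x + g x) \<le> ennreal (1 + d) * E2 M f + ennreal (1 + 1 / d) * E2 M g"
  using assms power2_add_le by (intro E2_le_comb) auto

lemma E2_add_le2:
  assumes "f \<in> borel_measurable M" "g \<in> borel_measurable M"
  shows "E2 M (\<lambda>x. f x + g x) \<le> 2 * E2 M f + 2 * E2 M g"
  using E2_add_le[OF assms, of 1] by simp

lemma E2_cmult: "f \<in> borel_measurable M \<Longrightarrow> E2 M (\<lambda>x. c * f x) = ennreal (c\<^sup>2) * E2 M f"
  by (simp add: power_mult_distrib ennreal_mult nn_integral_cmult)

lemma E2_integrable:
  assumes "f \<in> borel_measurable M" "E2 M f \<le> ennreal B"
  shows "integrable M (\<lambda>x. (f x)\<^sup>2)" "E2 M f = ennreal (\<integral>x. (f x)\<^sup>2 \<partial>M)"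
proof -
  have "E2 M f < \<infinity>" using assms(2) by (metis ennreal_less_top infinity_ennreal_def le_less_trans)
  then show i: "integrable M (\<lambda>x. (f x)\<^sup>2)"
    using assms(1) by (intro integrableI_bounded) auto
  show "E2 M f = ennreal (\<integral>x. (f x)\<^sup>2 \<partial>M)"
    by (rule nn_integral_eq_integral[OF i]) simp
qed

lemma (in prob_space) E2_integrable':
  assumes "f \<in> borel_measurable M" "E2 M f \<le> ennreal B"
  shows "integrable M f"
  using square_integrable_imp_integrable[OF assms(1) E2_integrable(1)[OF assms]] .

text \<open>The cross term factorises into \<open>2 * E f * E g\<close> and vanishes once
  \<open>f\<close> is centred. A deterministic toll can therefore be moved into
  \<open>g\<close>.\<close>

lemma (in pair_prob_space) E2_indep_sum:
  assumes f: "f \<in> borel_measurable M1" "E2 M1 f \<le> ennreal Bf" and f0: "(\<integral>x. f x \<partial>M1) = 0"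
    and g: "g \<in> borel_measurable M2" "E2 M2 g \<le> ennreal Bg"
  shows "(\<integral>\<^sup>+x. \<integral>\<^sup>+y. ennreal ((f x + g y)\<^sup>2) \<partial>M2 \<partial>M1) = E2 M1 f + E2 M2 g"
proof -
  note fi = E2_integrable[OF f] M1.E2_integrable'[OF f]
  note gi = E2_integrable[OF g] M2.E2_integrable'[OF g]
  have inner: "(\<integral>\<^sup>+y. ennreal ((a + g y)\<^sup>2) \<partial>M2) = ennreal (a\<^sup>2 + (2 * a * (\<integral>y. g y \<partial>M2) + (\<integral>y. (g y)\<^sup>2 \<partial>M2)))"
    (is "_ = ennreal (?h a)") and nn: "0 \<le> a\<^sup>2 + (2 * a * (\<integral>y. g y \<partial>M2) + (\<integral>y. (g y)\<^sup>2 \<partial>M2))" for a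
  proof -
    have i: "integrable M2 (\<lambda>y. a\<^sup>2 + (2 * a * g y + (g y)\<^sup>2))"
      using gi by (intro Bochner_Integration.integrable_add integrable_mult_right) auto
    have e: "(\<integral>y. a\<^sup>2 + (2 * a * g y + (g y)\<^sup>2) \<partial>M2) = ?h a"
      using gi by (simp add: M2.prob_space)
    have sq: "(a + x)\<^sup>2 = a\<^sup>2 + (2 * a * x + x\<^sup>2)" for x by (simp add: power2_sum)
    have pos: "0 \<le> a\<^sup>2 + (2 * a * x + x\<^sup>2)" for x unfolding sq[symmetric] by simp
    show "(\<integral>\<^sup>+y. ennreal ((a + g y)\<^sup>2) \<partial>M2) = ennreal (?h a)"
      unfolding sq e[symmetric] by (rule nn_integral_eq_integral[OF i]) (simp add: pos)
    show "0 \<le> ?h a" unfolding e[symmetric] by (rule Bochner_Integration.integral_nonneg) (rule pos)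
  qed
  have i: "integrable M1 (\<lambda>x. (f x)\<^sup>2 + (2 * f x * (\<integral>y. g y \<partial>M2) + (\<integral>y. (g y)\<^sup>2 \<partial>M2)))"
    using fi by (intro Bochner_Integration.integrable_add) auto
  have "(\<integral>\<^sup>+x. \<integral>\<^sup>+y. ennreal ((f x + g y)\<^sup>2) \<partial>M2 \<partial>M1)
    = ennreal (\<integral>x. (f x)\<^sup>2 + (2 * f x * (\<integral>y. g y \<partial>M2) + (\<integral>y. (g y)\<^sup>2 \<partial>M2)) \<partial>M1)"
    unfolding inner by (rule nn_integral_eq_integral[OF i]) (simp add: nn)
  also have "(\<integral>x. (f x)\<^sup>2 + (2 * f x * (\<integral>y. g y \<partial>M2) + (\<integral>y. (g y)\<^sup>2 \<partial>M2)) \<partial>M1)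
     = (\<integral>x. (f x)\<^sup>2 \<partial>M1) + (\<integral>y. (g y)\<^sup>2 \<partial>M2)"
    using fi f0 by (simp add: M1.prob_space)
  also have "ennreal \<dots> = E2 M1 f + E2 M2 g"
    unfolding fi(2) gi(2) by (rule ennreal_plus) auto
  finally show ?thesis .
qed

section \<open>Asymptotic bounds for second moments\<close>

definition limsup_le :: "(nat \<Rightarrow> ennreal) \<Rightarrow> real \<Rightarrow> bool" where
  "limsup_le s K \<longleftrightarrow> 0 \<le> K \<and> (\<forall>e>0. \<forall>\<^sub>F k in sequentially. s k \<le> ennreal (K + e))"

lemma limsup_leD: "limsup_le s K \<Longrightarrow> 0 < e \<Longrightarrow> \<forall>\<^sub>F k in sequentially. s k \<le> ennreal (K + e)"
  unfolding limsup_le_def by blast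

lemma limsup_le_nonneg: "limsup_le s K \<Longrightarrow> 0 \<le> K"
  by (simp add: limsup_le_def)

text \<open>The epsilon form is convenient for combining sequences, the \<open>limsup\<close> form
  is what the reverse Fatou lemma delivers.\<close>

lemma limsup_le_iff: "limsup_le s K \<longleftrightarrow> 0 \<le> K \<and> limsup s \<le> ennreal K"
proof safe
  assume l: "limsup_le s K"
  then show "0 \<le> K" by (simp add: limsup_le_def)
  show "limsup s \<le> ennreal K"
  proof (rule ennreal_le_epsilon)
    fix e :: real assume e: "0 < e"
    have "limsup s \<le> ennreal (K + e)" by (rule Limsup_bounded[OF limsup_leD[OF l e]])
    then show "limsup s \<le> ennreal K + ennreal e" using \<open>0 \<le> K\<close> e by (simp add: ennreal_plus)
  qed
next
  assume K: "0 \<le> K" "limsup s \<le> ennreal K"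
  show "limsup_le s K" unfolding limsup_le_def
  proof (intro conjI allI impI K(1))
    fix e :: real assume "0 < e"
    then have "limsup s < ennreal (K + e)"
      using K by (intro le_less_trans[OF K(2)]) (simp add: ennreal_less_iff)
    from Limsup_lessD[OF this] show "\<forall>\<^sub>F k in sequentially. s k \<le> ennreal (K + e)"
      by eventually_elim simp
  qed
qed

lemma limsup_le_mono:
  "limsup_le s K \<Longrightarrow> K \<le> K' \<Longrightarrow> limsup_le s K'"
  unfolding limsup_le_iff by (auto intro: order_trans ennreal_leI)

lemma limsup_le_mono':
  assumes "limsup_le s K" "\<forall>\<^sub>F k in sequentially. s' k \<le> s k"
  shows "limsup_le s' K"
  unfolding limsup_le_def
proof (intro conjI allI impI)
  show "0 \<le> K" using assms(1) by (rule limsup_le_nonneg)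
  fix e :: real assume "0 < e"
  from limsup_leD[OF assms(1) this] assms(2)
  show "\<forall>\<^sub>F k in sequentially. s' k \<le> ennreal (K + e)" by eventually_elim (rule order_trans)
qed

lemma limsup_le_compose:
  assumes "limsup_le s K" "filterlim n sequentially sequentially"
  shows "limsup_le (\<lambda>k. s (n k)) K"
  unfolding limsup_le_def
proof (intro conjI allI impI)
  show "0 \<le> K" using assms(1) by (rule limsup_le_nonneg)
  fix e :: real assume "0 < e"
  from limsup_leD[OF assms(1) this] assms(2)
  show "\<forall>\<^sub>F k in sequentially. s (n k) \<le> ennreal (K + e)" by (auto simp: filterlim_iff)
qed

lemma limsup_le_add:
  assumes "limsup_le s K" "limsup_le s' K'"
  shows "limsup_le (\<lambda>k. s k + s' k) (K + K')"
  unfolding limsup_le_def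
proof (intro conjI allI impI)
  show "0 \<le> K + K'" using limsup_le_nonneg[OF assms(1)] limsup_le_nonneg[OF assms(2)] by simp
  fix e :: real assume "0 < e"
  then have e: "0 < e / 2" by simp
  from limsup_leD[OF assms(1) e] limsup_leD[OF assms(2) e]
  show "\<forall>\<^sub>F k in sequentially. s k + s' k \<le> ennreal (K + K' + e)"
  proof eventually_elim
    case (elim k)
    have "s k + s' k \<le> ennreal (K + e / 2) + ennreal (K' + e / 2)" by (rule add_mono[OF elim])
    also have "\<dots> = ennreal (K + K' + e)"
      using limsup_le_nonneg[OF assms(1)] limsup_le_nonneg[OF assms(2)] e
      by (subst ennreal_plus[symmetric]) auto
    finally show ?case .
  qed
qed

text \<open>Rewrite the error as \<open>c * (V k - G)\<close> plus
  \<open>(r k - c) * V k + d k\<close>. The second part tends to zero in the second mean because the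
  \<open>V k\<close> are bounded there, and Young's inequality with a small weight adds it without
  spoiling the factor \<open>c^2\<close>.\<close>

lemma limsup_le_perturb:
  assumes M: "prob_space M"
    and V: "\<And>k. V k \<in> borel_measurable M" "\<And>k. E2 M (V k) \<le> ennreal B" and B: "0 \<le> B"
    and G: "G \<in> borel_measurable M"
    and lim: "limsup_le (\<lambda>k. E2 M (\<lambda>x. V k x - G x)) K"
    and r: "r \<longlonglongrightarrow> c" and d: "d \<longlonglongrightarrow> (0::real)"
  shows "limsup_le (\<lambda>k. E2 M (\<lambda>x. r k * V k x - c * G x + d k)) (c\<^sup>2 * K)"
  unfolding limsup_le_def
proof (intro conjI allI impI)
  interpret prob_space M by (rule M)
  have K: "0 \<le> K" using lim by (rule limsup_le_nonneg)
  then show "0 \<le> c\<^sup>2 * K" by simp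
  fix e :: real assume e: "0 < e"
  \<comment> \<open>One number \<open>b\<close> plays three roles: Young weight, slack in the
    asymptotic bound, and bound for the vanishing remainder.\<close>
  have "((\<lambda>b. (1 + b) * (c\<^sup>2 * (K + b)) + b) \<longlongrightarrow> (1 + 0) * (c\<^sup>2 * (K + 0)) + 0) (at_right 0)"
    by (intro tendsto_intros)
  then have "\<forall>\<^sub>F b in at_right 0. (1 + b) * (c\<^sup>2 * (K + b)) + b < c\<^sup>2 * K + e"
    using e by (intro order_tendstoD) auto
  then have "\<forall>\<^sub>F b in at_right 0. 0 < b \<and> (1 + b) * (c\<^sup>2 * (K + b)) + b < c\<^sup>2 * K + e"
    using eventually_at_right_less[of "0::real"] by eventually_elim auto
  then obtain b where b: "0 < b" "(1 + b) * (c\<^sup>2 * (K + b)) + b < c\<^sup>2 * K + e"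
    using eventually_happens' trivial_limit_at_right_real by blast
  define s where "s k = (1 + 1 / b) * (2 * ((r k - c)\<^sup>2 * B) + 2 * (d k)\<^sup>2)" for k
  have "(\<lambda>k. s k) \<longlonglongrightarrow> (1 + 1 / b) * (2 * ((c - c)\<^sup>2 * B) + 2 * 0\<^sup>2)"
    unfolding s_def by (intro tendsto_intros r d)
  then have "\<forall>\<^sub>F k in sequentially. s k < b" using b by (intro order_tendstoD) auto
  with limsup_leD[OF lim b(1)]
  show "\<forall>\<^sub>F k in sequentially. E2 M (\<lambda>x. r k * V k x - c * G x + d k) \<le> ennreal (c\<^sup>2 * K + e)"
  proof eventually_elim
    case (elim k)
    note m = V(1)[of k] G
    have "E2 M (\<lambda>x. r k * V k x - c * G x + d k) = E2 M (\<lambda>x. c * (V k x - G x) + ((r k - c) * V k x + d k))"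
      by (simp add: algebra_simps)
    also have "\<dots> \<le> ennreal (1 + b) * E2 M (\<lambda>x. c * (V k x - G x)) + ennreal (1 + 1 / b) * E2 M (\<lambda>x. (r k - c) * V k x + d k)"
      using m b by (intro E2_add_le) auto
    also have "E2 M (\<lambda>x. c * (V k x - G x)) = ennreal (c\<^sup>2) * E2 M (\<lambda>x. V k x - G x)"
      using m by (intro E2_cmult) auto
    also have "ennreal (1 + b) * (ennreal (c\<^sup>2) * E2 M (\<lambda>x. V k x - G x)) \<le> ennreal (1 + b) * (ennreal (c\<^sup>2) * ennreal (K + b))"
      by (intro mult_left_mono elim) auto
    also have "\<dots> = ennreal ((1 + b) * (c\<^sup>2 * (K + b)))"
      using b K by (simp add: ennreal_mult[symmetric] del: ennreal_plus)
    also have "E2 M (\<lambda>x. (r k - c) * V k x + d k) \<le> 2 * E2 M (\<lambda>x. (r k - c) * V k x) + 2 * E2 M (\<lambda>x. d k)"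
      using m by (intro E2_add_le2) auto
    also have "E2 M (\<lambda>x. (r k - c) * V k x) = ennreal ((r k - c)\<^sup>2) * E2 M (V k)"
      using m by (intro E2_cmult) auto
    also have "E2 M (\<lambda>x. d k) = ennreal ((d k)\<^sup>2)" by (simp add: emeasure_space_1)
    also have "2 * (ennreal ((r k - c)\<^sup>2) * E2 M (V k)) + 2 * ennreal ((d k)\<^sup>2)
      \<le> 2 * (ennreal ((r k - c)\<^sup>2) * ennreal B) + 2 * ennreal ((d k)\<^sup>2)"
      by (intro add_mono mult_left_mono V order_refl) auto
    also have "\<dots> = ennreal (2 * ((r k - c)\<^sup>2 * B) + 2 * (d k)\<^sup>2)"
      using B by (simp add: ennreal_mult ennreal_plus)
    also have "ennreal (1 + 1 / b) * \<dots> = ennreal (s k)"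
      unfolding s_def using b B by (subst ennreal_mult) auto
    also have "ennreal ((1 + b) * (c\<^sup>2 * (K + b))) + ennreal (s k) = ennreal ((1 + b) * (c\<^sup>2 * (K + b)) + s k)"
      using b K B by (intro ennreal_plus[symmetric]) (auto simp: s_def)
    also have "\<dots> \<le> ennreal (c\<^sup>2 * K + e)" using elim b by (intro ennreal_leI) simp
    finally show ?case by (simp add: mult_left_mono add_left_mono)
  qed
qed

text \<open>The source of the contraction factor \<open>2 / 3\<close>.\<close>

lemma nn_integral_unif01_quadratic:
  assumes "0 \<le> a" "0 \<le> b"
  shows "(\<integral>\<^sup>+u. ennreal (a + b * (u\<^sup>2 + (1 - u)\<^sup>2)) \<partial>unif01) = ennreal (a + 2 / 3 * b)"
proof -
  let ?F = "\<lambda>u::real. a * u + b * (u ^ 3 / 3 - (1 - u) ^ 3 / 3)"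
  have "(\<integral>\<^sup>+u. ennreal (a + b * (u\<^sup>2 + (1 - u)\<^sup>2)) * indicator {0..1} u \<partial>lborel) = ennreal (?F 1 - ?F 0)"
  proof (rule nn_integral_FTC_Icc)
    show "DERIV ?F x :> a + b * (x\<^sup>2 + (1 - x)\<^sup>2)" for x
      by (auto intro!: derivative_eq_intros simp: power2_eq_square)
  qed (use assms in auto)
  then show ?thesis
    by (subst nn_integral_uniform_measure) (auto simp: divide_ennreal_def add.commute)
qed

section \<open>Centred costs and their second moment of order \<open>n^2\<close>\<close>

definition Xcent :: "nat \<Rightarrow> nat \<Rightarrow> (bool list \<Rightarrow> real) \<Rightarrow> real" where
  "Xcent n l U = real (Xf n U l) - meanX n l"

lemma Xcent_measurable: "Xcent n l \<in> borel_measurable Uspace"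
proof -
  have "(\<lambda>U. real (Xf n U l)) \<in> borel_measurable Uspace"
    by (rule measurable_compose[OF Xf_measurable']) simp
  then show ?thesis unfolding Xcent_def[abs_def] by (intro borel_measurable_diff borel_measurable_const)
qed

lemma Xcent_bound: "\<bar>Xcent n l U\<bar> \<le> real (n * n) + \<bar>meanX n l\<bar>"
proof -
  have "real (Xf n U l) \<le> real (n * n)" using Xf_le by (rule of_nat_mono)
  then show ?thesis unfolding Xcent_def by linarith
qed

lemma Xcent_E2_finite: "\<exists>B. E2 Uspace (Xcent n l) \<le> ennreal B"
proof
  have "(Xcent n l U)\<^sup>2 \<le> (real (n * n) + \<bar>meanX n l\<bar>)\<^sup>2" for U
    using Xcent_bound by (rule power2_le_of_abs)
  then have "E2 Uspace (Xcent n l) \<le> (\<integral>\<^sup>+x. ennreal ((real (n * n) + \<bar>meanX n l\<bar>)\<^sup>2) \<partial>Uspace)"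
    by (intro nn_integral_mono ennreal_leI)
  also have "\<dots> = ennreal ((real (n * n) + \<bar>meanX n l\<bar>)\<^sup>2)"
    by (simp only: nn_integral_const U.emeasure_space_1 mult_1_right)
  finally show "E2 Uspace (Xcent n l) \<le> ennreal ((real (n * n) + \<bar>meanX n l\<bar>)\<^sup>2)" .
qed

lemma Xcent_integrable: "integrable Uspace (Xcent n l)"
  using Xcent_E2_finite U.E2_integrable'[OF Xcent_measurable] by blast

lemma Xcent_mean: "l \<le> n \<Longrightarrow> (\<integral>U. Xcent n l U \<partial>Uspace) = 0"
proof -
  assume l: "l \<le> n"
  have "(\<lambda>x. x l) \<in> NN \<rightarrow>\<^sub>M count_space UNIV" by (rule measurable_component_singleton) simp
  then have m: "(\<lambda>x. real (x l)) \<in> borel_measurable NN" by (rule measurable_compose) simp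
  have "(\<integral>U. real (Xf n U l) \<partial>Uspace) = meanX n l"
    using integral_Xf[OF m] expectation_qs[OF l] by (simp only:)
  moreover have "integrable Uspace (\<lambda>U. real (Xf n U l))"
  proof -
    have "integrable Uspace (\<lambda>U. Xcent n l U + meanX n l)"
      by (intro Bochner_Integration.integrable_add Xcent_integrable) simp
    then show ?thesis by (simp add: Xcent_def)
  qed
  ultimately show ?thesis unfolding Xcent_def
    by (subst Bochner_Integration.integral_diff) (simp_all add: U.prob_space[simplified])
qed

lemma Xcent_trivial: "n \<le> 1 \<or> l = 0 \<Longrightarrow> l \<le> n \<Longrightarrow> Xcent n l U = 0"
proof -
  assume a: "n \<le> 1 \<or> l = 0" "l \<le> n"
  have "Xf n U l = 0" using a by (subst Xf.simps) (auto simp: Xcomb_def)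
  moreover have "meanX n l = 0"
  proof (cases "l = 0")
    case False
    then have "n = 1" "l = 1" using a by auto
    then show ?thesis by (simp add: meanX_def harm_expand)
  qed (simp add: meanX_def)
  ultimately show ?thesis by (simp add: Xcent_def)
qed

text \<open>The two cases of the recursion are written as one: for \<open>l < i\<close> the truncated
  difference \<open>l - i\<close> is \<open>0\<close> and the last term vanishes.\<close>

lemma Xcent_glue:
  assumes "2 \<le> n" "1 \<le> l" "l \<le> n"
  shows "Xcent n l (glue u A B) = real n * toll n l (idx n u)
     + Xcent (idx n u - 1) (min l (idx n u - 1)) A + Xcent (n - idx n u) (l - idx n u) B"
proof -
  define i where "i = idx n u"
  have i: "1 \<le> i" "i \<le> n" using idx_bounds[of n u] assms by (auto simp: i_def)
  have X: "Xf n (glue u A B) = Xcomb n i (Xf (i - 1) A) (Xf (n - i) B)"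
    using assms by (simp add: Xf_glue i_def)
  have c: "real n * toll n l i = real n - 1 + (if l < i then meanX (i - 1) l else meanX (i - 1) (i - 1) + meanX (n - i) (l - i)) - meanX n l"
    using assms by (simp add: toll_def)
  show ?thesis
  proof (cases "l < i")
    case True
    have "Xcent (n - i) (l - i) B = 0" using True by (intro Xcent_trivial) auto
    moreover have "min l (i - 1) = l" using True by simp
    ultimately show ?thesis unfolding i_def[symmetric] c Xcent_def X using True assms
      by (simp add: Xcomb_def of_nat_diff)
  next
    case False
    then have "min l (i - 1) = i - 1" by simp
    then show ?thesis unfolding i_def[symmetric] c Xcent_def X using False assms
      by (simp add: Xcomb_def of_nat_diff)
  qed
qed

text \<open>Consequently the left size \<open>idx n u - 1\<close> is at most \<open>n * u\<close>
  and the right size \<open>n - idx n u\<close> at most \<open>n * (1 - u)\<close>, with no rounding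
  error left over in the second moment induction.\<close>

lemma idx_ge: "0 < u \<Longrightarrow> u \<le> 1 \<Longrightarrow> 1 \<le> n \<Longrightarrow> real n * u \<le> real (idx n u) \<and> real (idx n u) \<le> real n * u + 1"
proof -
  assume u: "0 < u" "u \<le> 1" "1 \<le> n"
  have c: "0 < \<lceil>real n * u\<rceil>" using u by simp
  have "real n * u \<le> real n" using u by (simp add: mult_left_le)
  then have c2: "\<lceil>real n * u\<rceil> \<le> int n" by (simp add: ceiling_le_iff)
  have "idx n u = nat \<lceil>real n * u\<rceil>" using c c2 unfolding idx_def by linarith
  moreover have "real n * u \<le> of_int \<lceil>real n * u\<rceil>" "of_int \<lceil>real n * u\<rceil> \<le> real n * u + 1" by linarith+
  ultimately show ?thesis using c by simp
qed

lemma AE_unif01: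
  assumes "\<And>u. 0 < u \<Longrightarrow> u < 1 \<Longrightarrow> u \<noteq> t \<Longrightarrow> P u"
  shows "AE u in unif01. P u"
proof (rule AE_uniform_measureI)
  show "AE u in lborel. u \<in> {0..1} \<longrightarrow> P u"
    using AE_lborel_singleton[of 0] AE_lborel_singleton[of 1] AE_lborel_singleton[of t]
    by eventually_elim (use assms in auto)
qed simp

text \<open>The fixed point of \<open>B = 415^2 + 2 / 3 * B\<close>, where \<open>415\<close> is the
  uniform bound for the toll.\<close>

definition B0 :: real where "B0 = 3 * 415\<^sup>2"

lemma B0_nonneg: "0 \<le> B0" by (simp add: B0_def)

text \<open>Given the root \<open>u\<close>, independence and centring make the second moment
  additive, which bounds it by \<open>n^2\<close> times
  \<open>415^2 + B0 * (u^2 + (1 - u)^2)\<close>; integrating over \<open>u\<close> reproduces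
  \<open>B0\<close>.\<close>

lemma Xcent_E2: "l \<le> n \<Longrightarrow> E2 Uspace (Xcent n l) \<le> ennreal (B0 * (real n)\<^sup>2)"
proof (induction n arbitrary: l rule: less_induct)
  case (less n)
  show ?case
  proof (cases "n \<le> 1 \<or> l = 0")
    case True
    then show ?thesis using Xcent_trivial[OF True less.prems] by simp
  next
    case False
    then have nl: "2 \<le> n" "1 \<le> l" "l \<le> n" using less.prems by auto
    have inner: "(\<integral>\<^sup>+A. \<integral>\<^sup>+B. ennreal ((Xcent n l (glue u A B))\<^sup>2) \<partial>Uspace \<partial>Uspace)
       \<le> ennreal ((real n)\<^sup>2 * (415\<^sup>2) + (real n)\<^sup>2 * B0 * (u\<^sup>2 + (1 - u)\<^sup>2))" if u: "0 < u" "u < 1" for u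
    proof -
      define i where "i = idx n u"
      have i: "1 \<le> i" "i \<le> n" using idx_bounds[of n u] nl by (auto simp: i_def)
      have iu: "real n * u \<le> real i" "real i \<le> real n * u + 1" using idx_ge[of u n] u nl by (auto simp: i_def)
      let ?f = "Xcent (i - 1) (min l (i - 1))" and ?w = "Xcent (n - i) (l - i)"
      define c where "c = real n * toll n l i"
      have f: "E2 Uspace ?f \<le> ennreal (B0 * (real (i - 1))\<^sup>2)" by (rule less.IH) (use i in auto)
      have w: "E2 Uspace ?w \<le> ennreal (B0 * (real (n - i))\<^sup>2)" by (rule less.IH) (use i nl in auto)
      have E: "(\<integral>\<^sup>+A. \<integral>\<^sup>+B. ennreal ((g A + h B)\<^sup>2) \<partial>Uspace \<partial>Uspace) = E2 Uspace g + E2 Uspace h"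
        if "g \<in> borel_measurable Uspace" "E2 Uspace g \<le> ennreal Bg" "(\<integral>x. g x \<partial>Uspace) = 0"
          "h \<in> borel_measurable Uspace" "E2 Uspace h \<le> ennreal Bh" for g h Bg Bh
        by (rule UxU.E2_indep_sum[OF that])
      have w0: "(\<integral>x. ?w x \<partial>Uspace) = 0" by (rule Xcent_mean) (use i nl in auto)
      have f0: "(\<integral>x. ?f x \<partial>Uspace) = 0" by (rule Xcent_mean) simp
      have cE: "E2 Uspace (\<lambda>_. c) = ennreal (c\<^sup>2)"
        by (simp only: nn_integral_const U.emeasure_space_1 mult_1_right)
      \<comment> \<open>The same additivity with a constant as second summand. Exactness matters:
        doubling the factor \<open>2 / 3\<close> would exceed \<open>1\<close> and the induction
        would not close.\<close>
      have wc: "E2 Uspace (\<lambda>x. ?w x + c) = E2 Uspace ?w + ennreal (c\<^sup>2)"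
      proof -
        have "(\<integral>\<^sup>+A. \<integral>\<^sup>+B. ennreal ((?w A + c)\<^sup>2) \<partial>Uspace \<partial>Uspace) = E2 Uspace ?w + E2 Uspace (\<lambda>_. c)"
          by (rule E[OF Xcent_measurable w w0 borel_measurable_const, where Bh = "c\<^sup>2"]) (simp only: cE order_refl)
        then show ?thesis by (simp only: nn_integral_const U.emeasure_space_1 mult_1_right)
      qed
      have wm: "(\<lambda>x. ?w x + c) \<in> borel_measurable Uspace"
        by (intro borel_measurable_add Xcent_measurable borel_measurable_const)
      have wb: "E2 Uspace ?w + ennreal (c\<^sup>2) \<le> ennreal (B0 * (real (n - i))\<^sup>2 + c\<^sup>2)"
        using w B0_nonneg by (subst ennreal_plus) (auto intro: add_mono)
      have "(\<integral>\<^sup>+A. \<integral>\<^sup>+B. ennreal ((Xcent n l (glue u A B))\<^sup>2) \<partial>Uspace \<partial>Uspace)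
        = (\<integral>\<^sup>+A. \<integral>\<^sup>+B. ennreal ((?f A + (?w B + c))\<^sup>2) \<partial>Uspace \<partial>Uspace)"
        unfolding Xcent_glue[OF nl] i_def[symmetric] c_def[symmetric] by (simp only: add_ac)
      also have "\<dots> = E2 Uspace ?f + E2 Uspace (\<lambda>x. ?w x + c)"
        by (rule E[OF Xcent_measurable f f0 wm ord_eq_le_trans[OF wc wb]])
      also have "\<dots> \<le> ennreal (B0 * (real (i - 1))\<^sup>2) + ennreal (B0 * (real (n - i))\<^sup>2 + c\<^sup>2)"
        unfolding wc by (rule add_mono[OF f wb])
      also have "\<dots> = ennreal (B0 * (real (i - 1))\<^sup>2 + (B0 * (real (n - i))\<^sup>2 + c\<^sup>2))"
        using B0_nonneg by (subst ennreal_plus) auto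
      also have "\<dots> \<le> ennreal ((real n)\<^sup>2 * (415\<^sup>2) + (real n)\<^sup>2 * B0 * (u\<^sup>2 + (1 - u)\<^sup>2))"
      proof (rule ennreal_leI)
        have "(real (i - 1))\<^sup>2 \<le> (real n * u)\<^sup>2" using i iu by (intro power_mono) (auto simp: of_nat_diff)
        moreover have "(real (n - i))\<^sup>2 \<le> (real n * (1 - u))\<^sup>2"
          using i iu by (intro power_mono) (auto simp: of_nat_diff algebra_simps)
        moreover have "c\<^sup>2 \<le> (real n)\<^sup>2 * 415\<^sup>2"
          unfolding c_def power_mult_distrib by (intro mult_left_mono power2_le_of_abs toll_bounded nl i) simp
        ultimately have le: "B0 * ((real (i - 1))\<^sup>2 + (real (n - i))\<^sup>2) + c\<^sup>2
            \<le> B0 * ((real n * u)\<^sup>2 + (real n * (1 - u))\<^sup>2) + (real n)\<^sup>2 * 415\<^sup>2"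
          using B0_nonneg by (intro add_mono mult_left_mono) auto
        show "B0 * (real (i - 1))\<^sup>2 + (B0 * (real (n - i))\<^sup>2 + c\<^sup>2)
           \<le> (real n)\<^sup>2 * (415\<^sup>2) + (real n)\<^sup>2 * B0 * (u\<^sup>2 + (1 - u)\<^sup>2)"
        proof -
          have "B0 * ((real n * u)\<^sup>2 + (real n * (1 - u))\<^sup>2) + (real n)\<^sup>2 * 415\<^sup>2
            = (real n)\<^sup>2 * 415\<^sup>2 + (real n)\<^sup>2 * B0 * (u\<^sup>2 + (1 - u)\<^sup>2)" by algebra
          moreover have "B0 * ((real (i - 1))\<^sup>2 + (real (n - i))\<^sup>2) + c\<^sup>2
            = B0 * (real (i - 1))\<^sup>2 + (B0 * (real (n - i))\<^sup>2 + c\<^sup>2)" by algebra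
          ultimately show ?thesis using le by (simp only:)
        qed
      qed
      finally show ?thesis .
    qed
    have m: "(\<lambda>x. ennreal ((Xcent n l x)\<^sup>2)) \<in> borel_measurable Uspace"
      by (intro measurable_compose[OF Xcent_measurable, of "\<lambda>x. ennreal (x\<^sup>2)"]) simp
    have "E2 Uspace (Xcent n l) = (\<integral>\<^sup>+u. \<integral>\<^sup>+A. \<integral>\<^sup>+B. ennreal ((Xcent n l (glue u A B))\<^sup>2) \<partial>Uspace \<partial>Uspace \<partial>unif01)"
      by (rule nn_integral_Uspace[OF m])
    also have "\<dots> \<le> (\<integral>\<^sup>+u. ennreal ((real n)\<^sup>2 * (415\<^sup>2) + (real n)\<^sup>2 * B0 * (u\<^sup>2 + (1 - u)\<^sup>2)) \<partial>unif01)"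
      by (intro nn_integral_mono_AE AE_unif01 inner)
    also have "\<dots> = ennreal ((real n)\<^sup>2 * (415\<^sup>2) + 2 / 3 * ((real n)\<^sup>2 * B0))"
      using B0_nonneg by (intro nn_integral_unif01_quadratic) auto
    also have "(real n)\<^sup>2 * (415\<^sup>2) + 2 / 3 * ((real n)\<^sup>2 * B0) = B0 * (real n)\<^sup>2"
      by (simp add: B0_def)
    finally show ?thesis .
  qed
qed

definition Xnorm :: "nat \<Rightarrow> nat \<Rightarrow> (bool list \<Rightarrow> real) \<Rightarrow> real" where
  "Xnorm n l U = Xcent n l U / real n"

lemma Xnorm_measurable: "Xnorm n l \<in> borel_measurable Uspace"
  unfolding Xnorm_def[abs_def] by (intro borel_measurable_divide Xcent_measurable borel_measurable_const)

lemma Xnorm_mean: "l \<le> n \<Longrightarrow> (\<integral>U. Xnorm n l U \<partial>Uspace) = 0"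
  unfolding Xnorm_def by (simp add: Xcent_mean)

lemma Xnorm_E2: "l \<le> n \<Longrightarrow> E2 Uspace (Xnorm n l) \<le> ennreal B0"
proof (cases "n = 0")
  case False
  assume l: "l \<le> n"
  have "E2 Uspace (Xnorm n l) = E2 Uspace (\<lambda>x. (1 / real n) * Xcent n l x)" by (simp add: Xnorm_def)
  also have "\<dots> = ennreal ((1 / real n)\<^sup>2) * E2 Uspace (Xcent n l)" by (rule E2_cmult[OF Xcent_measurable])
  also have "\<dots> \<le> ennreal ((1 / real n)\<^sup>2) * ennreal (B0 * (real n)\<^sup>2)"
    by (intro mult_left_mono Xcent_E2 l) simp
  also have "\<dots> = ennreal ((1 / real n)\<^sup>2 * (B0 * (real n)\<^sup>2))" by (rule ennreal_mult[symmetric]) (auto simp: B0_def)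
  also have "(1 / real n)\<^sup>2 * (B0 * (real n)\<^sup>2) = B0" using False by (simp add: field_simps)
  finally show ?thesis .
qed (simp add: Xnorm_def)

lemma Xnorm_glue:
  assumes "2 \<le> n" "1 \<le> l" "l \<le> n"
  shows "Xnorm n l (glue u A B) = toll n l (idx n u)
     + real (idx n u - 1) / real n * Xnorm (idx n u - 1) (min l (idx n u - 1)) A
     + real (n - idx n u) / real n * Xnorm (n - idx n u) (l - idx n u) B"
proof -
  \<comment> \<open>For size \<open>a = 0\<close> the right side is zero by the convention for
    division, and the left side is zero because the centred cost is.\<close>
  have s: "Xcent a b U / real n = real a / real n * Xnorm a b U" if "b \<le> a" for a b U
    using Xcent_trivial[of a b U] that by (cases "a = 0") (auto simp: Xnorm_def)
  have "Xnorm n l (glue u A B) = toll n l (idx n u)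
    + Xcent (idx n u - 1) (min l (idx n u - 1)) A / real n + Xcent (n - idx n u) (l - idx n u) B / real n"
    using assms unfolding Xnorm_def[of n] Xcent_glue[OF assms] by (simp add: add_divide_distrib)
  also have "\<dots> = toll n l (idx n u)
     + real (idx n u - 1) / real n * Xnorm (idx n u - 1) (min l (idx n u - 1)) A
     + real (n - idx n u) / real n * Xnorm (n - idx n u) (l - idx n u) B"
    using assms by (subst (1 2) s) auto
  finally show ?thesis .
qed

section \<open>One step of the recursion in the limit\<close>

text \<open>The reverse Fatou lemma is applied to conditional errors as functions of the root, which
  must therefore be measurable in \<open>u\<close>.\<close>

lemma measurable_nn_integral_glue:
  assumes f: "f \<in> borel_measurable Uspace"
  shows "(\<lambda>u. \<integral>\<^sup>+A. \<integral>\<^sup>+B. f (glue u A B) \<partial>Uspace \<partial>Uspace) \<in> borel_measurable unif01"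
proof -
  let ?g = "\<lambda>(u, A, B). glue u A B"
  have m: "(\<lambda>x. f (?g x)) \<in> borel_measurable (unif01 \<Otimes>\<^sub>M (Uspace \<Otimes>\<^sub>M Uspace))"
    by (rule measurable_compose[OF glue_prod_measurable f])
  have m2: "(\<lambda>y. f (?g (u, y))) \<in> borel_measurable (Uspace \<Otimes>\<^sub>M Uspace)" for u
    by (rule measurable_compose[OF _ m]) simp
  have "(\<lambda>u. \<integral>\<^sup>+y. f (?g (u, y)) \<partial>(Uspace \<Otimes>\<^sub>M Uspace)) \<in> borel_measurable unif01"
    by (rule UxU.P.borel_measurable_nn_integral_fst[OF m])
  also have "(\<lambda>u. \<integral>\<^sup>+y. f (?g (u, y)) \<partial>(Uspace \<Otimes>\<^sub>M Uspace)) = (\<lambda>u. \<integral>\<^sup>+A. \<integral>\<^sup>+B. f (?g (u, A, B)) \<partial>Uspace \<partial>Uspace)"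
    by (simp only: U.nn_integral_fst[symmetric, OF m2])
  finally show ?thesis by simp
qed

lemma filterlim_ratio:
  fixes a n :: "nat \<Rightarrow> nat"
  assumes n: "filterlim n sequentially sequentially" and a: "(\<lambda>k. real (a k) / real (n k)) \<longlonglongrightarrow> c" and c: "0 < c"
  shows "filterlim a sequentially sequentially"
proof -
  have "filterlim (\<lambda>k. real (n k)) at_top sequentially"
    using n by (simp add: filterlim_sequentially_iff_filterlim_real)
  from filterlim_tendsto_pos_mult_at_top[OF a c this]
  have "filterlim (\<lambda>k. real (a k) / real (n k) * real (n k)) at_top sequentially" .
  moreover have "\<forall>\<^sub>F k in sequentially. 1 \<le> n k" using n by (auto simp: filterlim_at_top)
  then have "\<forall>\<^sub>F k in sequentially. real (a k) / real (n k) * real (n k) = real (a k)"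
    by eventually_elim simp
  ultimately have "filterlim (\<lambda>k. real (a k)) at_top sequentially"
    by (simp cong: filterlim_cong)
  then show ?thesis by (simp add: filterlim_sequentially_iff_filterlim_real)
qed

lemma idx_limits:
  fixes n :: "nat \<Rightarrow> nat"
  assumes n: "filterlim n sequentially sequentially" and u: "0 < u" "u < 1"
  shows "(\<lambda>k. real (idx (n k) u) / real (n k)) \<longlonglongrightarrow> u"
    and "(\<lambda>k. real (idx (n k) u - 1) / real (n k)) \<longlonglongrightarrow> u"
    and "(\<lambda>k. real (n k - idx (n k) u) / real (n k)) \<longlonglongrightarrow> 1 - u"
proof -
  have n1: "\<forall>\<^sub>F k in sequentially. 1 \<le> n k" using n by (auto simp: filterlim_at_top)
  have "(\<lambda>m. 1 / real m) \<longlonglongrightarrow> 0" by real_asymp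
  from filterlim_compose[OF this n] have z: "(\<lambda>k. 1 / real (n k)) \<longlonglongrightarrow> 0" .
  have b: "\<forall>\<^sub>F k in sequentially. u \<le> real (idx (n k) u) / real (n k) \<and> real (idx (n k) u) / real (n k) \<le> u + 1 / real (n k)"
    using n1
  proof eventually_elim
    case (elim k)
    then show ?case using idx_ge[of u "n k"] u by (simp add: field_simps)
  qed
  have "(\<lambda>k. u + 1 / real (n k)) \<longlonglongrightarrow> u + 0" by (intro tendsto_intros z)
  then have "(\<lambda>k. u + 1 / real (n k)) \<longlonglongrightarrow> u" by simp
  then show 1: "(\<lambda>k. real (idx (n k) u) / real (n k)) \<longlonglongrightarrow> u"
    by (rule tendsto_sandwich[rotated 3]) (use b in \<open>auto elim: eventually_mono\<close>)
  have "(\<lambda>k. real (idx (n k) u) / real (n k) - 1 / real (n k)) \<longlonglongrightarrow> u - 0" by (intro tendsto_intros 1 z)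
  then have "(\<lambda>k. real (idx (n k) u) / real (n k) - 1 / real (n k)) \<longlonglongrightarrow> u" by simp
  moreover have "real (idx (n k) u) / real (n k) - 1 / real (n k) = real (idx (n k) u - 1) / real (n k)" for k
    using idx_bounds(1)[of "n k" u] by (simp add: of_nat_diff diff_divide_distrib)
  ultimately show "(\<lambda>k. real (idx (n k) u - 1) / real (n k)) \<longlonglongrightarrow> u" by simp
  have e: "\<forall>\<^sub>F k in sequentially. 1 - real (idx (n k) u) / real (n k) = real (n k - idx (n k) u) / real (n k)"
    using n1
  proof eventually_elim
    case (elim k)
    then show ?case using idx_bounds(2)[of "n k" u] by (simp add: of_nat_diff diff_divide_distrib)
  qed
  have "(\<lambda>k. 1 - real (idx (n k) u) / real (n k)) \<longlonglongrightarrow> 1 - u" by (intro tendsto_intros 1)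
  from Lim_transform_eventually[OF this e]
  show "(\<lambda>k. real (n k - idx (n k) u) / real (n k)) \<longlonglongrightarrow> 1 - u" .
qed

text \<open>A split replaces sizes and ranks by those of a subproblem, so one canonical sequence per
  time would not be preserved. Quantifying over all sequences with ratio tending to \<open>t\<close>
  gives an invariant property. The bound \<open>B\<close>, common to all times, supplies the
  majorant in the next step.\<close>

definition approx :: "real set \<Rightarrow> real \<Rightarrow> (real \<Rightarrow> (bool list \<Rightarrow> real) \<Rightarrow> real) \<Rightarrow> bool" where
  "approx D K G \<longleftrightarrow> (\<forall>t\<in>D. G t \<in> borel_measurable Uspace)
     \<and> (\<exists>B\<ge>0. \<forall>t\<in>D. E2 Uspace (G t) \<le> ennreal B)
     \<and> (\<forall>t\<in>D. \<forall>n l. filterlim n sequentially sequentially \<longrightarrow> (\<forall>\<^sub>F k in sequentially. l k \<le> n k)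
           \<longrightarrow> (\<lambda>k. real (l k) / real (n k)) \<longlonglongrightarrow> t
           \<longrightarrow> limsup_le (\<lambda>k. E2 Uspace (\<lambda>x. Xnorm (n k) (l k) x - G t x)) K)"

lemma approx_zero: "approx D B0 (\<lambda>_ _. 0)"
  unfolding approx_def
proof (intro conjI ballI allI impI)
  fix t :: real and n l :: "nat \<Rightarrow> nat"
  assume ev: "\<forall>\<^sub>F k in sequentially. l k \<le> n k"
  show "limsup_le (\<lambda>k. E2 Uspace (\<lambda>x. Xnorm (n k) (l k) x - 0)) B0"
    unfolding limsup_le_def
  proof (intro conjI allI impI B0_nonneg)
    fix e :: real assume "0 < e"
    then have "ennreal B0 \<le> ennreal (B0 + e)" by (intro ennreal_leI) simp
    from ev show "\<forall>\<^sub>F k in sequentially. E2 Uspace (\<lambda>x. Xnorm (n k) (l k) x - 0) \<le> ennreal (B0 + e)"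
    proof eventually_elim
      case (elim k)
      from order_trans[OF Xnorm_E2[OF elim] \<open>ennreal B0 \<le> ennreal (B0 + e)\<close>] show ?case by simp
    qed
  qed
qed auto

text \<open>The limit recursion with \<open>G\<close> inserted once. If the time lies at or beyond
  the pivot, the left part is sorted completely; its contribution \<open>q\<close> is kept separate
  from \<open>G\<close> since it may be the exact limit while \<open>G\<close> is still an
  approximation.\<close>

definition stepf :: "real \<Rightarrow> real \<Rightarrow> (real \<Rightarrow> (bool list \<Rightarrow> real) \<Rightarrow> real) \<Rightarrow> ((bool list \<Rightarrow> real) \<Rightarrow> real)
     \<Rightarrow> (bool list \<Rightarrow> real) \<Rightarrow> (bool list \<Rightarrow> real) \<Rightarrow> real" where
  "stepf t u G q A B = Cfun2 t u + (if t < u then u * G (t / u) A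
     else u * q A + (1 - u) * G ((t - u) / (1 - u)) B)"

lemma E2_const: "E2 Uspace (\<lambda>_. c) = ennreal (c\<^sup>2)"
  by (simp only: nn_integral_const U.emeasure_space_1 mult_1_right)

lemma E2_contract:
  assumes "f \<in> borel_measurable M" "\<bar>c\<bar> \<le> 1" "E2 M f \<le> ennreal B"
  shows "E2 M (\<lambda>x. c * f x) \<le> ennreal B"
proof -
  have "E2 M (\<lambda>x. c * f x) = ennreal (c\<^sup>2) * E2 M f" by (rule E2_cmult[OF assms(1)])
  also have "\<dots> \<le> 1 * E2 M f"
    using assms(2) by (intro mult_right_mono) (auto simp: abs_square_le_1)
  also have "\<dots> \<le> ennreal B" using assms(3) by simp
  finally show ?thesis .
qed

lemma E2_add_bound:
  assumes "f \<in> borel_measurable M" "g \<in> borel_measurable M" "E2 M f \<le> ennreal a" "E2 M g \<le> ennreal b" "0 \<le> a" "0 \<le> b"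
  shows "E2 M (\<lambda>x. f x + g x) \<le> ennreal (2 * a + 2 * b)"
proof -
  have "E2 M (\<lambda>x. f x + g x) \<le> 2 * E2 M f + 2 * E2 M g" by (rule E2_add_le2[OF assms(1,2)])
  also have "\<dots> \<le> 2 * ennreal a + 2 * ennreal b" by (intro add_mono mult_left_mono assms) auto
  also have "\<dots> = ennreal (2 * a + 2 * b)" using assms by (simp add: ennreal_mult)
  finally show ?thesis .
qed

lemma E2_diff_bound:
  assumes "f \<in> borel_measurable M" "g \<in> borel_measurable M" "E2 M f \<le> ennreal a" "E2 M g \<le> ennreal b" "0 \<le> a" "0 \<le> b"
  shows "E2 M (\<lambda>x. f x - g x) \<le> ennreal (2 * a + 2 * b)"
  using E2_add_bound[of f M "\<lambda>x. - g x" a b] assms by simp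

text \<open>\<open>D1\<close> and \<open>D2\<close> ask that the set of times be closed under the
  rescalings in \<open>T1\<close> and \<open>T2\<close>. Two sets are used: \<open>{1}\<close>,
  where \<open>t < u\<close> never happens and \<open>(1 - u) / (1 - u) = 1\<close>, and the
  half-open unit interval. The exceptional root \<open>u = t\<close> is a null set.\<close>

lemma approx_step:
  assumes D: "D \<subseteq> {0<..1}"
    and D1: "\<And>t u. t \<in> D \<Longrightarrow> u < 1 \<Longrightarrow> t < u \<Longrightarrow> t / u \<in> D"
    and D2: "\<And>t u. t \<in> D \<Longrightarrow> 0 < u \<Longrightarrow> u < t \<Longrightarrow> u < 1 \<Longrightarrow> (t - u) / (1 - u) \<in> D"
    and G: "approx D K G"
    and q: "q \<in> borel_measurable Uspace" "E2 Uspace q \<le> ennreal Bq" "0 \<le> Bq" "(\<integral>U. q U \<partial>Uspace) = 0"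
    and ql: "limsup_le (\<lambda>n. E2 Uspace (\<lambda>x. Xnorm n n x - q x)) K"
    and F: "\<And>t. t \<in> D \<Longrightarrow> F t \<in> borel_measurable Uspace"
    and Fs: "\<And>t u A B. t \<in> D \<Longrightarrow> 0 < u \<Longrightarrow> u < 1 \<Longrightarrow> u \<noteq> t \<Longrightarrow> F t (glue u A B) = stepf t u G q A B"
  shows "approx D (2 / 3 * K) F"
proof -
  have Gm: "G t \<in> borel_measurable Uspace" if "t \<in> D" for t using G that by (auto simp: approx_def)
  from G obtain BG where BG: "0 \<le> BG" "\<And>t. t \<in> D \<Longrightarrow> E2 Uspace (G t) \<le> ennreal BG"
    by (auto simp: approx_def)
  have Gl: "limsup_le (\<lambda>k. E2 Uspace (\<lambda>x. Xnorm (n k) (l k) x - G t x)) K"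
    if "t \<in> D" "filterlim n sequentially sequentially" "\<forall>\<^sub>F k in sequentially. l k \<le> n k"
      "(\<lambda>k. real (l k) / real (n k)) \<longlonglongrightarrow> t" for t n l
    using G that by (auto simp: approx_def)
  have K: "0 \<le> K" using ql by (rule limsup_le_nonneg)
  \<comment> \<open>The mean squared error conditional on the root variable.\<close>
  define I where "I t n l u = (\<integral>\<^sup>+A. \<integral>\<^sup>+B. ennreal ((Xnorm n l (glue u A B) - F t (glue u A B))\<^sup>2) \<partial>Uspace \<partial>Uspace)" for t n l u
  have Im: "I t n l \<in> borel_measurable unif01" and EI: "E2 Uspace (\<lambda>x. Xnorm n l x - F t x) = (\<integral>\<^sup>+u. I t n l u \<partial>unif01)"
    if t: "t \<in> D" for t n l
  proof -
    have "(\<lambda>x. Xnorm n l x - F t x) \<in> borel_measurable Uspace"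
      by (intro borel_measurable_diff Xnorm_measurable F t)
    then have m: "(\<lambda>x. ennreal ((Xnorm n l x - F t x)\<^sup>2)) \<in> borel_measurable Uspace"
      by (rule measurable_compose) simp
    show "I t n l \<in> borel_measurable unif01" unfolding I_def[abs_def]
      by (rule measurable_nn_integral_glue[OF m])
    show "E2 Uspace (\<lambda>x. Xnorm n l x - F t x) = (\<integral>\<^sup>+u. I t n l u \<partial>unif01)"
      unfolding I_def by (rule nn_integral_Uspace[OF m])
  qed
  \<comment> \<open>A majorant for the reverse Fatou lemma. Only its finiteness matters, so triangle
    inequalities suffice here; \<open>428 = 415 + 13\<close> bounds the difference of the discrete
    toll and its limit.\<close>
  define Dm where "Dm = 2 * (2 * B0 + 2 * (BG + Bq)) + 2 * (2 * (2 * B0 + 2 * BG) + 2 * 428\<^sup>2)"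
  have Dm: "0 \<le> Dm" using BG q B0_nonneg by (simp add: Dm_def)
  have dom: "I t n l u \<le> ennreal Dm"
    if t: "t \<in> D" and u: "0 < u" "u < 1" "u \<noteq> t" and nl: "2 \<le> n" "1 \<le> l" "l \<le> n" for t n l u
  proof -
    define i where "i = idx n u"
    have i: "1 \<le> i" "i \<le> n" using idx_bounds[of n u] nl by (auto simp: i_def)
    define r where "r = real (i - 1) / real n"
    define r' where "r' = real (n - i) / real n"
    have r: "\<bar>r\<bar> \<le> 1" "\<bar>r'\<bar> \<le> 1" using i nl by (auto simp: r_def r'_def)
    define d where "d = toll n l i - Cfun2 t u"
    have t01: "0 < t" "t \<le> 1" using t D by auto
    have "\<bar>Cfun2 t u\<bar> \<le> 13" using t01 u by (intro Cfun2_bounds) auto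
    then have d: "\<bar>d\<bar> \<le> 428" using toll_bounded[OF nl i] by (simp add: d_def abs_le_iff)
    \<comment> \<open>\<open>X\<close> and \<open>Z\<close> are the limits used for the left and the
      right part; for \<open>t < u\<close> the right part does not contribute, hence the zero
      function.\<close>
    define X where "X = (if t < u then G (t / u) else q)"
    define Z where "Z = (if t < u then (\<lambda>_. 0) else G ((t - u) / (1 - u)))"
    have X: "X \<in> borel_measurable Uspace" "E2 Uspace X \<le> ennreal (BG + Bq)"
    proof -
      have "ennreal BG \<le> ennreal (BG + Bq)" "ennreal Bq \<le> ennreal (BG + Bq)"
        using BG q by (auto intro!: ennreal_leI)
      then show "X \<in> borel_measurable Uspace" "E2 Uspace X \<le> ennreal (BG + Bq)"
        using Gm[OF D1[OF t]] BG(2)[OF D1[OF t]] q u unfolding X_def by (auto intro: order_trans)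
    qed
    have Z: "Z \<in> borel_measurable Uspace" "E2 Uspace Z \<le> ennreal BG"
      using Gm[OF D2[OF t]] BG(2)[OF D2[OF t]] u unfolding Z_def by auto
    define f where "f A = r * Xnorm (i - 1) (min l (i - 1)) A - u * X A" for A
    define g where "g B = (r' * Xnorm (n - i) (l - i) B - (1 - u) * Z B) + d" for B
    have fm: "f \<in> borel_measurable Uspace" unfolding f_def[abs_def]
      by (intro borel_measurable_diff borel_measurable_times borel_measurable_const Xnorm_measurable X)
    have gm': "(\<lambda>B. r' * Xnorm (n - i) (l - i) B - (1 - u) * Z B) \<in> borel_measurable Uspace"
      by (intro borel_measurable_diff borel_measurable_times borel_measurable_const Xnorm_measurable Z)
    then have gm: "g \<in> borel_measurable Uspace" unfolding g_def[abs_def]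
      by (intro borel_measurable_add borel_measurable_const)
    have fE: "E2 Uspace f \<le> ennreal (2 * B0 + 2 * (BG + Bq))" unfolding f_def
      by (intro E2_diff_bound E2_contract borel_measurable_times borel_measurable_const Xnorm_measurable X Xnorm_E2)
        (use r u BG q B0_nonneg in auto)
    have gE: "E2 Uspace g \<le> ennreal (2 * (2 * B0 + 2 * BG) + 2 * 428\<^sup>2)" unfolding g_def
    proof (rule E2_add_bound[OF gm'])
      show "E2 Uspace (\<lambda>B. r' * Xnorm (n - i) (l - i) B - (1 - u) * Z B) \<le> ennreal (2 * B0 + 2 * BG)"
        by (intro E2_diff_bound E2_contract borel_measurable_times borel_measurable_const Xnorm_measurable Z Xnorm_E2)
          (use r u BG q B0_nonneg nl i in auto)
      show "E2 Uspace (\<lambda>_. d) \<le> ennreal (428\<^sup>2)"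
        unfolding E2_const using d by (intro ennreal_leI power2_le_of_abs)
    qed (use BG B0_nonneg in auto)
    have "Xnorm n l (glue u A B) - F t (glue u A B) = f A + g B" for A B
      unfolding Xnorm_glue[OF nl] Fs[OF t u] i_def[symmetric] stepf_def f_def g_def X_def Z_def d_def r_def r'_def
      by simp
    then have "I t n l u = (\<integral>\<^sup>+A. \<integral>\<^sup>+B. ennreal ((f A + g B)\<^sup>2) \<partial>Uspace \<partial>Uspace)" by (simp only: I_def)
    also have "\<dots> \<le> (\<integral>\<^sup>+A. \<integral>\<^sup>+B. 2 * ennreal ((f A)\<^sup>2) + 2 * ennreal ((g B)\<^sup>2) \<partial>Uspace \<partial>Uspace)"
    proof (intro nn_integral_mono)
      fix A B
      have "ennreal ((f A + g B)\<^sup>2) \<le> ennreal (2 * (f A)\<^sup>2 + 2 * (g B)\<^sup>2)"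
        using power2_add_le[of 1 "f A" "g B"] by (intro ennreal_leI) simp
      then show "ennreal ((f A + g B)\<^sup>2) \<le> 2 * ennreal ((f A)\<^sup>2) + 2 * ennreal ((g B)\<^sup>2)"
        by (simp add: ennreal_mult)
    qed
    also have "\<dots> = 2 * E2 Uspace f + 2 * E2 Uspace g"
    proof -
      have f2: "(\<lambda>x. 2 * ennreal ((f x)\<^sup>2)) \<in> borel_measurable Uspace"
        by (rule measurable_compose[OF fm]) simp
      have g2: "(\<lambda>x. 2 * ennreal ((g x)\<^sup>2)) \<in> borel_measurable Uspace"
        by (rule measurable_compose[OF gm]) simp
      have f2': "(\<lambda>x. ennreal ((f x)\<^sup>2)) \<in> borel_measurable Uspace"
        by (rule measurable_compose[OF fm]) simp
      have g2': "(\<lambda>x. ennreal ((g x)\<^sup>2)) \<in> borel_measurable Uspace"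
        by (rule measurable_compose[OF gm]) simp
      have "(\<integral>\<^sup>+A. \<integral>\<^sup>+B. 2 * ennreal ((f A)\<^sup>2) + 2 * ennreal ((g B)\<^sup>2) \<partial>Uspace \<partial>Uspace)
         = (\<integral>\<^sup>+A. 2 * ennreal ((f A)\<^sup>2) + (\<integral>\<^sup>+B. 2 * ennreal ((g B)\<^sup>2) \<partial>Uspace) \<partial>Uspace)"
        by (simp only: nn_integral_add[OF borel_measurable_const g2] nn_integral_const U.emeasure_space_1 mult_1_right)
      also have "\<dots> = (\<integral>\<^sup>+A. 2 * ennreal ((f A)\<^sup>2) \<partial>Uspace) + (\<integral>\<^sup>+B. 2 * ennreal ((g B)\<^sup>2) \<partial>Uspace)"
        by (simp only: nn_integral_add[OF f2 borel_measurable_const] nn_integral_const U.emeasure_space_1 mult_1_right)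
      finally show ?thesis by (simp only: nn_integral_cmult[OF f2'] nn_integral_cmult[OF g2'])
    qed
    also have "\<dots> \<le> 2 * ennreal (2 * B0 + 2 * (BG + Bq)) + 2 * ennreal (2 * (2 * B0 + 2 * BG) + 2 * 428\<^sup>2)"
      by (intro add_mono mult_left_mono fE gE) auto
    also have "\<dots> = ennreal Dm"
    proof -
      have "2 * ennreal x + 2 * ennreal y = ennreal (2 * x + 2 * y)" if "0 \<le> x" "0 \<le> y" for x y
        using that by (simp add: ennreal_mult)
      then show ?thesis unfolding Dm_def using BG q B0_nonneg by (auto simp del: ennreal_plus)
    qed
    finally show ?thesis .
  qed
  have inner_lim: "limsup_le (\<lambda>k. I t (n k) (l k) u) (K * (u\<^sup>2 + (1 - u)\<^sup>2))"
    if t: "t \<in> D" and u: "0 < u" "u < 1" "u \<noteq> t" and n: "filterlim n sequentially sequentially"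
      and nl: "\<And>k. 2 \<le> n k \<and> 1 \<le> l k \<and> l k \<le> n k" and lt: "(\<lambda>k. real (l k) / real (n k)) \<longlonglongrightarrow> t" for t n l u
  proof -
    have t01: "0 < t" "t \<le> 1" using t D by auto
    define i where "i k = idx (n k) u" for k
    have i: "1 \<le> i k" "i k \<le> n k" for k using idx_bounds[of "n k" u] nl[of k] by (auto simp: i_def)
    note il = idx_limits[OF n u(1,2), folded i_def]
    have a: "filterlim (\<lambda>k. i k - 1) sequentially sequentially" by (rule filterlim_ratio[OF n il(2) u(1)])
    have b: "filterlim (\<lambda>k. n k - i k) sequentially sequentially" by (rule filterlim_ratio[OF n il(3)]) (use u in simp)
    define d where "d k = toll (n k) (l k) (i k) - Cfun2 t u" for k
    have "(\<lambda>k. toll (n k) (l k) (i k)) \<longlonglongrightarrow> Cfun2 t u"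
      using nl i t01 u by (intro toll_tendsto n lt il(1)) (auto intro: always_eventually)
    then have d: "d \<longlonglongrightarrow> 0" unfolding d_def[abs_def] by (rule LIM_zero)
    have n0: "real (n k) \<noteq> 0" for k using nl[of k] by simp
    have div_cancel: "(x / z) / (y / z) = x / y" if "z \<noteq> 0" for x y z :: real using that by simp
    show ?thesis
    proof (cases "t < u")
      case True
      obtain m where m: "t < m" "m < u" using dense[OF True] by blast
      have ev: "\<forall>\<^sub>F k in sequentially. l k < i k"
        using order_tendstoD(2)[OF lt m(1)] order_tendstoD(1)[OF il(1) m(2)]
      proof eventually_elim
        case (elim k)
        then have "real (l k) / real (n k) < real (i k) / real (n k)" by linarith
        then show ?case by (auto simp: divide_less_cancel)
      qed
      have tu: "t / u \<in> D" by (rule D1[OF t u(2) True])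
      have L: "limsup_le (\<lambda>k. E2 Uspace (\<lambda>x. Xnorm (i k - 1) (min (l k) (i k - 1)) x - G (t / u) x)) K"
      proof (rule Gl[OF tu a])
        \<comment> \<open>The rank relative to the left part is the quotient of the two ratios over
          \<open>n k\<close>, so it tends to the time rescaled as in \<open>T1\<close>. The other
          case recovers the rescaling of \<open>T2\<close> in the same way.\<close>
        have "(\<lambda>k. (real (l k) / real (n k)) / (real (i k - 1) / real (n k))) \<longlonglongrightarrow> t / u"
          by (intro tendsto_divide lt il(2)) (use u in simp)
        moreover have "\<forall>\<^sub>F k in sequentially. (real (l k) / real (n k)) / (real (i k - 1) / real (n k))
            = real (min (l k) (i k - 1)) / real (i k - 1)"
          using ev
        proof eventually_elim
          case (elim k)
          then have "min (l k) (i k - 1) = l k" by simp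
          then show ?case by (simp only: div_cancel[OF n0])
        qed
        ultimately show "(\<lambda>k. real (min (l k) (i k - 1)) / real (i k - 1)) \<longlonglongrightarrow> t / u"
          by (rule Lim_transform_eventually)
      qed simp
      have "limsup_le (\<lambda>k. E2 Uspace (\<lambda>x. real (i k - 1) / real (n k) * Xnorm (i k - 1) (min (l k) (i k - 1)) x
          - u * G (t / u) x + d k)) (u\<^sup>2 * K)"
        by (rule limsup_le_perturb[OF U.prob_space_axioms Xnorm_measurable Xnorm_E2 B0_nonneg Gm[OF tu] L il(2) d]) simp
      then have "limsup_le (\<lambda>k. I t (n k) (l k) u) (u\<^sup>2 * K)"
      proof (rule limsup_le_mono')
        show "\<forall>\<^sub>F k in sequentially. I t (n k) (l k) u \<le> E2 Uspace (\<lambda>x. real (i k - 1) / real (n k) *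
            Xnorm (i k - 1) (min (l k) (i k - 1)) x - u * G (t / u) x + d k)"
          using ev
        proof eventually_elim
          case (elim k)
          have nlk: "2 \<le> n k" "1 \<le> l k" "l k \<le> n k" using nl[of k] by auto
          \<comment> \<open>Eventually \<open>l k < i k\<close>, so the right part is asked for rank
            \<open>0\<close> and contributes nothing.\<close>
          have V0: "Xnorm (n k - i k) (l k - i k) B = 0" for B
            unfolding Xnorm_def using elim by (simp add: Xcent_trivial)
          have "Xnorm (n k) (l k) (glue u A B) - F t (glue u A B) = real (i k - 1) / real (n k) *
            Xnorm (i k - 1) (min (l k) (i k - 1)) A - u * G (t / u) A + d k" for A B
            unfolding Xnorm_glue[OF nlk] Fs[OF t u] i_def[symmetric] stepf_def d_def V0 using True by simp
          then show ?case by (simp only: I_def nn_integral_const U.emeasure_space_1 mult_1_right order_refl)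
        qed
      qed
      then show ?thesis
        by (rule limsup_le_mono) (use K in \<open>simp add: mult.commute mult_left_mono\<close>)
    next
      case False
      then have ut: "u < t" using u by simp
      obtain m where m: "u < m" "m < t" using dense[OF ut] by blast
      have ev: "\<forall>\<^sub>F k in sequentially. i k < l k"
        using order_tendstoD(1)[OF lt m(2)] order_tendstoD(2)[OF il(1) m(1)]
      proof eventually_elim
        case (elim k)
        then have "real (i k) / real (n k) < real (l k) / real (n k)" by linarith
        then show ?case by (auto simp: divide_less_cancel)
      qed
      define t' where "t' = (t - u) / (1 - u)"
      have tu: "t' \<in> D" unfolding t'_def by (rule D2[OF t u(1) ut u(2)])
      have L: "limsup_le (\<lambda>k. E2 Uspace (\<lambda>x. Xnorm (n k - i k) (l k - i k) x - G t' x)) K"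
      proof (rule Gl[OF tu b])
        have "(\<lambda>k. (real (l k) / real (n k) - real (i k) / real (n k)) / (real (n k - i k) / real (n k))) \<longlonglongrightarrow> t'"
          unfolding t'_def by (intro tendsto_divide tendsto_diff lt il) (use u in simp)
        moreover have "\<forall>\<^sub>F k in sequentially. (real (l k) / real (n k) - real (i k) / real (n k)) / (real (n k - i k) / real (n k))
            = real (l k - i k) / real (n k - i k)"
          using ev
        proof eventually_elim
          case (elim k)
          then have "real (l k) / real (n k) - real (i k) / real (n k) = real (l k - i k) / real (n k)"
            by (simp add: of_nat_diff diff_divide_distrib)
          then show ?case by (simp only: div_cancel[OF n0])
        qed
        ultimately show "(\<lambda>k. real (l k - i k) / real (n k - i k)) \<longlonglongrightarrow> t'"
          by (rule Lim_transform_eventually)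
        show "\<forall>\<^sub>F k in sequentially. l k - i k \<le> n k - i k" using nl by (intro always_eventually allI diff_le_mono) blast
      qed
      \<comment> \<open>The left part is complete, rank equals size, and \<open>ql\<close> applies
        along the sizes \<open>i k - 1\<close>, which tend to infinity. The toll error
        \<open>d k\<close> is assigned to the right part, so that the left error stays
        centred.\<close>
      have L1: "limsup_le (\<lambda>k. E2 Uspace (\<lambda>x. real (i k - 1) / real (n k) * Xnorm (i k - 1) (i k - 1) x - u * q x + 0)) (u\<^sup>2 * K)"
        by (rule limsup_le_perturb[OF U.prob_space_axioms Xnorm_measurable Xnorm_E2 B0_nonneg q(1) limsup_le_compose[OF ql a] il(2) tendsto_const]) simp
      have L2: "limsup_le (\<lambda>k. E2 Uspace (\<lambda>x. real (n k - i k) / real (n k) * Xnorm (n k - i k) (l k - i k) x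
          - (1 - u) * G t' x + d k)) ((1 - u)\<^sup>2 * K)"
        by (rule limsup_le_perturb[OF U.prob_space_axioms Xnorm_measurable Xnorm_E2 B0_nonneg Gm[OF tu] L il(3) d])
          (rule diff_le_mono, use nl in blast)
      have "limsup_le (\<lambda>k. I t (n k) (l k) u) (u\<^sup>2 * K + (1 - u)\<^sup>2 * K)"
      proof (rule limsup_le_mono'[OF limsup_le_add[OF L1 L2]])
        show "\<forall>\<^sub>F k in sequentially. I t (n k) (l k) u \<le>
           E2 Uspace (\<lambda>x. real (i k - 1) / real (n k) * Xnorm (i k - 1) (i k - 1) x - u * q x + 0) +
           E2 Uspace (\<lambda>x. real (n k - i k) / real (n k) * Xnorm (n k - i k) (l k - i k) x - (1 - u) * G t' x + d k)"
          using ev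
        proof eventually_elim
          case (elim k)
          have nlk: "2 \<le> n k" "1 \<le> l k" "l k \<le> n k" using nl[of k] by auto
          define r where "r = real (i k - 1) / real (n k)"
          define r' where "r' = real (n k - i k) / real (n k)"
          have r: "\<bar>r\<bar> \<le> 1" "\<bar>r'\<bar> \<le> 1" using i[of k] nlk by (auto simp: r_def r'_def)
          let ?f = "\<lambda>x. r * Xnorm (i k - 1) (i k - 1) x - u * q x + 0"
          let ?g = "\<lambda>x. r' * Xnorm (n k - i k) (l k - i k) x - (1 - u) * G t' x + d k"
          have mn: "min (l k) (i k - 1) = i k - 1" using elim by simp
          have eq: "Xnorm (n k) (l k) (glue u A B) - F t (glue u A B) = ?f A + ?g B" for A B
            unfolding Xnorm_glue[OF nlk] Fs[OF t u] i_def[symmetric] stepf_def d_def mn r_def r'_def t'_def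
            using False by simp
          have fm: "?f \<in> borel_measurable Uspace"
            by (intro borel_measurable_add borel_measurable_diff borel_measurable_times borel_measurable_const Xnorm_measurable q)
          have gm': "(\<lambda>x. r' * Xnorm (n k - i k) (l k - i k) x - (1 - u) * G t' x) \<in> borel_measurable Uspace"
            by (intro borel_measurable_diff borel_measurable_times borel_measurable_const Xnorm_measurable Gm tu)
          then have gm: "?g \<in> borel_measurable Uspace"
            by (intro borel_measurable_add borel_measurable_const)
          have fE: "E2 Uspace (\<lambda>x. r * Xnorm (i k - 1) (i k - 1) x - u * q x) \<le> ennreal (2 * B0 + 2 * Bq)"
            by (intro E2_diff_bound E2_contract borel_measurable_times borel_measurable_const Xnorm_measurable q Xnorm_E2)
              (use r u q B0_nonneg in auto)
          then have fE': "E2 Uspace ?f \<le> ennreal (2 * B0 + 2 * Bq)" by (simp only: add_0_right)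
          have g1: "E2 Uspace (\<lambda>x. r' * Xnorm (n k - i k) (l k - i k) x - (1 - u) * G t' x) \<le> ennreal (2 * B0 + 2 * BG)"
            by (intro E2_diff_bound E2_contract borel_measurable_times borel_measurable_const Xnorm_measurable Gm BG(2) tu Xnorm_E2)
              (use r u BG B0_nonneg nlk in \<open>auto simp: diff_le_mono\<close>)
          have gE: "E2 Uspace ?g \<le> ennreal (2 * (2 * B0 + 2 * BG) + 2 * (d k)\<^sup>2)"
            by (rule E2_add_bound[OF gm' borel_measurable_const g1]) (use E2_const BG B0_nonneg in auto)
          have f0: "(\<integral>x. ?f x \<partial>Uspace) = 0"
          proof -
            have "integrable Uspace (Xnorm (i k - 1) (i k - 1))" "integrable Uspace q"
              using U.E2_integrable'[OF Xnorm_measurable Xnorm_E2[OF order_refl]] U.E2_integrable'[OF q(1,2)] by auto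
            then show ?thesis using Xnorm_mean[of "i k - 1" "i k - 1"] q(4) by simp
          qed
          \<comment> \<open>Exact additivity instead of a triangle inequality: factors
            \<open>2\<close> would turn \<open>2 / 3\<close> into \<open>4 / 3\<close>.\<close>
          have "I t (n k) (l k) u = E2 Uspace ?f + E2 Uspace ?g"
            unfolding I_def eq by (rule UxU.E2_indep_sum[OF fm fE' f0 gm gE])
          then show ?case unfolding r_def r'_def by (rule eq_refl)
        qed
      qed
      then show ?thesis by (simp add: algebra_simps)
    qed
  qed
  have lim: "limsup_le (\<lambda>k. E2 Uspace (\<lambda>x. Xnorm (n k) (l k) x - F t x)) (2 / 3 * K)"
    if t: "t \<in> D" and n: "filterlim n sequentially sequentially"
      and ln: "\<forall>\<^sub>F k in sequentially. l k \<le> n k" and lt: "(\<lambda>k. real (l k) / real (n k)) \<longlonglongrightarrow> t" for t n l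
  proof -
    have t01: "0 < t" using t D by auto
    have "\<forall>\<^sub>F k in sequentially. 2 \<le> n k" using n by (auto simp: filterlim_at_top)
    then have "\<forall>\<^sub>F k in sequentially. 2 \<le> n k \<and> 1 \<le> l k \<and> l k \<le> n k"
      using ln order_tendstoD(1)[OF lt t01]
    proof eventually_elim
      case (elim k)
      then show ?case by (cases "l k") auto
    qed
    \<comment> \<open>The majorant requires the side conditions for every index, whereas they hold
      only eventually (rank at least \<open>1\<close> because \<open>t > 0\<close>). Shifting the
      sequences repairs this and leaves \<open>limsup\<close> unchanged.\<close>
    then obtain N where "\<forall>k\<ge>N. 2 \<le> n k \<and> 1 \<le> l k \<and> l k \<le> n k"
      unfolding eventually_sequentially by blast
    then have N: "2 \<le> n (k + N) \<and> 1 \<le> l (k + N) \<and> l (k + N) \<le> n (k + N)" for k by simp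
    have n': "filterlim (\<lambda>k. n (k + N)) sequentially sequentially"
      by (rule filterlim_compose[OF n]) (rule filterlim_add_const_nat_at_top)
    have lt': "(\<lambda>k. real (l (k + N)) / real (n (k + N))) \<longlonglongrightarrow> t"
      using LIMSEQ_ignore_initial_segment[OF lt, of N] .
    have "limsup (\<lambda>k. E2 Uspace (\<lambda>x. Xnorm (n k) (l k) x - F t x))
       = limsup (\<lambda>k. E2 Uspace (\<lambda>x. Xnorm (n (k + N)) (l (k + N)) x - F t x))"
      by (rule limsup_shift_k[symmetric])
    also have "\<dots> = limsup (\<lambda>k. \<integral>\<^sup>+u. I t (n (k + N)) (l (k + N)) u \<partial>unif01)"
      by (simp only: EI[OF t])
    also have "\<dots> \<le> (\<integral>\<^sup>+u. limsup (\<lambda>k. I t (n (k + N)) (l (k + N)) u) \<partial>unif01)"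
    proof (rule nn_integral_limsup)
      show "AE u in unif01. I t (n (k + N)) (l (k + N)) u \<le> ennreal Dm" for k
        using N[of k] by (intro AE_unif01[of t] dom t) auto
      show "(\<integral>\<^sup>+u. ennreal Dm \<partial>unif01) < \<infinity>"
        by (simp only: nn_integral_const unif01.emeasure_space_1 mult_1_right) simp
      show "I t (n (k + N)) (l (k + N)) \<in> borel_measurable unif01" for k by (rule Im[OF t])
    qed (rule borel_measurable_const)
    also have "\<dots> \<le> (\<integral>\<^sup>+u. ennreal (0 + K * (u\<^sup>2 + (1 - u)\<^sup>2)) \<partial>unif01)"
    proof (intro nn_integral_mono_AE AE_unif01[of t])
      fix u assume u: "0 < u" "u < 1" "u \<noteq> t"
      show "limsup (\<lambda>k. I t (n (k + N)) (l (k + N)) u) \<le> ennreal (0 + K * (u\<^sup>2 + (1 - u)\<^sup>2))"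
        using inner_lim[OF t u n' N lt'] by (simp add: limsup_le_iff)
    qed
    also have "\<dots> = ennreal (0 + 2 / 3 * K)" by (rule nn_integral_unif01_quadratic) (use K in auto)
    finally show ?thesis using K by (simp add: limsup_le_iff)
  qed
  \<comment> \<open>The majorant holds for any admissible size and rank, however far their ratio is
    from \<open>t\<close>. Comparing \<open>F t\<close> with the single variable
    \<open>Xnorm 2 1\<close> therefore bounds its second moment uniformly in
    \<open>t\<close>.\<close>
  have bound: "E2 Uspace (F t) \<le> ennreal (2 * B0 + 2 * Dm)" if t: "t \<in> D" for t
  proof -
    have m: "(\<lambda>x. Xnorm 2 1 x - F t x) \<in> borel_measurable Uspace"
      by (intro borel_measurable_diff Xnorm_measurable F t)
    have "E2 Uspace (\<lambda>x. Xnorm 2 1 x - F t x) \<le> (\<integral>\<^sup>+u. ennreal Dm \<partial>unif01)"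
      unfolding EI[OF t] by (intro nn_integral_mono_AE AE_unif01[of t] dom t) auto
    also have "\<dots> = ennreal Dm" by (simp only: nn_integral_const unif01.emeasure_space_1 mult_1_right)
    finally have "E2 Uspace (\<lambda>x. Xnorm 2 1 x - (Xnorm 2 1 x - F t x)) \<le> ennreal (2 * B0 + 2 * Dm)"
      by (intro E2_diff_bound Xnorm_measurable m Xnorm_E2 B0_nonneg Dm) simp_all
    then show ?thesis by simp
  qed
  show ?thesis unfolding approx_def
    using F bound lim B0_nonneg Dm by (auto intro!: exI[of _ "2 * B0 + 2 * Dm"])
qed

section \<open>Geometric approximation in the second mean\<close>

lemma limsup_le_null: "(\<And>e. 0 < e \<Longrightarrow> \<forall>\<^sub>F k in sequentially. s k \<le> ennreal e) \<Longrightarrow> limsup_le s 0"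
  by (simp add: limsup_le_def)

text \<open>If random variables \<open>V n\<close> are approximated in the second mean by \<open>Z m\<close> with geometrically
  decreasing asymptotic error, then the \<open>Z m\<close> are automatically almost surely convergent.\<close>

context prob_space
begin

context
  fixes V Z :: "nat \<Rightarrow> 'a \<Rightarrow> real" and c :: real
  assumes V: "\<And>n. V n \<in> borel_measurable M" and Z: "\<And>m. Z m \<in> borel_measurable M" and c: "0 \<le> c"
    and lim: "\<And>m. limsup_le (\<lambda>n. E2 M (\<lambda>x. V n x - Z m x)) (c * (2 / 3) ^ m)"
begin

text \<open>The triangle inequality through \<open>V n\<close> for one large \<open>n\<close>; the
  \<open>V n\<close> then drop out, so the \<open>Z m\<close> form a Cauchy sequence in the second
  mean.\<close>

lemma E2_geometric_diff: "E2 M (\<lambda>x. Z m x - Z k x) \<le> ennreal (2 * (c * (2 / 3) ^ m) + 2 * (c * (2 / 3) ^ k))"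
proof (rule ennreal_le_epsilon)
  fix e :: real assume e: "0 < e"
  then have e4: "0 < e / 4" by simp
  have "\<forall>\<^sub>F n in sequentially. E2 M (\<lambda>x. Z m x - Z k x)
     \<le> ennreal (2 * (c * (2 / 3) ^ k + e / 4) + 2 * (c * (2 / 3) ^ m + e / 4))"
    using limsup_leD[OF lim e4, of m] limsup_leD[OF lim e4, of k]
  proof eventually_elim
    case (elim n)
    have "E2 M (\<lambda>x. (V n x - Z k x) - (V n x - Z m x))
       \<le> ennreal (2 * (c * (2 / 3) ^ k + e / 4) + 2 * (c * (2 / 3) ^ m + e / 4))"
      using c e by (intro E2_diff_bound borel_measurable_diff V Z elim) simp_all
    then show ?case by simp
  qed
  then obtain n :: nat where "E2 M (\<lambda>x. Z m x - Z k x)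
     \<le> ennreal (2 * (c * (2 / 3) ^ k + e / 4) + 2 * (c * (2 / 3) ^ m + e / 4))"
    using eventually_happens' sequentially_bot by blast
  also have "2 * (c * (2 / 3) ^ k + e / 4) + 2 * (c * (2 / 3) ^ m + e / 4)
    = (2 * (c * (2 / 3) ^ m) + 2 * (c * (2 / 3) ^ k)) + e" by (simp add: algebra_simps)
  also have "ennreal \<dots> = ennreal (2 * (c * (2 / 3) ^ m) + 2 * (c * (2 / 3) ^ k)) + ennreal e"
    using c e by (intro ennreal_plus) auto
  finally show "E2 M (\<lambda>x. Z m x - Z k x) \<le> ennreal (2 * (c * (2 / 3) ^ m) + 2 * (c * (2 / 3) ^ k)) + ennreal e" .
qed

text \<open>The expected absolute increments are summable, hence the increments are almost surely
  absolutely summable.\<close>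

lemma AE_convergent_geometric: "AE x in M. convergent (\<lambda>m. Z m x)"
proof -
  \<comment> \<open>First moments come from \<open>\<bar>x\<bar> \<le> s + x^2 / s\<close> with
    \<open>s = (9 / 10)^m\<close>: any base strictly between \<open>2 / 3\<close> and
    \<open>1\<close> makes both terms geometric, here with ratios \<open>9 / 10\<close> and
    \<open>(2 / 3) / (9 / 10) = 20 / 27\<close>.\<close>
  define b where "b m = (9 / 10) ^ m + 4 * c * (20 / 27) ^ m" for m :: nat
  have b0: "0 \<le> b m" for m using c by (simp add: b_def)
  have bs: "summable b" unfolding b_def
    by (intro summable_add summable_mult summable_geometric) simp_all
  have zm: "(\<lambda>x. Z (Suc m) x - Z m x) \<in> borel_measurable M" for m by (intro borel_measurable_diff Z)
  have zm': "(\<lambda>x. ennreal \<bar>Z (Suc m) x - Z m x\<bar>) \<in> borel_measurable M" for m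
    by (rule measurable_compose[OF zm]) simp
  have le: "(\<integral>\<^sup>+x. ennreal \<bar>Z (Suc m) x - Z m x\<bar> \<partial>M) \<le> ennreal (b m)" for m
  proof -
    define s :: real where "s = (9 / 10) ^ m"
    have s: "0 < s" by (simp add: s_def)
    have am: "\<bar>x\<bar> \<le> s + (1 / s) * x\<^sup>2" for x :: real
    proof -
      have "0 \<le> (s - \<bar>x\<bar>)\<^sup>2" by simp
      also have "\<dots> = s\<^sup>2 - 2 * s * \<bar>x\<bar> + x\<^sup>2" by (simp add: power2_diff)
      finally have "2 * \<bar>x\<bar> * s \<le> s\<^sup>2 + x\<^sup>2" by (simp add: mult_ac)
      then have "2 * \<bar>x\<bar> \<le> (s\<^sup>2 + x\<^sup>2) / s" using s by (simp only: pos_le_divide_eq)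
      also have "\<dots> = s + (1 / s) * x\<^sup>2" using s by (simp add: add_divide_distrib power2_eq_square)
      finally have "2 * \<bar>x\<bar> \<le> s + (1 / s) * x\<^sup>2" .
      then show ?thesis by simp
    qed
    have sq: "(\<lambda>x. ennreal ((Z (Suc m) x - Z m x)\<^sup>2)) \<in> borel_measurable M"
      by (rule measurable_compose[OF zm]) simp
    have sq': "(\<lambda>x. ennreal (1 / s) * ennreal ((Z (Suc m) x - Z m x)\<^sup>2)) \<in> borel_measurable M"
      by (rule measurable_compose[OF zm]) simp
    have "(\<integral>\<^sup>+x. ennreal \<bar>Z (Suc m) x - Z m x\<bar> \<partial>M)
       \<le> (\<integral>\<^sup>+x. ennreal s + ennreal (1 / s) * ennreal ((Z (Suc m) x - Z m x)\<^sup>2) \<partial>M)"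
    proof (intro nn_integral_mono)
      fix x
      have "ennreal \<bar>Z (Suc m) x - Z m x\<bar> \<le> ennreal (s + (1 / s) * (Z (Suc m) x - Z m x)\<^sup>2)"
        by (intro ennreal_leI am)
      also have "\<dots> = ennreal s + ennreal (1 / s) * ennreal ((Z (Suc m) x - Z m x)\<^sup>2)"
        using s by (subst ennreal_plus, simp, simp, subst ennreal_mult) simp_all
      finally show "ennreal \<bar>Z (Suc m) x - Z m x\<bar> \<le> ennreal s + ennreal (1 / s) * ennreal ((Z (Suc m) x - Z m x)\<^sup>2)" .
    qed
    also have "\<dots> = ennreal s + ennreal (1 / s) * E2 M (\<lambda>x. Z (Suc m) x - Z m x)"
      by (simp only: nn_integral_add[OF borel_measurable_const sq'] nn_integral_cmult[OF sq] nn_integral_const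
          emeasure_space_1 mult_1_right)
    also have "\<dots> \<le> ennreal s + ennreal (1 / s) * ennreal (2 * (c * (2 / 3) ^ Suc m) + 2 * (c * (2 / 3) ^ m))"
      by (intro add_mono mult_left_mono E2_geometric_diff) auto
    also have "\<dots> = ennreal (s + (1 / s) * (2 * (c * (2 / 3) ^ Suc m) + 2 * (c * (2 / 3) ^ m)))"
      using s c by (subst ennreal_mult[symmetric], simp, simp, subst ennreal_plus[symmetric]) auto
    also have "\<dots> \<le> ennreal (b m)"
    proof (rule ennreal_leI)
      have "(20 / 27 :: real) ^ m = (2 / 3) ^ m / (9 / 10) ^ m" by (simp flip: power_divide)
      then have "(1 / s) * (2 / 3) ^ m = (20 / 27) ^ m" by (simp add: s_def)
      moreover have "(1 / s) * (2 * (c * (2 / 3) ^ Suc m) + 2 * (c * (2 / 3) ^ m))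
        = (10 / 3) * c * ((1 / s) * (2 / 3) ^ m)" by (simp add: algebra_simps)
      moreover have "(10 / 3) * c * (20 / 27) ^ m \<le> 4 * c * (20 / 27) ^ m"
        using c by (intro mult_right_mono) auto
      ultimately show "s + (1 / s) * (2 * (c * (2 / 3) ^ Suc m) + 2 * (c * (2 / 3) ^ m)) \<le> b m"
        by (simp add: b_def s_def)
    qed
    finally show ?thesis .
  qed
  have "(\<integral>\<^sup>+x. (\<Sum>m. ennreal \<bar>Z (Suc m) x - Z m x\<bar>) \<partial>M) = (\<Sum>m. \<integral>\<^sup>+x. ennreal \<bar>Z (Suc m) x - Z m x\<bar> \<partial>M)"
    by (rule nn_integral_suminf[OF zm'])
  also have "\<dots> \<le> (\<Sum>m. ennreal (b m))" by (intro suminf_le le) auto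
  finally have "(\<integral>\<^sup>+x. (\<Sum>m. ennreal \<bar>Z (Suc m) x - Z m x\<bar>) \<partial>M) \<noteq> \<infinity>"
    using ennreal_suminf_neq_top[OF bs b0] by (auto simp: top_unique)
  then have "AE x in M. (\<Sum>m. ennreal \<bar>Z (Suc m) x - Z m x\<bar>) \<noteq> \<infinity>"
    by (rule nn_integral_PInf_AE[rotated]) (intro borel_measurable_suminf_order zm')
  then show ?thesis
  proof eventually_elim
    case (elim x)
    then have "summable (\<lambda>m. \<bar>Z (Suc m) x - Z m x\<bar>)"
      by (intro summable_suminf_not_top) auto
    then have "summable (\<lambda>m. Z (Suc m) x - Z m x)" by (rule summable_rabs_cancel)
    then have "convergent (\<lambda>n. \<Sum>m<n. Z (Suc m) x - Z m x)" by (simp add: summable_iff_convergent)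
    moreover have "(\<Sum>m<n. Z (Suc m) x - Z m x) = Z n x - Z 0 x" for n
      by (rule sum_lessThan_telescope[of "\<lambda>m. Z m x"])
    ultimately have "convergent (\<lambda>n. Z n x - Z 0 x)" by (simp only:)
    then have "convergent (\<lambda>n. (Z n x - Z 0 x) + Z 0 x)" by (intro convergent_add convergent_const)
    then show ?case by simp
  qed
qed

lemma lim_geometric_measurable: "(\<lambda>x. lim (\<lambda>m. Z m x)) \<in> borel_measurable M"
  by (rule borel_measurable_lim_metric[OF Z])

text \<open>Fatou's lemma in \<open>k\<close>, using that \<open>Z k\<close> converges almost surely
  to its \<open>lim\<close>.\<close>

lemma E2_geometric_lim: "E2 M (\<lambda>x. Z m x - lim (\<lambda>k. Z k x)) \<le> ennreal (4 * (c * (2 / 3) ^ m))"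
proof -
  have m: "(\<lambda>x. ennreal ((Z m x - Z k x)\<^sup>2)) \<in> borel_measurable M" for k
    by (rule measurable_compose[OF borel_measurable_diff[OF Z Z], of _ _ m k]) simp
  have "AE x in M. ennreal ((Z m x - lim (\<lambda>k. Z k x))\<^sup>2) = liminf (\<lambda>k. ennreal ((Z m x - Z k x)\<^sup>2))"
    using AE_convergent_geometric
  proof eventually_elim
    case (elim x)
    then have "(\<lambda>k. Z k x) \<longlonglongrightarrow> lim (\<lambda>k. Z k x)" by (simp add: convergent_LIMSEQ_iff)
    then have "(\<lambda>k. ennreal ((Z m x - Z k x)\<^sup>2)) \<longlonglongrightarrow> ennreal ((Z m x - lim (\<lambda>k. Z k x))\<^sup>2)"
      by (intro tendsto_intros tendsto_ennrealI)
    then show ?case using lim_imp_Liminf[OF sequentially_bot] by metis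
  qed
  then have "E2 M (\<lambda>x. Z m x - lim (\<lambda>k. Z k x)) = (\<integral>\<^sup>+x. liminf (\<lambda>k. ennreal ((Z m x - Z k x)\<^sup>2)) \<partial>M)"
    by (rule nn_integral_cong_AE)
  also have "\<dots> \<le> liminf (\<lambda>k. E2 M (\<lambda>x. Z m x - Z k x))" by (rule nn_integral_liminf[OF m])
  also have "\<dots> \<le> limsup (\<lambda>k. E2 M (\<lambda>x. Z m x - Z k x))" by (rule Liminf_le_Limsup) simp
  also have "\<dots> \<le> ennreal (4 * (c * (2 / 3) ^ m))"
  proof (rule Limsup_bounded, rule eventually_sequentiallyI[of m])
    fix k assume "m \<le> k"
    then have "(2 / 3 :: real) ^ k \<le> (2 / 3) ^ m" by (intro power_decreasing) auto
    then have "2 * (c * (2 / 3) ^ m) + 2 * (c * (2 / 3) ^ k) \<le> 4 * (c * (2 / 3) ^ m)"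
      using mult_left_mono[OF _ c, of "(2 / 3) ^ k" "(2 / 3) ^ m"] by simp
    then show "E2 M (\<lambda>x. Z m x - Z k x) \<le> ennreal (4 * (c * (2 / 3) ^ m))"
      by (intro order_trans[OF E2_geometric_diff] ennreal_leI)
  qed
  finally show ?thesis .
qed

lemma limsup_geometric: "limsup_le (\<lambda>n. E2 M (\<lambda>x. V n x - lim (\<lambda>k. Z k x))) 0"
proof (rule limsup_le_null)
  fix e :: real assume e: "0 < e"
  \<comment> \<open>\<open>10 = 2 + 2 * 4\<close>: the error of \<open>Z m\<close> against
    \<open>V n\<close> and its error against the limit, both doubled by the triangle inequality. The
    other half of \<open>e\<close> covers the slack \<open>e / 4\<close>, likewise doubled.\<close>
  have "(\<lambda>m. 10 * (c * (2 / 3) ^ m)) \<longlonglongrightarrow> 10 * (c * 0)"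
    by (intro tendsto_intros LIMSEQ_power_zero) simp
  then have "\<forall>\<^sub>F m in sequentially. 10 * (c * (2 / 3) ^ m) < e / 2"
    by (rule order_tendstoD(2)) (use e in simp)
  then obtain m where m: "10 * (c * (2 / 3) ^ m) < e / 2" using eventually_happens' sequentially_bot by blast
  have e4: "0 < e / 4" using e by simp
  show "\<forall>\<^sub>F n in sequentially. E2 M (\<lambda>x. V n x - lim (\<lambda>k. Z k x)) \<le> ennreal e"
    using limsup_leD[OF lim e4, of m]
  proof eventually_elim
    case (elim n)
    have "E2 M (\<lambda>x. (V n x - Z m x) + (Z m x - lim (\<lambda>k. Z k x)))
      \<le> ennreal (2 * (c * (2 / 3) ^ m + e / 4) + 2 * (4 * (c * (2 / 3) ^ m)))"
      using c e by (intro E2_add_bound borel_measurable_diff V Z lim_geometric_measurable elim E2_geometric_lim) simp_all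
    also have "\<dots> \<le> ennreal e" using m by (intro ennreal_leI) simp
    finally show ?case by simp
  qed
qed

end

text \<open>If \<open>f\<close> had mean \<open>a\<close>, then \<open>V n - f\<close> would have
  mean \<open>-a\<close> and hence second moment at least \<open>a^2\<close>, contradicting an error
  of at most \<open>a^2 / 2\<close>.\<close>

lemma integral_null_of_E2:
  fixes V :: "nat \<Rightarrow> 'a \<Rightarrow> real" and f :: "'a \<Rightarrow> real"
  assumes f: "f \<in> borel_measurable M" "E2 M f \<le> ennreal B"
    and V: "\<And>n. V n \<in> borel_measurable M" "\<And>n. E2 M (V n) \<le> ennreal B'" "\<And>n. (\<integral>x. V n x \<partial>M) = 0"
    and lim: "limsup_le (\<lambda>n. E2 M (\<lambda>x. V n x - f x)) 0" and B: "0 \<le> B" "0 \<le> B'"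
  shows "(\<integral>x. f x \<partial>M) = 0"
proof (rule ccontr)
  define a where "a = (\<integral>x. f x \<partial>M)"
  assume "(\<integral>x. f x \<partial>M) \<noteq> 0"
  then have "0 < a\<^sup>2 / 2" by (simp add: a_def)
  from limsup_leD[OF lim this] obtain n where n: "E2 M (\<lambda>x. V n x - f x) \<le> ennreal (0 + a\<^sup>2 / 2)"
    using eventually_happens' sequentially_bot by blast
  have m: "(\<lambda>x. V n x - f x) \<in> borel_measurable M" by (intro borel_measurable_diff V f)
  have i: "integrable M (V n)" "integrable M f" "integrable M (\<lambda>x. V n x - f x)" "integrable M (\<lambda>x. (V n x - f x)\<^sup>2)"
    using E2_integrable'[OF V(1,2)] E2_integrable'[OF f] E2_integrable'[OF m n] E2_integrable(1)[OF m n] by auto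
  have d: "(\<integral>x. V n x - f x \<partial>M) = - a" using i V(3) by (simp add: a_def)
  have "0 \<le> (\<integral>x. ((V n x - f x) + a)\<^sup>2 \<partial>M)" by (rule Bochner_Integration.integral_nonneg) simp
  also have "\<dots> = (\<integral>x. (V n x - f x)\<^sup>2 + (2 * a * (V n x - f x) + a\<^sup>2) \<partial>M)"
    by (intro Bochner_Integration.integral_cong refl) (simp only: power2_sum, simp add: algebra_simps)
  also have "\<dots> = (\<integral>x. (V n x - f x)\<^sup>2 \<partial>M) + (2 * a * (- a) + a\<^sup>2)"
    unfolding d[symmetric] using i by (simp add: prob_space)
  finally have "a\<^sup>2 \<le> (\<integral>x. (V n x - f x)\<^sup>2 \<partial>M)" by (simp add: power2_eq_square)
  moreover have "(\<integral>x. (V n x - f x)\<^sup>2 \<partial>M) \<le> a\<^sup>2 / 2"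
    using n unfolding E2_integrable(2)[OF m n] by (subst (asm) ennreal_le_iff) auto
  ultimately show False using \<open>0 < a\<^sup>2 / 2\<close> by simp
qed

text \<open>As \<open>f\<close> is merely bounded and continuous, the argument passes through almost
  sure convergence: a subsequence violating the claim has a further subsequence that converges
  almost surely, and along it dominated convergence gives a contradiction.\<close>

lemma integral_tendsto_of_E2:
  fixes X :: "nat \<Rightarrow> 'a \<Rightarrow> real ^ 'k" and Y :: "'a \<Rightarrow> real ^ 'k" and f :: "real ^ 'k \<Rightarrow> real"
  assumes X: "\<And>n i. (\<lambda>x. X n x $ i) \<in> borel_measurable M" and Y: "\<And>i. (\<lambda>x. Y x $ i) \<in> borel_measurable M"
    and fin: "\<And>n i. E2 M (\<lambda>x. X n x $ i - Y x $ i) \<le> ennreal B"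
    and lim: "\<And>i. limsup_le (\<lambda>n. E2 M (\<lambda>x. X n x $ i - Y x $ i)) 0"
    and f: "continuous_on UNIV f" "bounded (range f)"
    and XB: "\<And>n. X n \<in> borel_measurable M" and YB: "Y \<in> borel_measurable M"
  shows "(\<lambda>n. \<integral>x. f (X n x) \<partial>M) \<longlonglongrightarrow> (\<integral>x. f (Y x) \<partial>M)"
proof (rule ccontr)
  assume "\<not> (\<lambda>n. \<integral>x. f (X n x) \<partial>M) \<longlonglongrightarrow> (\<integral>x. f (Y x) \<partial>M)"
  then obtain e where e: "0 < e" "\<not> (\<forall>\<^sub>F n in sequentially. dist (\<integral>x. f (X n x) \<partial>M) (\<integral>x. f (Y x) \<partial>M) < e)"
    unfolding tendsto_iff by blast
  from not_eventually_sequentiallyD[OF e(2)] obtain r :: "nat \<Rightarrow> nat" where r: "strict_mono r"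
    "\<And>n. \<not> dist (\<integral>x. f (X (r n) x) \<partial>M) (\<integral>x. f (Y x) \<partial>M) < e" by blast
  \<comment> \<open>Summing over the coordinates yields one further subsequence that works for all
    of them at once.\<close>
  define s where "s n x = (\<Sum>i\<in>UNIV. (X (r n) x $ i - Y x $ i)\<^sup>2)" for n x
  have dm: "(\<lambda>x. X n x $ i - Y x $ i) \<in> borel_measurable M" for n i by (intro borel_measurable_diff X Y)
  note di = E2_integrable[OF dm fin]
  have si: "integrable M (s n)" for n unfolding s_def[abs_def] by (intro Bochner_Integration.integrable_sum di(1))
  have ct: "(\<lambda>n. \<integral>x. (X (r n) x $ i - Y x $ i)\<^sup>2 \<partial>M) \<longlonglongrightarrow> 0" for i
  proof -
    have "(\<lambda>n. \<integral>x. (X n x $ i - Y x $ i)\<^sup>2 \<partial>M) \<longlonglongrightarrow> 0"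
    proof (rule tendstoI)
      fix \<epsilon> :: real assume "0 < \<epsilon>"
      then have "0 < \<epsilon> / 2" by simp
      from limsup_leD[OF lim this, of i]
      show "\<forall>\<^sub>F n in sequentially. dist (\<integral>x. (X n x $ i - Y x $ i)\<^sup>2 \<partial>M) 0 < \<epsilon>"
      proof eventually_elim
        case (elim n)
        then have "(\<integral>x. (X n x $ i - Y x $ i)\<^sup>2 \<partial>M) \<le> \<epsilon> / 2"
          unfolding di(2) using \<open>0 < \<epsilon>\<close> by (subst (asm) ennreal_le_iff) auto
        moreover have "0 \<le> (\<integral>x. (X n x $ i - Y x $ i)\<^sup>2 \<partial>M)" by (rule Bochner_Integration.integral_nonneg) simp
        ultimately show ?case using \<open>0 < \<epsilon>\<close> by (simp add: dist_real_def)
      qed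
    qed
    from LIMSEQ_subseq_LIMSEQ[OF this r(1)] show ?thesis by (simp add: o_def)
  qed
  have "(\<integral>x. norm (s n x) \<partial>M) = (\<Sum>i\<in>UNIV. \<integral>x. (X (r n) x $ i - Y x $ i)\<^sup>2 \<partial>M)" for n
  proof -
    have "norm (s n x) = s n x" for x by (simp add: s_def sum_nonneg)
    then show ?thesis using di(1) by (simp add: s_def Bochner_Integration.integral_sum)
  qed
  moreover have "(\<lambda>n. \<Sum>i\<in>UNIV. \<integral>x. (X (r n) x $ i - Y x $ i)\<^sup>2 \<partial>M) \<longlonglongrightarrow> (\<Sum>i\<in>(UNIV :: 'k set). 0)"
    by (intro tendsto_sum ct)
  ultimately have "(\<lambda>n. \<integral>x. norm (s n x) \<partial>M) \<longlonglongrightarrow> 0" by simp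
  from tendsto_L1_AE_subseq[OF si this] obtain r' :: "nat \<Rightarrow> nat"
    where r': "strict_mono r'" "AE x in M. (\<lambda>n. s (r' n) x) \<longlonglongrightarrow> 0" by blast
  obtain C where C: "\<And>y. norm (f y) \<le> C" using f(2) by (auto simp: bounded_iff)
  have fb: "f \<in> borel_measurable borel" by (rule borel_measurable_continuous_onI[OF f(1)])
  have "(\<lambda>n. \<integral>x. f (X (r (r' n)) x) \<partial>M) \<longlonglongrightarrow> (\<integral>x. f (Y x) \<partial>M)"
  proof (rule integral_dominated_convergence[where w = "\<lambda>_. C"])
    show "(\<lambda>x. f (Y x)) \<in> borel_measurable M" by (rule measurable_compose[OF YB fb])
    show "(\<lambda>x. f (X (r (r' n)) x)) \<in> borel_measurable M" for n by (rule measurable_compose[OF XB fb])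
    show "AE x in M. (\<lambda>n. f (X (r (r' n)) x)) \<longlonglongrightarrow> f (Y x)"
      using r'(2)
    proof eventually_elim
      case (elim x)
      have "(\<lambda>n. X (r (r' n)) x) \<longlonglongrightarrow> Y x"
      proof (rule vec_tendstoI)
        fix i
        have "(\<lambda>n. X (r (r' n)) x $ i - Y x $ i) \<longlonglongrightarrow> 0"
        proof (rule Lim_null_comparison)
          show "\<forall>\<^sub>F n in sequentially. norm (X (r (r' n)) x $ i - Y x $ i) \<le> sqrt (s (r' n) x)"
          proof (intro always_eventually allI)
            fix n
            have "(X (r (r' n)) x $ i - Y x $ i)\<^sup>2 \<le> s (r' n) x"
              unfolding s_def by (rule member_le_sum) auto
            then show "norm (X (r (r' n)) x $ i - Y x $ i) \<le> sqrt (s (r' n) x)"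
              by (simp add: real_le_rsqrt)
          qed
          show "(\<lambda>n. sqrt (s (r' n) x)) \<longlonglongrightarrow> 0" using tendsto_real_sqrt[OF elim] by simp
        qed
        then show "(\<lambda>n. X (r (r' n)) x $ i) \<longlonglongrightarrow> Y x $ i" by (rule LIM_zero_cancel)
      qed
      then show ?case using f(1) by (intro continuous_on_tendsto_compose[OF f(1)]) auto
    qed
  qed (use C in auto)
  from tendstoD[OF this e(1)] obtain n where
    "dist (\<integral>x. f (X (r (r' n)) x) \<partial>M) (\<integral>x. f (Y x) \<partial>M) < e"
    using eventually_happens' sequentially_bot by blast
  with r(2)[of "r' n"] show False by simp
qed

end

lemma borel_measurable_vecI:
  fixes f :: "'a \<Rightarrow> real ^ 'k"
  assumes "\<And>i. (\<lambda>x. f x $ i) \<in> borel_measurable M"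
  shows "f \<in> borel_measurable M"
  unfolding borel_measurable_euclidean_space[of f]
  using assms by (auto simp: Basis_vec_def inner_axis)

section \<open>The Quicksort process\<close>

definition Qp :: "nat \<Rightarrow> (bool list \<Rightarrow> real) \<Rightarrow> real" where
  "Qp m U = (\<Sum>w\<in>Vlt m. ell U [] w * Cfun (U w))"

lemma Vlt_0: "Vlt 0 = {}" by (simp add: Vlt_def)

text \<open>Words are split at the first letter, not the last, so that partial sums over the tree
  satisfy a recursion at the root that matches \<open>glue\<close>.\<close>

lemma Vlt_Suc: "Vlt (Suc m) = insert [] (Cons False ` Vlt m \<union> Cons True ` Vlt m)"
proof (intro set_eqI)
  fix w show "w \<in> Vlt (Suc m) \<longleftrightarrow> w \<in> insert [] (Cons False ` Vlt m \<union> Cons True ` Vlt m)"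
    by (cases w; cases "hd w") (auto simp: Vlt_def)
qed

lemma finite_Vlt: "finite (Vlt m)"
  by (induction m) (simp_all add: Vlt_0 Vlt_Suc)

lemma sum_Vlt_Suc:
  fixes f :: "bool list \<Rightarrow> real"
  shows "(\<Sum>w\<in>Vlt (Suc m). f w) = f [] + (\<Sum>w\<in>Vlt m. f (False # w)) + (\<Sum>w\<in>Vlt m. f (True # w))"
proof -
  have "(\<Sum>w\<in>Vlt (Suc m). f w) = f [] + (\<Sum>w\<in>Cons False ` Vlt m \<union> Cons True ` Vlt m. f w)"
    unfolding Vlt_Suc by (rule sum.insert) (auto simp: finite_Vlt)
  also have "(\<Sum>w\<in>Cons False ` Vlt m \<union> Cons True ` Vlt m. f w)
     = (\<Sum>w\<in>Cons False ` Vlt m. f w) + (\<Sum>w\<in>Cons True ` Vlt m. f w)"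
    by (rule sum.union_disjoint) (auto simp: finite_Vlt)
  also have "(\<Sum>w\<in>Cons False ` Vlt m. f w) = (\<Sum>w\<in>Vlt m. f (False # w))"
    by (rule sum.reindex_cong[of "Cons False"]) (auto intro: inj_onI)
  also have "(\<Sum>w\<in>Cons True ` Vlt m. f w) = (\<Sum>w\<in>Vlt m. f (True # w))"
    by (rule sum.reindex_cong[of "Cons True"]) (auto intro: inj_onI)
  finally show ?thesis by simp
qed

lemma ell_Nil[simp]: "ell U v [] = 1"
  by (simp add: ell_def)

lemma ell_Cons: "ell U [] (b # w) = (if b then 1 - U [] else U []) * ell (subtree b U) [] w"
  unfolding ell_def append_Nil subtree_def length_Cons prod.lessThan_Suc_shift nth_Cons_Suc take_Suc_Cons
    nth_Cons_0 take_0 ..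

lemma ell_shift: "ell U (b # v) w = ell (subtree b U) v w"
  unfolding ell_def subtree_def append_Cons ..

text \<open>Holds at every sample point, convergent or not, since both sides are \<open>lim\<close>
  of the same sequence. It identifies the term in \<open>Cv\<close> as the root quantity of an
  independent copy.\<close>

lemma Qv_shift: "Qv U (b # v) = Qv (subtree b U) v"
  unfolding Qv_def by (simp add: ell_shift) (simp add: subtree_def)

lemma Qv_Nil: "Qv U [] = lim (\<lambda>m. Qp m U)"
  unfolding Qv_def Qp_def by simp

lemma Qp_0: "Qp 0 U = 0" by (simp add: Qp_def Vlt_0)

lemma Qp_Suc: "Qp (Suc m) (glue u A B) = Cfun u + u * Qp m A + (1 - u) * Qp m B"
  unfolding Qp_def sum_Vlt_Suc by (simp add: ell_Cons sum_distrib_left mult.assoc)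

lemma U_component_measurable: "(\<lambda>U. U w) \<in> borel_measurable Uspace"
  by (rule measurable_Uspace_component[OF measurable_ident_sets[OF refl]])

lemma xlnx_measurable[measurable]: "xlnx \<in> borel_measurable borel"
  unfolding xlnx_def by measurable

lemma Cfun_measurable[measurable]: "Cfun \<in> borel_measurable borel"
  unfolding Cfun_def by measurable

lemma Cfun2_measurable:
  assumes [measurable]: "f \<in> borel_measurable M" "g \<in> borel_measurable M"
  shows "(\<lambda>x. Cfun2 (f x) (g x)) \<in> borel_measurable M"
  unfolding Cfun2_def by measurable

lemma ell_measurable: "(\<lambda>U. ell U v w) \<in> borel_measurable Uspace"
proof -
  have "(\<lambda>U. if w ! j then 1 - U (v @ take j w) else U (v @ take j w)) \<in> borel_measurable Uspace" for j
    by (cases "w ! j") (simp_all add: U_component_measurable borel_measurable_diff)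
  then show ?thesis unfolding ell_def by (intro borel_measurable_prod)
qed

lemma Qv_sum_measurable: "(\<lambda>U. \<Sum>w\<in>Vlt m. ell U v w * Cfun (U (v @ w))) \<in> borel_measurable Uspace"
  by (intro borel_measurable_sum borel_measurable_times ell_measurable
      measurable_compose[OF U_component_measurable Cfun_measurable])

lemma Qp_measurable: "Qp m \<in> borel_measurable Uspace"
  using Qv_sum_measurable[where m = m and v = "[]"] by (simp add: Qp_def[abs_def])

lemma Qv_measurable: "(\<lambda>U. Qv U v) \<in> borel_measurable Uspace"
  unfolding Qv_def by (rule borel_measurable_lim_metric[OF Qv_sum_measurable])

section \<open>Complete sorting: the limit \<open>Q\<close>\<close>

lemma Cfun2_1: "u \<le> 1 \<Longrightarrow> Cfun2 1 u = Cfun u"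
  by (simp add: Cfun2_def)

lemma integral_cc_idx: "2 \<le> n \<Longrightarrow> (\<integral>u. toll n n (idx n u) \<partial>unif01) = 0"
proof -
  assume n: "2 \<le> n"
  have b: "\<bar>toll n n (idx n u)\<bar> \<le> 415" for u
    using idx_bounds[of n u] n by (intro toll_bounded) auto
  have m: "(\<lambda>u. toll n n (idx n u)) \<in> borel_measurable unif01"
    using measurable_compose[OF idx_measurable[of n], of "toll n n" borel] by simp
  have i: "integrable unif01 (\<lambda>u. toll n n (idx n u))"
    by (rule unif01.integrable_const_bound[of _ 415]) (use b m in auto)
  have nn: "0 \<le> toll n n i + 415" if "i \<in> {1..n}" for i
    using toll_bounded[of n n i] n that by auto
  \<comment> \<open>Adding \<open>415\<close> makes the toll nonnegative, as
    \<open>nn_integral_idx\<close> speaks of nonnegative functions.\<close>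
  have "ennreal (\<integral>u. toll n n (idx n u) + 415 \<partial>unif01) = (\<integral>\<^sup>+u. ennreal (toll n n (idx n u) + 415) \<partial>unif01)"
  proof (rule nn_integral_eq_integral[symmetric])
    show "integrable unif01 (\<lambda>u. toll n n (idx n u) + 415)"
      by (intro Bochner_Integration.integrable_add i) simp
    have "0 \<le> toll n n (idx n u) + 415" for u using b[of u] by linarith
    then show "AE u in unif01. 0 \<le> toll n n (idx n u) + 415" by simp
  qed
  also have "\<dots> = (\<Sum>i=1..n. ennreal (toll n n i + 415)) / of_nat n"
    by (rule nn_integral_idx) (use n in simp)
  also have "(\<Sum>i=1..n. ennreal (toll n n i + 415)) = ennreal (\<Sum>i=1..n. toll n n i + 415)"
    by (rule sum_ennreal) (rule nn)
  also have "(\<Sum>i=1..n. toll n n i + 415) = 415 * real n"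
    using sum_cc[of n n] n by (simp add: sum.distrib)
  also have "ennreal (415 * real n) / of_nat n = ennreal 415"
    using n by (simp add: ennreal_of_nat_eq_real_of_nat divide_ennreal)
  finally have "(\<integral>u. toll n n (idx n u) + 415 \<partial>unif01) = 415"
    using Bochner_Integration.integral_nonneg[of unif01 "\<lambda>u. toll n n (idx n u) + 415"] nn idx_bounds[of n] n
    by (subst (asm) ennreal_inj) auto
  then show ?thesis using i by (simp add: unif01.prob_space[simplified])
qed

text \<open>No logarithm is integrated: \<open>Cfun\<close> is the bounded pointwise limit of the
  tolls for complete sorting, and those average to zero for every \<open>n\<close>.\<close>

lemma integral_Cfun: "(\<integral>u. Cfun u \<partial>unif01) = 0"
proof -
  have "(\<lambda>k. \<integral>u. toll (k + 2) (k + 2) (idx (k + 2) u) \<partial>unif01) \<longlonglongrightarrow> (\<integral>u. Cfun u \<partial>unif01)"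
  proof (rule integral_dominated_convergence[where w = "\<lambda>_. 415"])
    show "(\<lambda>u. toll (k + 2) (k + 2) (idx (k + 2) u)) \<in> borel_measurable unif01" for k
      using measurable_compose[OF idx_measurable[of "k + 2"], of "toll (k + 2) (k + 2)" borel] by simp
    show "Cfun \<in> borel_measurable unif01" using Cfun_measurable by simp
    have "\<bar>toll (k + 2) (k + 2) (idx (k + 2) u)\<bar> \<le> 415" for u k
      using idx_bounds[of "k + 2" u] by (intro toll_bounded) auto
    then show "AE u in unif01. norm (toll (k + 2) (k + 2) (idx (k + 2) u)) \<le> 415" for k by simp
    show "AE u in unif01. (\<lambda>k. toll (k + 2) (k + 2) (idx (k + 2) u)) \<longlonglongrightarrow> Cfun u"
    proof (rule AE_unif01[of 1])
      fix u :: real assume u: "0 < u" "u < 1"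
      have n: "filterlim (\<lambda>k. k + 2) sequentially sequentially" by (rule filterlim_add_const_nat_at_top)
      have "(\<lambda>k. real (k + 2) / real (k + 2)) \<longlonglongrightarrow> 1" by simp
      then have "(\<lambda>k. toll (k + 2) (k + 2) (idx (k + 2) u)) \<longlonglongrightarrow> Cfun2 1 u"
        using u idx_bounds[of "_ + 2" u] by (intro toll_tendsto n idx_limits(1)[OF n u]) auto
      then show "(\<lambda>k. toll (k + 2) (k + 2) (idx (k + 2) u)) \<longlonglongrightarrow> Cfun u" using u by (simp add: Cfun2_1)
    qed
  qed simp
  moreover have "(\<integral>u. toll (k + 2) (k + 2) (idx (k + 2) u) \<partial>unif01) = 0" for k
    by (rule integral_cc_idx) simp
  ultimately show ?thesis using LIMSEQ_unique[OF _ tendsto_const] by fastforce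
qed

lemma approxD:
  assumes "approx D K G" "t \<in> D"
  shows "G t \<in> borel_measurable Uspace" "\<exists>B\<ge>0. E2 Uspace (G t) \<le> ennreal B"
  using assms unfolding approx_def by blast+

lemma approx_limsup:
  assumes "approx D K G" "t \<in> D" "filterlim n sequentially sequentially"
    "\<And>k. l k \<le> n k" "(\<lambda>k. real (l k) / real (n k)) \<longlonglongrightarrow> t"
  shows "limsup_le (\<lambda>k. E2 Uspace (\<lambda>x. Xnorm (n k) (l k) x - G t x)) K"
  using assms unfolding approx_def by (blast intro: always_eventually)

lemma ratio_one: "(\<lambda>n. real n / real n) \<longlonglongrightarrow> 1"
proof (rule Lim_transform_eventually[OF tendsto_const])
  show "\<forall>\<^sub>F n in sequentially. 1 = real n / real n"
    using eventually_gt_at_top[of 0] by eventually_elim simp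
qed

text \<open>For the time \<open>1\<close> the contribution of the complete left part is the
  approximation itself, so \<open>Qp m\<close> serves both as \<open>G\<close> and as
  \<open>q\<close> in \<open>approx_step\<close>. Since \<open>q\<close> has to be centred, the mean
  is carried along in the induction.\<close>

lemma approx_Qp: "approx {1} (B0 * (2 / 3) ^ m) (\<lambda>_. Qp m) \<and> (\<integral>U. Qp m U \<partial>Uspace) = 0"
proof (induction m)
  case 0
  then show ?case using approx_zero[of "{1}"] by (simp add: Qp_0[abs_def] fun_eq_iff)
next
  case (Suc m)
  then have ap: "approx {1} (B0 * (2 / 3) ^ m) (\<lambda>_. Qp m)" and z: "(\<integral>U. Qp m U \<partial>Uspace) = 0" by auto
  from approxD(2)[OF ap] obtain B where B: "0 \<le> B" "E2 Uspace (Qp m) \<le> ennreal B" by auto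
  have l: "limsup_le (\<lambda>n. E2 Uspace (\<lambda>x. Xnorm n n x - Qp m x)) (B0 * (2 / 3) ^ m)"
    by (rule approx_limsup[OF ap _ _ _ ratio_one]) (auto simp: filterlim_ident)
  have "approx {1} (2 / 3 * (B0 * (2 / 3) ^ m)) (\<lambda>_. Qp (Suc m))"
  proof (rule approx_step[OF _ _ _ ap Qp_measurable B(2,1) z l Qp_measurable])
    fix t u :: real and A B' assume "t \<in> {1}" "0 < u" "u < 1"
    then show "Qp (Suc m) (glue u A B') = stepf t u (\<lambda>_. Qp m) (Qp m) A B'"
      by (simp add: Qp_Suc stepf_def Cfun2_1)
  qed auto
  then have ap': "approx {1} (B0 * (2 / 3) ^ Suc m) (\<lambda>_. Qp (Suc m))" by (simp add: mult_ac)
  from approxD(2)[OF ap'] obtain B' where B': "E2 Uspace (Qp (Suc m)) \<le> ennreal B'" by auto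
  have i: "integrable Uspace (Qp k)" if "E2 Uspace (Qp k) \<le> ennreal b" for k b
    by (rule U.E2_integrable'[OF Qp_measurable that])
  have im: "integrable Uspace (Qp m)" by (rule i[OF B(2)])
  have "(\<integral>B. Cfun u + u * Qp m A + (1 - u) * Qp m B \<partial>Uspace) = Cfun u + u * Qp m A" for u A
    using im z by (simp add: U.prob_space[simplified])
  moreover have "(\<integral>A. Cfun u + u * Qp m A \<partial>Uspace) = Cfun u" for u
    using im z by (simp add: U.prob_space[simplified])
  ultimately have "(\<integral>U. Qp (Suc m) U \<partial>Uspace) = (\<integral>u. Cfun u \<partial>unif01)"
    by (subst integral_Uspace[OF i[OF B']]) (simp only: Qp_Suc)
  then show ?case using ap' integral_Cfun by simp
qed

definition Qinf :: "(bool list \<Rightarrow> real) \<Rightarrow> real" where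
  "Qinf U = Qv U []"

lemma Qinf_measurable: "Qinf \<in> borel_measurable Uspace"
  unfolding Qinf_def[abs_def] by (rule Qv_measurable)

lemma Qinf_limsup: "limsup_le (\<lambda>n. E2 Uspace (\<lambda>x. Xnorm n n x - Qinf x)) 0"
proof -
  have "limsup_le (\<lambda>n. E2 Uspace (\<lambda>x. Xnorm n n x - Qp m x)) (B0 * (2 / 3) ^ m)" for m
    by (rule approx_limsup[OF conjunct1[OF approx_Qp] _ _ _ ratio_one]) (auto simp: filterlim_ident)
  from U.limsup_geometric[OF Xnorm_measurable Qp_measurable B0_nonneg this] show ?thesis
    by (simp only: Qinf_def Qv_Nil)
qed

text \<open>One index \<open>n\<close> with error at most \<open>1\<close> suffices, because the
  second moments of \<open>Xnorm\<close> are bounded by \<open>B0\<close>.\<close>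

lemma E2_limit_bounded:
  assumes f: "f \<in> borel_measurable Uspace" and l: "\<And>n. l n \<le> n"
    and lim: "limsup_le (\<lambda>n. E2 Uspace (\<lambda>x. Xnorm n (l n) x - f x)) 0"
  shows "E2 Uspace f \<le> ennreal (2 * B0 + 2)"
proof -
  from limsup_leD[OF lim, of 1] obtain n where n: "E2 Uspace (\<lambda>x. Xnorm n (l n) x - f x) \<le> ennreal 1"
    using eventually_happens'[OF sequentially_bot] by fastforce
  have "E2 Uspace (\<lambda>x. Xnorm n (l n) x - (Xnorm n (l n) x - f x)) \<le> ennreal (2 * B0 + 2 * 1)"
    by (intro E2_diff_bound borel_measurable_diff Xnorm_measurable f Xnorm_E2 l n B0_nonneg) simp
  then show ?thesis by simp
qed

lemma Qinf_E2: "E2 Uspace Qinf \<le> ennreal (2 * B0 + 2)"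
  by (rule E2_limit_bounded[OF Qinf_measurable _ Qinf_limsup]) simp

lemma Qinf_mean: "(\<integral>U. Qinf U \<partial>Uspace) = 0"
  by (rule U.integral_null_of_E2[OF Qinf_measurable Qinf_E2 Xnorm_measurable Xnorm_E2 Xnorm_mean Qinf_limsup])
    (use B0_nonneg in auto)

section \<open>The partial sums of the Quicksort process\<close>

lemma Tv_shift: "Tv U (b # v) i = Tv (subtree b U) v i"
  by (simp add: Tv_def subtree_def)

lemma Lv_shift: "Lv U (b # v) w h = Lv (subtree b U) v w h"
  by (induction w arbitrary: v) (simp_all add: Tv_shift)

lemma Cv_shift: "Cv U (b # v) = Cv (subtree b U) v"
  by (rule ext) (simp add: Cv_def Qv_shift subtree_def)

lemma T1_sum: "(\<Sum>w\<in>S. T1 u (h w) t) = T1 u (\<lambda>s. \<Sum>w\<in>S. h w s) t"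
  by (simp add: T1_def sum_distrib_left)

lemma T2_sum: "(\<Sum>w\<in>S. T2 u (h w) t) = T2 u (\<lambda>s. \<Sum>w\<in>S. h w s) t"
  by (simp add: T2_def sum_distrib_left)

lemma Rm_Suc: "Rm U [] (Suc m) t = Cv U [] t + T1 (U []) (Rm (subtree False U) [] m) t + T2 (U []) (Rm (subtree True U) [] m) t"
  unfolding Rm_def sum_Vlt_Suc by (simp add: Tv_def T1_sum T2_sum Lv_shift Cv_shift)

text \<open>\<open>Cv\<close> contains the full limit for the left subtree, so \<open>q\<close> is
  \<open>Qinf\<close> at every level \<open>m\<close>; this is why \<open>Qinf\<close> is settled
  before the process. For times in the half-open unit interval and \<open>u \<noteq> t\<close>, the
  truncations by \<open>min\<close> and \<open>max\<close> have no effect.\<close>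

lemma Rm_glue:
  assumes t: "0 < t" "t \<le> 1" and u: "0 < u" "u < 1" "u \<noteq> t"
  shows "Rm (glue u A B) [] (Suc m) t = stepf t u (\<lambda>t U. Rm U [] m t) Qinf A B"
proof (cases "t < u")
  case True
  then have "min 1 (t / u) = t / u" using t u by simp
  then show ?thesis using True by (simp add: Rm_Suc stepf_def Cv_def T1_def T2_def)
next
  case False
  then have "max 0 ((t - u) / (1 - u)) = (t - u) / (1 - u)" using t u by simp
  then show ?thesis using False by (simp add: Rm_Suc stepf_def Cv_def T1_def T2_def Qinf_def Qv_shift)
qed

lemma Cv_measurable:
  assumes [measurable]: "f \<in> borel_measurable Uspace"
  shows "(\<lambda>U. Cv U v (f U)) \<in> borel_measurable Uspace"
proof -
  note [measurable] = U_component_measurable Qv_measurable Cfun2_measurable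
  show ?thesis unfolding Cv_def by measurable
qed

text \<open>The time argument is allowed to be random because each operator rescales it by the
  variable at its node; for a fixed time the induction would not go through.\<close>

lemma Lv_measurable:
  "f \<in> borel_measurable Uspace \<Longrightarrow> (\<lambda>U. Lv U v w (Cv U (v @ w)) (f U)) \<in> borel_measurable Uspace"
proof (induction w arbitrary: v f)
  case Nil
  then show ?case using Cv_measurable by simp
next
  case (Cons i w)
  note [measurable] = Cons.prems U_component_measurable
  have a: "(\<lambda>U. min 1 (f U / U v)) \<in> borel_measurable Uspace" by measurable
  have b: "(\<lambda>U. max 0 ((f U - U v) / (1 - U v))) \<in> borel_measurable Uspace" by measurable
  note [measurable] = Cons.IH[OF a, of "v @ [i]"] Cons.IH[OF b, of "v @ [i]"]
  have 1: "(\<lambda>U. if f U < U v then U v * Lv U (v @ [i]) w (Cv U ((v @ [i]) @ w)) (min 1 (f U / U v)) else 0)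
      \<in> borel_measurable Uspace" by measurable
  have 2: "(\<lambda>U. if f U \<ge> U v then (1 - U v) * Lv U (v @ [i]) w (Cv U ((v @ [i]) @ w)) (max 0 ((f U - U v) / (1 - U v))) else 0)
      \<in> borel_measurable Uspace" by measurable
  show ?case
    using 1 2 by (cases i) (simp_all only: Lv.simps Tv_def T1_def T2_def if_True if_False append_assoc append_Cons append_Nil)
qed

lemma Rm_measurable: "(\<lambda>U. Rm U [] m t) \<in> borel_measurable Uspace"
proof -
  have "(\<lambda>U. Lv U [] w (Cv U ([] @ w)) t) \<in> borel_measurable Uspace" for w
    by (rule Lv_measurable) simp
  then show ?thesis unfolding Rm_def by (intro borel_measurable_sum)
qed

lemma approx_Rm: "approx {0<..1} (B0 * (2 / 3) ^ m) (\<lambda>t U. Rm U [] m t)"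
proof (induction m)
  case 0
  then show ?case using approx_zero[of "{0<..1}"] by (simp add: Rm_def Vlt_0)
next
  case (Suc m)
  have "approx {0<..1} (2 / 3 * (B0 * (2 / 3) ^ m)) (\<lambda>t U. Rm U [] (Suc m) t)"
  proof (rule approx_step[OF order_refl _ _ Suc Qinf_measurable Qinf_E2 _ Qinf_mean _ Rm_measurable])
    show "0 \<le> 2 * B0 + 2" using B0_nonneg by simp
    show "limsup_le (\<lambda>n. E2 Uspace (\<lambda>x. Xnorm n n x - Qinf x)) (B0 * (2 / 3) ^ m)"
      by (rule limsup_le_mono[OF Qinf_limsup]) (use B0_nonneg in simp)
    show "Rm (glue u A B) [] (Suc m) t = stepf t u (\<lambda>t U. Rm U [] m t) Qinf A B"
      if "t \<in> {0<..1}" "0 < u" "u < 1" "u \<noteq> t" for t u A B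
      using that by (intro Rm_glue) auto
    show "t / u \<in> {0<..1}" if "t \<in> {0<..1}" "u < 1" "t < u" for t u :: real
      using that by auto
    show "(t - u) / (1 - u) \<in> {0<..1}" if "t \<in> {0<..1}" "0 < u" "u < t" "u < 1" for t u :: real
      using that by auto
  qed
  then show ?case by (simp add: mult_ac)
qed

lemma Yproc_measurable: "(\<lambda>U. Yproc U t) \<in> borel_measurable Uspace"
  unfolding Yproc_def by (rule borel_measurable_lim_metric[OF Rm_measurable])

section \<open>Convergence of the finite dimensional distributions\<close>

lemma floor_mult_le: "0 \<le> t \<Longrightarrow> t \<le> 1 \<Longrightarrow> nat \<lfloor>real n * t\<rfloor> \<le> n"
proof -
  assume t: "0 \<le> t" "t \<le> 1"
  have "real n * t \<le> real n" using t by (simp add: mult_left_le)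
  then have "\<lfloor>real n * t\<rfloor> \<le> int n" by linarith
  then show ?thesis by simp
qed

lemma floor_ratio: "0 < t \<Longrightarrow> (\<lambda>n. real (nat \<lfloor>real n * t\<rfloor>) / real n) \<longlonglongrightarrow> t"
proof -
  assume t: "0 < t"
  have z: "(\<lambda>n. 1 / real n) \<longlonglongrightarrow> 0" by (rule lim_1_over_n)
  have b: "\<forall>\<^sub>F n in sequentially. t - 1 / real n \<le> real (nat \<lfloor>real n * t\<rfloor>) / real n \<and> real (nat \<lfloor>real n * t\<rfloor>) / real n \<le> t"
    using eventually_gt_at_top[of 0]
  proof eventually_elim
    case (elim n)
    have "0 \<le> real n * t" using t by simp
    then have "real n * t - 1 \<le> real (nat \<lfloor>real n * t\<rfloor>)" "real (nat \<lfloor>real n * t\<rfloor>) \<le> real n * t" by linarith+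
    then have "(real n * t - 1) / real n \<le> real (nat \<lfloor>real n * t\<rfloor>) / real n"
      "real (nat \<lfloor>real n * t\<rfloor>) / real n \<le> real n * t / real n"
      by (simp_all only: divide_right_mono of_nat_0_le_iff)
    then show ?case using elim by (simp add: diff_divide_distrib)
  qed
  have "(\<lambda>n. t - 1 / real n) \<longlonglongrightarrow> t - 0" by (intro tendsto_intros z)
  then have "(\<lambda>n. t - 1 / real n) \<longlonglongrightarrow> t" by simp
  then show ?thesis by (rule tendsto_sandwich[rotated 2, OF _ tendsto_const]) (use b in \<open>auto elim: eventually_mono\<close>)
qed

lemma Yproc_limsup:
  assumes "0 < t" "t \<le> 1"
  shows "limsup_le (\<lambda>n. E2 Uspace (\<lambda>U. Xnorm n (nat \<lfloor>real n * t\<rfloor>) U - Yproc U t)) 0"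
proof -
  have "limsup_le (\<lambda>n. E2 Uspace (\<lambda>x. Xnorm n (nat \<lfloor>real n * t\<rfloor>) x - Rm x [] m t)) (B0 * (2 / 3) ^ m)" for m
    by (rule approx_limsup[OF approx_Rm _ _ _ floor_ratio])
      (use assms floor_mult_le in \<open>auto simp: filterlim_ident\<close>)
  from U.limsup_geometric[OF Xnorm_measurable Rm_measurable B0_nonneg this] show ?thesis
    by (simp only: Yproc_def)
qed

lemma Yn_Xf: "0 \<le> t \<Longrightarrow> t \<le> 1 \<Longrightarrow> Yn n (Xf n U) t = Xnorm n (nat \<lfloor>real n * t\<rfloor>) U"
  by (simp add: Yn_def Xnorm_def Xcent_def expectation_qs floor_mult_le Let_def)

theorem theorem2:
  fixes t :: "'k::finite \<Rightarrow> real"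
  assumes "\<And>i. 0 < t i \<and> t i \<le> 1"
  shows "conv_in_dist
           (\<lambda>n. measure_pmf (map_pmf (\<lambda>x. (\<chi> i. Yn n x (t i)) :: real ^ 'k) (qs n)))
           (distr Uspace borel (\<lambda>U. (\<chi> i. Yproc U (t i)) :: real ^ 'k))"
  unfolding conv_in_dist_def
proof (intro allI impI)
  fix f :: "real ^ 'k \<Rightarrow> real"
  assume "continuous_on UNIV f \<and> bounded (range f)"
  then have f: "continuous_on UNIV f" "bounded (range f)" by auto
  have fb: "f \<in> borel_measurable borel" by (rule borel_measurable_continuous_onI[OF f(1)])
  define X :: "nat \<Rightarrow> (bool list \<Rightarrow> real) \<Rightarrow> real ^ 'k" where
    "X n U = (\<chi> i. Xnorm n (nat \<lfloor>real n * t i\<rfloor>) U)" for n U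
  define Y :: "(bool list \<Rightarrow> real) \<Rightarrow> real ^ 'k" where "Y U = (\<chi> i. Yproc U (t i))" for U
  have Xi: "(\<lambda>U. X n U $ i) \<in> borel_measurable Uspace" for n i
    by (simp add: X_def Xnorm_measurable)
  have Yi: "(\<lambda>U. Y U $ i) \<in> borel_measurable Uspace" for i
    by (simp add: Y_def Yproc_measurable)
  have l: "nat \<lfloor>real n * t i\<rfloor> \<le> n" for n i using assms[of i] by (intro floor_mult_le) auto
  have lim: "limsup_le (\<lambda>n. E2 Uspace (\<lambda>U. X n U $ i - Y U $ i)) 0" for i
    using Yproc_limsup assms[of i] by (simp add: X_def Y_def)
  have "E2 Uspace (\<lambda>U. Yproc U (t i)) \<le> ennreal (2 * B0 + 2)" for i
    using Yproc_limsup assms[of i] by (intro E2_limit_bounded[OF Yproc_measurable l]) auto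
  then have fin: "E2 Uspace (\<lambda>U. X n U $ i - Y U $ i) \<le> ennreal (2 * B0 + 2 * (2 * B0 + 2))" for n i
    unfolding X_def Y_def vec_lambda_beta
    by (intro E2_diff_bound Xnorm_measurable Yproc_measurable Xnorm_E2 l) (use B0_nonneg in auto)
  have XB: "X n \<in> borel_measurable Uspace" and YB: "Y \<in> borel_measurable Uspace" for n
    by (intro borel_measurable_vecI Xi Yi)+
  have "(\<lambda>n. \<integral>U. f (X n U) \<partial>Uspace) \<longlonglongrightarrow> (\<integral>U. f (Y U) \<partial>Uspace)"
    by (rule U.integral_tendsto_of_E2[OF Xi Yi fin lim f XB YB])
  moreover have "(\<integral>x. f x \<partial>distr Uspace borel (\<lambda>U. \<chi> i. Yproc U (t i))) = (\<integral>U. f (Y U) \<partial>Uspace)"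
    unfolding Y_def[symmetric] by (rule integral_distr[OF YB fb])
  \<comment> \<open>Only the law of the costs enters on the left, so \<open>integral_Xf\<close> may
    replace it by the coupled realisation; the centring agrees because \<open>meanX\<close> is the
    true expectation for ranks up to \<open>n\<close>.\<close>
  moreover have "(\<integral>x. f x \<partial>measure_pmf (map_pmf (\<lambda>x. \<chi> i. Yn n x (t i)) (qs n))) = (\<integral>U. f (X n U) \<partial>Uspace)" for n
  proof -
    have "(\<lambda>x. (\<chi> i. Yn n x (t i)) :: real ^ 'k) \<in> borel_measurable NN"
    proof (rule borel_measurable_vecI)
      fix i
      have "(\<lambda>x. real (x k)) \<in> borel_measurable NN" for k
        by (rule measurable_compose[OF measurable_component_singleton]) simp_all
      then show "(\<lambda>x. ((\<chi> i. Yn n x (t i)) :: real ^ 'k) $ i) \<in> borel_measurable NN"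
        unfolding Yn_def Let_def vec_lambda_beta
        by (intro borel_measurable_divide borel_measurable_diff borel_measurable_const)
    qed
    then have m: "(\<lambda>x. f (\<chi> i. Yn n x (t i))) \<in> borel_measurable NN"
      by (rule measurable_compose[OF _ fb])
    have "(\<integral>x. f x \<partial>measure_pmf (map_pmf (\<lambda>x. \<chi> i. Yn n x (t i)) (qs n)))
      = measure_pmf.expectation (qs n) (\<lambda>x. f (\<chi> i. Yn n x (t i)))" by (rule integral_map_pmf)
    also have "\<dots> = (\<integral>U. f (\<chi> i. Yn n (Xf n U) (t i)) \<partial>Uspace)" by (rule integral_Xf[OF m, symmetric])
    also have "(\<lambda>U. f (\<chi> i. Yn n (Xf n U) (t i))) = (\<lambda>U. f (X n U))"
      using assms by (simp add: X_def Yn_Xf less_imp_le)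
    finally show ?thesis .
  qed
  ultimately show "(\<lambda>n. \<integral>x. f x \<partial>measure_pmf (map_pmf (\<lambda>x. \<chi> i. Yn n x (t i)) (qs n)))
     \<longlonglongrightarrow> (\<integral>x. f x \<partial>distr Uspace borel (\<lambda>U. \<chi> i. Yproc U (t i)))" by simp
qed

end
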